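(* There exists $\epsilon>0$ such that the following holds. Let admissible initial data be given at $\{\eta=0\}$ and let $(\tilde\phi,\tilde A)$ be its Maxwell-scalar field development on $\mathrm{dS}_4$. (1) If $\mathrm{S}_2[\tilde\phi,\tilde{\mathbf{A}}](\eta=0)\leq\epsilon$, then $$|\tilde\phi|\lesssim e^{-H|\eta|},\qquad |\tilde A_\eta|\lesssim e^{-H|\eta|},\qquad |\tilde{\mathbf{A}}|_{\mathfrak{s}_3}\lesssim1\qquad\text{as }|\eta|\to\infty,$$ and, in the static coordinates, $$|\tilde\phi|\lesssim_re^{-H|t|},\qquad|\tilde A_t|\lesssim_re^{-H|t|},\qquad|\tilde A_r|\lesssim_re^{-H|t|},\qquad\frac1r|\tilde A|_{\mathfrak{s}_2}\lesssim_re^{-H|t|}$$ as $|t|\to\infty$ with $r$ fixed. (2) If moreover $\mathrm{S}_3[\tilde\phi,\tilde{\mathbf{A}}](\eta=0)\leq\epsilon$, then there exists a constant $c$ such that $$\tilde\phi = c\,\tilde\Phi_1+\mathcal{O}(e^{-2Ht})\qquad\text{as }t\to+\infty\ (r\text{ fixed}),$$ where $\tilde\Phi_1=F(r)^{-1/2}e^{-Ht}$, $F(r)=1-H^2r^2$, which is a solution of the linear uncharged conformally invariant wave equation $(\tilde\Box+\tfrac16\tilde R)\tilde\Phi_1=0$ on $\mathrm{dS}_4$.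
   Context: Fix $H>0$. De Sitter space $\mathrm{dS}_4=\mathbb{R}_\eta\times\mathbb{S}^3$ has metric $\tilde g=d\eta^2-H^{-2}\cosh^2(H\eta)\,\mathfrak{s}_3$ (signature $(+,-,-,-)$), with $\mathfrak{s}_3$ the round unit metric on $\mathbb{S}^3$. With $\tan(\tau/2)=\tanh(H\eta/2)$, $\tau\in(-\pi/2,\pi/2)$, and $\Omega=H\cos\tau=H/\cosh(H\eta)$ one has $\Omega^2\tilde g=d\tau^2-\mathfrak{s}_3$. $\tilde\Box$ and $\tilde R$ are the wave operator and scalar curvature of $\tilde g$, with the curvature sign convention in which $\tilde R=12H^2>0$. Write $\mathfrak{s}_3=d\zeta^2+\sin^2\zeta\,\mathfrak{s}_2$, $\zeta\in[0,\pi]$, with $\mathfrak{s}_2$ the round unit metric on $\mathbb{S}^2$. Static coordinates $(t,r,\omega)$, $\omega\in\mathbb{S}^2$, $0<r<1/H$, are used in the static region containing the South Pole $\{\zeta=\pi\}$ (where $\sin\zeta<\cos\tau$, $\zeta>\pi/2$) and are given by $r=\frac{\sin\zeta}{H\cos\tau}$, $\tanh(Ht)=\frac{\sin\tau}{|\cos\zeta|}$; then $\tilde g=F(r)dt^2-F(r)^{-1}dr^2-r^2\mathfrak{s}_2$. Fields: $\tilde\phi$ is a complex scalar field and $\tilde A$ a real 1-form on $\mathrm{dS}_4$. The rescaled fields are $\phi=\Omega^{-1}\tilde\phi$, $A=\tilde A$, with $A=A_0\,d\tau+\mathbf{A}$, and $\tilde A=\tilde A_\eta\,d\eta+\tilde{\mathbf{A}}$,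 $\mathbf{A}$, $\tilde{\mathbf{A}}$ tangential to $\mathbb{S}^3$. $|\tilde{\mathbf{A}}|_{\mathfrak{s}_3}$ is the $\mathfrak{s}_3$-norm; $\tilde A_t,\tilde A_r$ are the components of $\tilde A$ in static coordinates and $|\tilde A|_{\mathfrak{s}_2}$ the $\mathfrak{s}_2$-norm of its part tangential to the $\mathbb{S}^2$ factor. $(\tilde\phi,\tilde A)$ is a Maxwell-scalar field development if the rescaled fields solve on $[-\pi/2,\pi/2]\times\mathbb{S}^3$ the Maxwell-scalar field system in strong Coulomb gauge (dot $=\partial_\tau$; $\mathring{\nabla},\mathring{\Delta}$ the connection and Laplacian of $\mathfrak{s}_3$; $\Box=\partial_\tau^2-\mathring{\Delta}$): $$\Box\phi+2iA_0\dot\phi-2i\mathbf{A}\cdot\mathring{\nabla}\phi+(1-A_0^2+|\mathbf{A}|^2+i\dot A_0)\phi=0,$$ $$\Box\mathbf{A}+(2+|\phi|^2)\mathbf{A}=-\operatorname{Im}(\bar\phi\mathring{\nabla}\phi)+\mathring{\nabla}\dot A_0,$$ $$-\mathring{\Delta}A_0+|\phi|^2A_0=-\operatorname{Im}(\bar\phi\dot\phi),\qquad\mathring{\nabla}\cdot\mathbf{A}=0,\qquad\int_{\mathbb{S}^3}A_0(\tau)\,\mathrm{dv}_{\mathfrak{s}_3}=0\ \text{for all }\tau,$$ with $(\phi,\mathbf{A},A_0)\in\bigcap_{k=0}^mC^k_b([-\pi/2,\pi/2];H^{m-k}(\mathbb{S}^3))$, where $m=2$ in (1) and $m=3$ in (2).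 Data at $\{\eta=0\}=\{\tau=0\}$ is admissible if the rescaled data satisfies $\mathring{\nabla}\cdot\mathbf{A}=\mathring{\nabla}\cdot\dot{\mathbf{A}}=0$, $\int_{\mathbb{S}^3}A_0\,\mathrm{dv}_{\mathfrak{s}_3}=0$, and $-\mathring{\Delta}A_0+|\phi|^2A_0=-\operatorname{Im}(\bar\phi\dot\phi)$ there. $\mathrm{S}_m[\tilde\phi,\tilde{\mathbf{A}}](\eta=0)=\|\partial_\eta\tilde\phi\|_{H^{m-1}}^2+\|\tilde\phi\|_{H^m}^2+\|\partial_\eta\tilde{\mathbf{A}}\|_{H^{m-1}}^2+\|\tilde{\mathbf{A}}\|_{H^m}^2$ with norms on $\mathbb{S}^3$ at $\eta=0$. $X\lesssim Y$ means $X\le CY$ with $C$ independent of the spacetime point; $\lesssim_r$ means $C$ may depend on $r$. *)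

theory Defs
  imports "HOL-Analysis.Analysis"
begin

section \<open>The round three-sphere\<close>

text \<open>The sphere is the unit sphere of \<open>\<real>\<^sup>4\<close> with the induced metric. Functions and fields on it are
  functions on \<open>\<real>\<^sup>4\<close> of which only the values on the sphere matter. One-forms are identified with
  tangent vector fields, that is, with \<open>\<real>\<^sup>4\<close>-valued maps \<open>A\<close> such that \<open>A x \<bullet> x = 0\<close>.\<close>

abbreviation S3 :: "(real^4) set" where
  "S3 \<equiv> sphere 0 1"

abbreviation S2 :: "(real^3) set" where
  "S2 \<equiv> sphere 0 1"

text \<open>Surface measure as a cone measure: the area of \<open>E\<close> is four times the Lebesgue measure of the
  cone \<open>{r x | 0 < r < 1, x \<in> E}\<close>. The projection \<open>x \<mapsto> x / |x|\<close> is \<^const>\<open>sgn\<close>.\<close>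

definition vol3 :: "(real^4) measure" where
  "vol3 = scale_measure 4
     (distr (restrict_space lborel (ball 0 1 - {0})) (restrict_space borel S3) sgn)"

text \<open>A global orthonormal frame of the tangent spaces of the sphere: in terms of quaternions it is
  \<open>x \<mapsto> x i, x j, x k\<close>. Its members are Killing fields, hence divergence free.\<close>

definition frame :: "3 \<Rightarrow> real^4 \<Rightarrow> real^4" where
  "frame i x =
     (if i = 1 then vector [- x$2, x$1, x$4, - x$3]
      else if i = 2 then vector [- x$3, - x$4, x$1, x$2]
      else vector [- x$4, x$3, - x$2, x$1])"

lemma vector_4_nth [simp]:
  "(vector [a, b, c, d] :: 'a::zero^4) $ 1 = a"
  "(vector [a, b, c, d] :: 'a^4) $ 2 = b"
  "(vector [a, b, c, d] :: 'a^4) $ 3 = c"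
  "(vector [a, b, c, d] :: 'a^4) $ 4 = d"
  by (simp_all add: vector_def)

lemma frame_orthonormal:
  assumes "x \<in> S3"
  shows "frame i x \<bullet> x = 0" and "frame i x \<bullet> frame j x = (if i = j then 1 else 0)"
proof -
  have "(norm x)\<^sup>2 = 1" using assms by simp
  then have n: "x$1 * x$1 + x$2 * x$2 + x$3 * x$3 + x$4 * x$4 = 1"
    by (simp add: power2_norm_eq_inner inner_vec_def sum_4)
  show "frame i x \<bullet> x = 0"
    by (simp add: frame_def inner_vec_def sum_4 algebra_simps)
  have "\<forall>i j. frame i x \<bullet> frame j x = (if i = j then 1 else 0)"
    using n by (simp add: forall_3 frame_def inner_vec_def sum_4 algebra_simps)
  then show "frame i x \<bullet> frame j x = (if i = j then 1 else 0)" by blast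
qed

text \<open>Connection coefficients \<open>\<langle>\<nabla>\<^bsub>e\<^sub>i\<^esub> e\<^sub>j, e\<^sub>k\<rangle>\<close>: the Levi-Civita connection of the induced metric is the
  tangential part of the flat derivative of \<open>\<real>\<^sup>4\<close>.\<close>

definition conn :: "3 \<Rightarrow> 3 \<Rightarrow> 3 \<Rightarrow> real^4 \<Rightarrow> real" where
  "conn i j k x = frechet_derivative (frame j) (at x) (frame i x) \<bullet> frame k x"

section \<open>Tensor fields and Sobolev spaces on the sphere\<close>

text \<open>A covariant tensor field \<open>T\<close> of rank \<open>r\<close> is given by its frame components
  \<open>T [j\<^sub>1,\<dots>,j\<^sub>r] = T (e\<^bsub>j\<^sub>1\<^esub>,\<dots>,e\<^bsub>j\<^sub>r\<^esub>)\<close>; components at lists of another length are irrelevant.\<close>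

type_synonym 'b tensor = "3 list \<Rightarrow> real^4 \<Rightarrow> 'b"

definition scal :: "(real^4 \<Rightarrow> 'b) \<Rightarrow> 'b tensor" where
  "scal f = (\<lambda>js. f)"

definition oneform :: "(real^4 \<Rightarrow> real^4) \<Rightarrow> real tensor" where
  "oneform A = (\<lambda>js x. A x \<bullet> frame (hd js) x)"

definition L2 :: "(real^4 \<Rightarrow> 'b::euclidean_space) \<Rightarrow> bool" where
  "L2 u \<longleftrightarrow> u \<in> borel_measurable vol3 \<and> integrable vol3 (\<lambda>x. (norm (u x))\<^sup>2)"

text \<open>\<open>v\<close> is the weak derivative of \<open>u\<close> along \<open>e\<^sub>i\<close>. The test functions \<open>\<psi>\<close> are the continuously
  differentiable ones. As \<open>e\<^sub>i\<close> is divergence free, there is no zeroth order term.\<close>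

definition weak_deriv :: "3 \<Rightarrow> (real^4 \<Rightarrow> 'b::euclidean_space) \<Rightarrow> (real^4 \<Rightarrow> 'b) \<Rightarrow> bool" where
  "weak_deriv i u v \<longleftrightarrow> L2 u \<and> L2 v \<and>
     (\<forall>(\<psi> :: real^4 \<Rightarrow> real) D :: real^4 \<Rightarrow> ((real^4) \<Rightarrow>\<^sub>L real).
        (\<forall>x. (\<psi> has_derivative blinfun_apply (D x)) (at x)) \<and> continuous_on UNIV D \<longrightarrow>
        (LINT x|vol3. \<psi> x *\<^sub>R v x) = - (LINT x|vol3. D x (frame i x) *\<^sub>R u x))"

text \<open>Weak derivatives are unique up to null sets; a representative is chosen.\<close>

definition wd :: "3 \<Rightarrow> (real^4 \<Rightarrow> 'b::euclidean_space) \<Rightarrow> real^4 \<Rightarrow> 'b" where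
  "wd i u = (SOME v. weak_deriv i u v)"

text \<open>Covariant derivative; the index of differentiation comes first. The formula is
  \<open>(\<nabla>\<^sub>i T)(e\<^bsub>j\<^sub>1\<^esub>,\<dots>) = e\<^sub>i (T(e\<^bsub>j\<^sub>1\<^esub>,\<dots>)) - \<Sum>\<^sub>l T(\<dots>, \<nabla>\<^bsub>e\<^sub>i\<^esub> e\<^bsub>j\<^sub>l\<^esub>, \<dots>)\<close>.\<close>

fun cov :: "'b::euclidean_space tensor \<Rightarrow> 'b tensor" where
  "cov T [] = (\<lambda>x. 0)"
| "cov T (i # js) = (\<lambda>x. wd i (T js) x
     - (\<Sum>l<length js. \<Sum>m\<in>UNIV. conn i (js ! l) m x *\<^sub>R T (js[l := m]) x))"

definition lap :: "'b::euclidean_space tensor \<Rightarrow> 'b tensor" where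
  "lap T = (\<lambda>js x. \<Sum>i\<in>UNIV. cov (cov T) (i # i # js) x)"

definition divg :: "'b::euclidean_space tensor \<Rightarrow> real^4 \<Rightarrow> 'b" where
  "divg T x = (\<Sum>i\<in>UNIV. cov T [i, i] x)"

text \<open>The Sobolev space \<open>H\<^sup>s\<close> of tensor fields of rank \<open>r\<close>, and its norm
  \<open>(\<Sum>\<^bsub>k\<le>s\<^esub> \<parallel>\<nabla>\<^sup>k T\<parallel>\<^sup>2)\<^sup>1\<^sup>/\<^sup>2\<close>.\<close>

definition in_H :: "nat \<Rightarrow> nat \<Rightarrow> 'b::euclidean_space tensor \<Rightarrow> bool" where
  "in_H r s T \<longleftrightarrow>
     (\<forall>k\<le>s. \<forall>js. length js = r + k \<longrightarrow> L2 ((cov ^^ k) T js)) \<and>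
     (\<forall>k<s. \<forall>js i. length js = r + k \<longrightarrow> (\<exists>v. weak_deriv i ((cov ^^ k) T js) v))"

definition Hnorm :: "nat \<Rightarrow> nat \<Rightarrow> 'b::euclidean_space tensor \<Rightarrow> real" where
  "Hnorm r s T = sqrt (\<Sum>k\<le>s. \<Sum>js\<in>{js. length js = r + k}.
     (LINT x|vol3. (norm ((cov ^^ k) T js x))\<^sup>2))"

section \<open>Time-dependent tensor fields\<close>

text \<open>\<open>V\<close> is the time derivative of the curve \<open>U\<close> at \<open>\<tau>\<close>, as a curve in \<open>H\<^sup>s\<close> defined on \<open>J\<close>.\<close>

definition has_time_deriv ::
  "nat \<Rightarrow> nat \<Rightarrow> real set \<Rightarrow> (real \<Rightarrow> 'b::euclidean_space tensor) \<Rightarrow> 'b tensor \<Rightarrow> real \<Rightarrow> bool" where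
  "has_time_deriv r s J U V \<tau> \<longleftrightarrow>
     ((\<lambda>\<sigma>. Hnorm r s (\<lambda>js x. (U \<sigma> js x - U \<tau> js x) /\<^sub>R (\<sigma> - \<tau>) - V js x)) \<longlongrightarrow> 0)
       (at \<tau> within J)"

abbreviation Itau :: "real set" where
  "Itau \<equiv> {- (pi/2) .. pi/2}"

text \<open>The space \<open>C\<^sup>k\<^sub>b([-\<pi>/2,\<pi>/2]; H\<^sup>s)\<close> of curves of tensor fields of rank \<open>r\<close>.\<close>

definition CbH :: "nat \<Rightarrow> nat \<Rightarrow> nat \<Rightarrow> (real \<Rightarrow> 'b::euclidean_space tensor) \<Rightarrow> bool" where
  "CbH r k s U \<longleftrightarrow> (\<exists>D. D 0 = U \<and>
     (\<forall>j\<le>k. (\<forall>\<tau>\<in>Itau. in_H r s (D j \<tau>) \<and>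
                ((\<lambda>\<sigma>. Hnorm r s (\<lambda>js x. D j \<sigma> js x - D j \<tau> js x)) \<longlongrightarrow> 0) (at \<tau> within Itau)) \<and>
            bounded ((\<lambda>\<tau>. Hnorm r s (D j \<tau>)) ` Itau)) \<and>
     (\<forall>j<k. \<forall>\<tau>\<in>Itau. has_time_deriv r s Itau (D j) (D (Suc j) \<tau>) \<tau>))"

text \<open>The derivative in \<open>\<tau>\<close>, taken in \<open>L\<^sup>2\<close> (one-sided at the ends of the interval); it is unique up
  to null sets, and agrees with the derivative in any \<open>H\<^sup>s\<close> in which the curve is differentiable.\<close>

definition tdot :: "nat \<Rightarrow> (real \<Rightarrow> 'b::euclidean_space tensor) \<Rightarrow> real \<Rightarrow> 'b tensor" where
  "tdot r U \<tau> = (SOME V. in_H r 0 V \<and> has_time_deriv r 0 Itau U V \<tau>)"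

section \<open>The Maxwell-scalar field system in strong Coulomb gauge\<close>

text \<open>The equations hold almost everywhere on the sphere at every time, which is their meaning as
  equations in \<open>L\<^sup>2\<close>; \<^const>\<open>lap\<close> on one-forms is the connection (rough) Laplacian, and one-form
  equations are written in frame components.\<close>

definition ms_system ::
  "(real \<Rightarrow> real^4 \<Rightarrow> complex) \<Rightarrow> (real \<Rightarrow> real^4 \<Rightarrow> real^4) \<Rightarrow> (real \<Rightarrow> real^4 \<Rightarrow> real) \<Rightarrow> bool" where
  "ms_system \<phi> A A0 \<longleftrightarrow>
    (let P = (\<lambda>\<tau>. scal (\<phi> \<tau>)); a = (\<lambda>\<tau>. oneform (A \<tau>)); Z = (\<lambda>\<tau>. scal (A0 \<tau>));
         P' = tdot 0 P; P'' = tdot 0 P'; a'' = tdot 1 (tdot 1 a); Z' = tdot 0 Z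
     in \<forall>\<tau>\<in>Itau.
       (AE x in vol3.
          P'' \<tau> [] x - lap (P \<tau>) [] x
          + 2 * \<i> * of_real (A0 \<tau> x) * P' \<tau> [] x
          - 2 * \<i> * (\<Sum>i\<in>UNIV. of_real (a \<tau> [i] x) * cov (P \<tau>) [i] x)
          + (1 - of_real ((A0 \<tau> x)\<^sup>2) + of_real ((norm (A \<tau> x))\<^sup>2) + \<i> * of_real (Z' \<tau> [] x)) * \<phi> \<tau> x
          = 0) \<and>
       (\<forall>i. AE x in vol3.
          a'' \<tau> [i] x - lap (a \<tau>) [i] x + (2 + (cmod (\<phi> \<tau> x))\<^sup>2) * a \<tau> [i] x
          = - Im (cnj (\<phi> \<tau> x) * cov (P \<tau>) [i] x) + cov (Z' \<tau>) [i] x) \<and>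
       (AE x in vol3.
          - lap (Z \<tau>) [] x + (cmod (\<phi> \<tau> x))\<^sup>2 * A0 \<tau> x = - Im (cnj (\<phi> \<tau> x) * P' \<tau> [] x)) \<and>
       (AE x in vol3. divg (a \<tau>) x = 0) \<and>
       (LINT x|vol3. A0 \<tau> x) = 0)"

text \<open>Solutions of regularity \<open>m\<close>. For \<open>m \<ge> 2\<close> the space \<open>H\<^sup>m\<close> embeds into the continuous functions;
  elements of it are identified with their continuous representatives, so that pointwise
  statements are meaningful.\<close>

definition ms_solution ::
  "nat \<Rightarrow> (real \<Rightarrow> real^4 \<Rightarrow> complex) \<Rightarrow> (real \<Rightarrow> real^4 \<Rightarrow> real^4) \<Rightarrow> (real \<Rightarrow> real^4 \<Rightarrow> real) \<Rightarrow> bool"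
where
  "ms_solution m \<phi> A A0 \<longleftrightarrow>
     (\<forall>\<tau>\<in>Itau. continuous_on S3 (\<phi> \<tau>) \<and> continuous_on S3 (A \<tau>) \<and> continuous_on S3 (A0 \<tau>) \<and>
        (\<forall>x\<in>S3. A \<tau> x \<bullet> x = 0)) \<and>
     (\<forall>k\<le>m. CbH 0 k (m - k) (\<lambda>\<tau>. scal (\<phi> \<tau>)) \<and>
            CbH 1 k (m - k) (\<lambda>\<tau>. oneform (A \<tau>)) \<and>
            CbH 0 k (m - k) (\<lambda>\<tau>. scal (A0 \<tau>))) \<and>
     ms_system \<phi> A A0"

section \<open>De Sitter space: fields, data and developments\<close>

definition tau :: "real \<Rightarrow> real \<Rightarrow> real" where
  "tau H \<eta> = 2 * arctan (tanh (H * \<eta> / 2))"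

definition Omega :: "real \<Rightarrow> real \<Rightarrow> real" where
  "Omega H \<eta> = H * cos (tau H \<eta>)"

text \<open>A field \<open>(\<phi>, A\<^sub>\<eta> d\<eta> + A)\<close> on de Sitter space; the first argument is \<open>\<eta>\<close>, the second one a point of
  the sphere.\<close>

record ds_field =
  f_phi :: "real \<Rightarrow> real^4 \<Rightarrow> complex"
  f_Aeta :: "real \<Rightarrow> real^4 \<Rightarrow> real"
  f_A :: "real \<Rightarrow> real^4 \<Rightarrow> real^4"

text \<open>Values at \<open>\<eta> = 0\<close> of the physical (not rescaled) \<open>\<phi>, \<partial>\<^sub>\<eta>\<phi>, A, \<partial>\<^sub>\<eta>A, A\<^sub>\<eta>\<close>.\<close>

record ds_data =
  d_phi :: "real^4 \<Rightarrow> complex"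
  d_dphi :: "real^4 \<Rightarrow> complex"
  d_A :: "real^4 \<Rightarrow> real^4"
  d_dA :: "real^4 \<Rightarrow> real^4"
  d_Aeta :: "real^4 \<Rightarrow> real"

text \<open>The constraints are those of the rescaled data. At \<open>\<eta> = 0\<close> one has \<open>\<Omega> = d\<tau>/d\<eta> = H\<close> and
  \<open>\<partial>\<^sub>\<tau>\<Omega> = 0\<close>, so there the rescaled fields and their \<open>\<tau>\<close>-derivatives are \<open>\<phi>/H\<close>, \<open>\<partial>\<^sub>\<eta>\<phi>/H\<^sup>2\<close>,
  \<open>A\<close>, \<open>\<partial>\<^sub>\<eta>A/H\<close>, \<open>A\<^sub>\<eta>/H\<close>, where the symbols on the right denote physical quantities.\<close>

definition admissible :: "real \<Rightarrow> nat \<Rightarrow> ds_data \<Rightarrow> bool" where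
  "admissible H m d \<longleftrightarrow>
    (let \<phi> = (\<lambda>x. d_phi d x / of_real H); \<phi>' = (\<lambda>x. d_dphi d x / of_real (H\<^sup>2));
         A = d_A d; A' = (\<lambda>x. d_dA d x /\<^sub>R H); A0 = (\<lambda>x. d_Aeta d x / H)
     in in_H 0 m (scal \<phi>) \<and> in_H 0 (m - 1) (scal \<phi>') \<and>
        in_H 1 m (oneform A) \<and> in_H 1 (m - 1) (oneform A') \<and> in_H 0 m (scal A0) \<and>
        (\<forall>x\<in>S3. A x \<bullet> x = 0 \<and> A' x \<bullet> x = 0) \<and>
        (AE x in vol3. divg (oneform A) x = 0) \<and>
        (AE x in vol3. divg (oneform A') x = 0) \<and>
        (LINT x|vol3. A0 x) = 0 \<and>
        (AE x in vol3. - lap (scal A0) [] x + (cmod (\<phi> x))\<^sup>2 * A0 x = - Im (cnj (\<phi> x) * \<phi>' x)))"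

text \<open>The Sobolev size of the data, with the norms squared.\<close>

definition data_size :: "nat \<Rightarrow> ds_data \<Rightarrow> real" where
  "data_size m d =
     (Hnorm 0 (m - 1) (scal (d_dphi d)))\<^sup>2 + (Hnorm 0 m (scal (d_phi d)))\<^sup>2 +
     (Hnorm 1 (m - 1) (oneform (d_dA d)))\<^sup>2 + (Hnorm 1 m (oneform (d_A d)))\<^sup>2"

text \<open>The field \<open>u\<close> is a development of the data \<open>d\<close>: its rescaling extends to a solution on the closed
  interval, and it attains the data (with \<open>\<eta>\<close>-derivatives in \<open>L\<^sup>2\<close>). From
  \<open>A\<^sub>\<eta> d\<eta> = A\<^sub>0 d\<tau>\<close> one has \<open>A\<^sub>\<eta> = A\<^sub>0 d\<tau>/d\<eta>\<close>.\<close>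

definition development :: "real \<Rightarrow> nat \<Rightarrow> ds_data \<Rightarrow> ds_field \<Rightarrow> bool" where
  "development H m d u \<longleftrightarrow>
     (\<exists>\<phi> A A0. ms_solution m \<phi> A A0 \<and>
        (\<forall>\<eta>. \<forall>x\<in>S3. \<phi> (tau H \<eta>) x = f_phi u \<eta> x / of_real (Omega H \<eta>) \<and>
                    A (tau H \<eta>) x = f_A u \<eta> x \<and>
                    f_Aeta u \<eta> x = A0 (tau H \<eta>) x * deriv (tau H) \<eta>)) \<and>
     (AE x in vol3. f_phi u 0 x = d_phi d x \<and> f_A u 0 x = d_A d x \<and> f_Aeta u 0 x = d_Aeta d x) \<and>
     has_time_deriv 0 0 UNIV (\<lambda>\<eta>. scal (f_phi u \<eta>)) (scal (d_dphi d)) 0 \<and>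
     has_time_deriv 1 0 UNIV (\<lambda>\<eta>. oneform (f_A u \<eta>)) (oneform (d_dA d)) 0"

section \<open>Static coordinates\<close>

text \<open>A point of the sphere is \<open>(cos \<zeta>, sin \<zeta> \<omega>)\<close> with \<open>\<omega>\<close> in the two-sphere. The static region around
  the South Pole \<open>\<zeta> = \<pi>\<close> is described in terms of \<open>(\<eta>, \<zeta>)\<close>.\<close>

definition sph :: "real \<Rightarrow> real^3 \<Rightarrow> real^4" where
  "sph \<zeta> \<omega> = vector [cos \<zeta>, sin \<zeta> * \<omega>$1, sin \<zeta> * \<omega>$2, sin \<zeta> * \<omega>$3]"

definition static_region :: "real \<Rightarrow> (real \<times> real) set" where
  "static_region H = {(\<eta>, \<zeta>). pi/2 < \<zeta> \<and> \<zeta> \<le> pi \<and> sin \<zeta> < cos (tau H \<eta>)}"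

definition static_chart :: "real \<Rightarrow> real \<times> real \<Rightarrow> real \<times> real" where
  "static_chart H = (\<lambda>(\<eta>, \<zeta>).
     (artanh (sin (tau H \<eta>) / \<bar>cos \<zeta>\<bar>) / H, sin \<zeta> / (H * cos (tau H \<eta>))))"

text \<open>The chart is injective, so that its inverse in the definitions below is meaningful.\<close>

lemma tau_bounds: "- (pi/2) < tau H \<eta>" "tau H \<eta> < pi/2"
proof -
  have "\<bar>tanh (H * \<eta> / 2)\<bar> < 1" using tanh_real_lt_1 tanh_real_gt_neg1 by (simp add: abs_less_iff)
  then have "arctan (tanh (H * \<eta> / 2)) < arctan 1" "arctan (-1) < arctan (tanh (H * \<eta> / 2))"
    by (simp_all only: arctan_less_iff abs_less_iff) linarith+
  then show "- (pi/2) < tau H \<eta>" "tau H \<eta> < pi/2"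
    by (simp_all add: tau_def arctan_one arctan_minus)
qed

lemma static_chart_inj:
  assumes "H > 0"
  shows "inj_on (static_chart H) (static_region H)"
proof (rule inj_onI)
  fix p p' assume p: "p \<in> static_region H" and p': "p' \<in> static_region H"
    and eq: "static_chart H p = static_chart H p'"
  obtain \<eta> \<zeta> \<eta>' \<zeta>' where pq: "p = (\<eta>, \<zeta>)" "p' = (\<eta>', \<zeta>')" by fastforce
  have facts: "cos (tau H \<eta>) > 0 \<and> sin \<zeta> \<ge> 0 \<and> cos \<zeta> < 0 \<and>
      \<bar>sin (tau H \<eta>) / \<bar>cos \<zeta>\<bar>\<bar> < 1 \<and> sin \<zeta> / cos (tau H \<eta>) < 1 \<and> sin \<zeta> / cos (tau H \<eta>) \<ge> 0"
    if "(\<eta>, \<zeta>) \<in> static_region H" for \<eta> \<zeta>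
  proof -
    have z: "pi/2 < \<zeta>" "\<zeta> \<le> pi" "sin \<zeta> < cos (tau H \<eta>)"
      using that by (auto simp: static_region_def)
    have c: "cos (tau H \<eta>) > 0" using tau_bounds by (simp add: cos_gt_zero_pi)
    have s: "sin \<zeta> \<ge> 0" using z by (simp add: sin_ge_zero)
    have "cos \<zeta> < cos (pi/2)" using z by (intro cos_monotone_0_pi) auto
    then have n: "cos \<zeta> < 0" by simp
    have "(sin \<zeta>)\<^sup>2 < (cos (tau H \<eta>))\<^sup>2" using z(3) s by (simp add: power_strict_mono)
    then have "(sin (tau H \<eta>))\<^sup>2 < (cos \<zeta>)\<^sup>2" by (simp add: sin_squared_eq)
    then have "\<bar>sin (tau H \<eta>)\<bar> < \<bar>cos \<zeta>\<bar>" by (metis abs_le_square_iff not_le)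
    then have "\<bar>sin (tau H \<eta>)\<bar> / \<bar>cos \<zeta>\<bar> < 1"
      using n by (subst divide_less_eq_1_pos) auto
    then have "\<bar>sin (tau H \<eta>) / \<bar>cos \<zeta>\<bar>\<bar> < 1" by (simp only: abs_divide abs_abs)
    then show ?thesis using c s n z by simp
  qed
  have key: "c\<^sup>2 * (1 - u\<^sup>2 * v\<^sup>2) = 1 - u\<^sup>2"
    if "u = sin (tau H \<eta>) / \<bar>cos \<zeta>\<bar>" "v = sin \<zeta> / cos (tau H \<eta>)" "c = cos (tau H \<eta>)"
      "cos \<zeta> < 0" "c > 0" for u v c \<eta> \<zeta>
  proof -
    have "v\<^sup>2 * c\<^sup>2 = (sin \<zeta>)\<^sup>2" "u\<^sup>2 * (cos \<zeta>)\<^sup>2 = (sin (tau H \<eta>))\<^sup>2"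
      using that by (auto simp: power_divide)
    moreover have "(sin \<zeta>)\<^sup>2 = 1 - (cos \<zeta>)\<^sup>2" "(sin (tau H \<eta>))\<^sup>2 = 1 - c\<^sup>2"
      using that by (simp_all add: sin_squared_eq)
    ultimately show ?thesis by algebra
  qed
  define u v where "u = sin (tau H \<eta>) / \<bar>cos \<zeta>\<bar>" and "v = sin \<zeta> / cos (tau H \<eta>)"
  note f = facts[OF p[unfolded pq]] and f' = facts[OF p'[unfolded pq]]
  have "artanh u = artanh (sin (tau H \<eta>') / \<bar>cos \<zeta>'\<bar>)"
    using eq assms by (simp add: static_chart_def pq u_def)
  moreover have "x = y" if "artanh x = artanh y" "\<bar>x\<bar> < 1" "\<bar>y\<bar> < 1" for x y :: real
  proof -
    have "(1 + x) / (1 - x) = (1 + y) / (1 - y)"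
      using that by (simp add: artanh_def abs_less_iff)
    then show ?thesis using that by (simp add: field_simps abs_less_iff)
  qed
  ultimately have u': "u = sin (tau H \<eta>') / \<bar>cos \<zeta>'\<bar>" using f f' unfolding u_def by blast
  have "sin \<zeta> / (H * cos (tau H \<eta>)) = sin \<zeta>' / (H * cos (tau H \<eta>'))"
    using eq by (simp add: static_chart_def pq)
  then have "v / H = (sin \<zeta>' / cos (tau H \<eta>')) / H" by (simp add: v_def mult.commute)
  then have v': "v = sin \<zeta>' / cos (tau H \<eta>')"
    unfolding divide_cancel_right using assms by blast
  have "u\<^sup>2 < 1" unfolding abs_square_less_1 u_def using f by blast
  have "v\<^sup>2 < 1" unfolding abs_square_less_1 v_def using f by linarith
  then have "u\<^sup>2 * v\<^sup>2 < 1"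
    using \<open>u\<^sup>2 < 1\<close> mult_left_le[of "v\<^sup>2" "u\<^sup>2"] by simp
  then have ne: "1 - u\<^sup>2 * v\<^sup>2 \<noteq> 0" by simp
  have "(cos (tau H \<eta>))\<^sup>2 * (1 - u\<^sup>2 * v\<^sup>2) = (cos (tau H \<eta>'))\<^sup>2 * (1 - u\<^sup>2 * v\<^sup>2)"
    using key[OF u_def v_def refl] key[OF u' v' refl] f f' by metis
  then have "(cos (tau H \<eta>))\<^sup>2 = (cos (tau H \<eta>'))\<^sup>2" using ne by simp
  then have c: "cos (tau H \<eta>) = cos (tau H \<eta>')" using f f' unfolding power2_eq_iff by linarith
  have cp: "cos (tau H \<eta>') > 0" and n: "cos \<zeta>' < 0" using f' by blast+
  then have s: "sin \<zeta> = sin \<zeta>'" using v' c by (simp add: v_def)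
  then have "(cos \<zeta>)\<^sup>2 = (cos \<zeta>')\<^sup>2" by (simp add: cos_squared_eq)
  then have cz: "cos \<zeta> = cos \<zeta>'" using f f' unfolding power2_eq_iff by linarith
  have z: "\<zeta> = \<zeta>'"
  proof (rule cos_inj_pi)
    have "0 < pi/2" by simp
    then show "0 \<le> \<zeta>" "0 \<le> \<zeta>'" "\<zeta> \<le> pi" "\<zeta>' \<le> pi"
      using p p' pq unfolding static_region_def by auto
  qed (rule cz)
  have "sin (tau H \<eta>) = sin (tau H \<eta>')" using u' n cz by (simp add: u_def)
  moreover have "arcsin (sin (tau H e)) = tau H e" for e
    by (rule arcsin_sin) (use tau_bounds[of H e] in linarith)+
  ultimately have "tau H \<eta> = tau H \<eta>'" by metis
  then have "\<eta> = \<eta>'" using assms by (simp add: tau_def arctan_eq_iff)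
  then show "p = p'" using z pq by simp
qed

definition eta_st :: "real \<Rightarrow> real \<Rightarrow> real \<Rightarrow> real" where
  "eta_st H t r = fst (the_inv_into (static_region H) (static_chart H) (t, r))"

definition zeta_st :: "real \<Rightarrow> real \<Rightarrow> real \<Rightarrow> real" where
  "zeta_st H t r = snd (the_inv_into (static_region H) (static_chart H) (t, r))"

definition point_st :: "real \<Rightarrow> real \<Rightarrow> real \<Rightarrow> real^3 \<Rightarrow> real^4" where
  "point_st H t r \<omega> = sph (zeta_st H t r) \<omega>"

definition phi_st :: "real \<Rightarrow> ds_field \<Rightarrow> real \<Rightarrow> real \<Rightarrow> real^3 \<Rightarrow> complex" where
  "phi_st H u t r \<omega> = f_phi u (eta_st H t r) (point_st H t r \<omega>)"

definition A_t :: "real \<Rightarrow> ds_field \<Rightarrow> real \<Rightarrow> real \<Rightarrow> real^3 \<Rightarrow> real" where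
  "A_t H u t r \<omega> =
     f_Aeta u (eta_st H t r) (point_st H t r \<omega>) * deriv (\<lambda>t. eta_st H t r) t +
     f_A u (eta_st H t r) (point_st H t r \<omega>) \<bullet> vector_derivative (\<lambda>t. point_st H t r \<omega>) (at t)"

definition A_r :: "real \<Rightarrow> ds_field \<Rightarrow> real \<Rightarrow> real \<Rightarrow> real^3 \<Rightarrow> real" where
  "A_r H u t r \<omega> =
     f_Aeta u (eta_st H t r) (point_st H t r \<omega>) * deriv (\<lambda>r. eta_st H t r) r +
     f_A u (eta_st H t r) (point_st H t r \<omega>) \<bullet> vector_derivative (\<lambda>r. point_st H t r \<omega>) (at r)"

text \<open>Norm, on the unit two-sphere, of the pullback of the one-form under
  \<open>\<omega> \<mapsto> (cos \<zeta>, sin \<zeta> \<omega>)\<close>: the supremum over unit tangent vectors \<open>v\<close> at \<open>\<omega>\<close>.\<close>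

definition A_ang_norm :: "real \<Rightarrow> ds_field \<Rightarrow> real \<Rightarrow> real \<Rightarrow> real^3 \<Rightarrow> real" where
  "A_ang_norm H u t r \<omega> =
     (SUP v\<in>{v. v \<bullet> \<omega> = 0 \<and> norm v = 1}.
        \<bar>f_A u (eta_st H t r) (point_st H t r \<omega>) \<bullet>
          frechet_derivative (\<lambda>\<omega>. point_st H t r \<omega>) (at \<omega>) v\<bar>)"

definition F_st :: "real \<Rightarrow> real \<Rightarrow> real" where
  "F_st H r = 1 - H\<^sup>2 * r\<^sup>2"

definition Phi1 :: "real \<Rightarrow> real \<Rightarrow> real \<Rightarrow> real" where
  "Phi1 H t r = F_st H r powr (- 1/2) * exp (- H * t)"

section \<open>Wave operator and scalar curvature\<close>

definition pd :: "'n::finite \<Rightarrow> (real^'n \<Rightarrow> 'b::real_normed_vector) \<Rightarrow> real^'n \<Rightarrow> 'b" where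
  "pd a f p = frechet_derivative f (at p) (axis a 1)"

definition christoffel ::
  "(real^'n \<Rightarrow> real^'n^'n) \<Rightarrow> 'n::finite \<Rightarrow> 'n \<Rightarrow> 'n \<Rightarrow> real^'n \<Rightarrow> real" where
  "christoffel g c a b p = (\<Sum>d\<in>UNIV. 1/2 * matrix_inv (g p) $ c $ d *
     (pd a (\<lambda>q. g q $ d $ b) p + pd b (\<lambda>q. g q $ d $ a) p - pd d (\<lambda>q. g q $ a $ b) p))"

definition box :: "(real^'n \<Rightarrow> real^'n^'n) \<Rightarrow> (real^'n \<Rightarrow> real) \<Rightarrow> real^'n::finite \<Rightarrow> real" where
  "box g f p = (\<Sum>a\<in>UNIV. \<Sum>b\<in>UNIV. matrix_inv (g p) $ a $ b *
     (pd a (pd b f) p - (\<Sum>c\<in>UNIV. christoffel g c a b p * pd c f p)))"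

text \<open>Ricci tensor in the convention in which it is positive on round spheres; it is invariant under
  \<open>g \<mapsto> - g\<close>.\<close>

definition ricci :: "(real^'n \<Rightarrow> real^'n^'n) \<Rightarrow> 'n::finite \<Rightarrow> 'n \<Rightarrow> real^'n \<Rightarrow> real" where
  "ricci g a b p = (\<Sum>c\<in>UNIV.
     pd c (christoffel g c a b) p - pd b (christoffel g c a c) p +
     (\<Sum>e\<in>UNIV. christoffel g c c e p * christoffel g e a b p
             - christoffel g c b e p * christoffel g e a c p))"

text \<open>The minus sign makes the scalar curvature of de Sitter space, in signature \<open>(+,-,-,-)\<close>, equal to
  \<open>12 H\<^sup>2 > 0\<close>.\<close>

definition scal_curv :: "(real^'n \<Rightarrow> real^'n^'n) \<Rightarrow> real^'n::finite \<Rightarrow> real" where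
  "scal_curv g p = - (\<Sum>a\<in>UNIV. \<Sum>b\<in>UNIV. matrix_inv (g p) $ a $ b * ricci g a b p)"

text \<open>Coordinates \<open>p = (\<eta>, y)\<close> on de Sitter space without the North Pole line \<open>\<zeta> = 0\<close>, which cover
  the whole static region including the South Pole \<open>r = 0\<close>: \<open>y \<in> \<real>\<^sup>3\<close> is the stereographic coordinate on the
  sphere that vanishes at the South Pole.\<close>

definition stereo :: "real^4 \<Rightarrow> real^4" where
  "stereo p = (let q = (p$2)\<^sup>2 + (p$3)\<^sup>2 + (p$4)\<^sup>2
     in vector [(q - 1) / (q + 1), 2 * p$2 / (q + 1), 2 * p$3 / (q + 1), 2 * p$4 / (q + 1)])"

text \<open>The metric \<open>d\<eta>\<^sup>2 - H\<^sup>-\<^sup>2 cosh\<^sup>2(H\<eta>) s\<^sub>3\<close>, the round metric \<open>s\<^sub>3\<close> being pulled back from \<open>\<real>\<^sup>4\<close>.\<close>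

definition ds_metric :: "real \<Rightarrow> real^4 \<Rightarrow> real^4^4" where
  "ds_metric H p = (\<chi> a b. pd a (\<lambda>q. q$1) p * pd b (\<lambda>q. q$1) p
     - (cosh (H * p$1))\<^sup>2 / H\<^sup>2 * (pd a stereo p \<bullet> pd b stereo p))"

text \<open>\<open>\<zeta>\<close> is the arc cosine of the first coordinate of a point of the sphere.\<close>

definition static_domain :: "real \<Rightarrow> (real^4) set" where
  "static_domain H = {p. (p$1, arccos (stereo p $ 1)) \<in> static_region H}"

definition Phi1_ds :: "real \<Rightarrow> real^4 \<Rightarrow> real" where
  "Phi1_ds H p = (let (t, r) = static_chart H (p$1, arccos (stereo p $ 1)) in Phi1 H t r)"

text \<open>Twice differentiable solutions on a set \<open>D\<close> of the conformally invariant wave equation.\<close>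

definition solves_conf_wave :: "(real^4 \<Rightarrow> real^4^4) \<Rightarrow> (real^4) set \<Rightarrow> (real^4 \<Rightarrow> real) \<Rightarrow> bool" where
  "solves_conf_wave g D f \<longleftrightarrow> (\<forall>p\<in>D.
     f differentiable (at p) \<and> (\<forall>a. pd a f differentiable (at p)) \<and>
     box g f p + 1/6 * scal_curv g p * f p = 0)"

end

theory Submission
  imports Defs
begin

text \<open>A development is bounded in \<open>H\<^sup>m\<close> on the closed interval \<open>[-\<pi>/2, \<pi>/2]\<close>, so decay follows from the
  embedding of \<open>H\<^sup>2\<close> of the three-sphere into the bounded functions and the conformal weights of the
  fields. The embedding comes from the representation of \<open>u(p)\<close> by \<open>(- \<Delta> + 3/4) u\<close> and the Green
  function \<open>(1 - p \<bullet> x)\<^sup>-\<^sup>1\<^sup>/\<^sup>2\<close> of the conformal Laplacian, which is square integrable in dimension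
  three; applied to first derivatives, it makes functions in \<open>H\<^sup>3\<close> Lipschitz. At fixed \<open>r\<close>, the
  static observer converges as \<open>t \<rightarrow> \<infinity>\<close> to the South Pole at \<open>\<tau> = \<pi>/2\<close> at the rate \<open>e\<^sup>-\<^sup>H\<^sup>t\<close>, so the rescaled
  field is its value there up to \<open>O(e\<^sup>-\<^sup>H\<^sup>t)\<close>, and \<open>\<Omega>\<close> is a multiple of \<open>\<Phi>\<^sub>1\<close> up to \<open>O(e\<^sup>-\<^sup>3\<^sup>H\<^sup>t)\<close>.\<close>

section \<open>The measure on the three-sphere\<close>

text \<open>The Sobolev spaces are defined by weak derivatives against functions that are
  continuously differentiable on the whole ambient space, and the singular Green function is not one
  of them. It is replaced by functions of \<open>1 + e - p \<bullet> x\<close>, extended off the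
  sphere as \<open>|x - p|^2 / 2 + e\<close>, and estimates are kept uniform in \<open>e\<close> and
  in the centre \<open>p\<close> until \<open>e\<close> tends to 0. Weak derivatives are chosen
  representatives, so an iterated derivative of a sum is known only up to null sets; hence their
  uniqueness is proved before the Sobolev norms are used. The frame of right multiplications by
  quaternion units removes most of the geometry: its fields are Killing, their integral curves are
  great circles and their connection coefficients are constant, so covariant and iterated frame
  derivatives differ by lower order terms with constant coefficients. Order three regularity enters
  the expansion twice, as one derivative in time with values in the second Sobolev space and as
  three derivatives in space at the final time; each controls one of the two differences of size
  \<open>exp (- H * t)\<close>.\<close>

lemma lborel_distr_orthogonal:
  fixes f :: "real^'n::{finite,wellorder} \<Rightarrow> real^'n::_"
  assumes f: "orthogonal_transformation f"
  shows "distr lborel lborel f = lborel"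
proof -
  let ?g = "inv f"
  have g: "orthogonal_transformation ?g"
    using f by (rule orthogonal_transformation_inv)
  have [measurable]: "f \<in> borel_measurable borel"
    using f by (intro borel_measurable_continuous_onI linear_continuous_on)
      (simp add: orthogonal_transformation_linear linear_conv_bounded_linear[symmetric])
  have "lborel = distr lborel borel f"
  proof (rule lborel_eqI)
    fix l u :: "(real, 'n) vec" assume lu: "\<And>b. b \<in> Basis \<Longrightarrow> l \<bullet> b \<le> u \<bullet> b"
    let ?B = "Topology_Euclidean_Space.box l u"
    have eq: "f -` ?B = ?g ` ?B"
      using orthogonal_transformation_bij[OF f] by (simp add: bij_vimage_eq_inv_image)
    have lm: "?B \<in> lmeasurable" by simp
    have m: "?g ` ?B \<in> sets borel"
      unfolding eq[symmetric] using measurable_sets[of f borel borel "?B"] by simp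
    have "emeasure (distr lborel borel f) ?B = emeasure lborel (?g ` ?B)"
      by (simp add: emeasure_distr eq)
    also have "\<dots> = emeasure lebesgue (?g ` ?B)"
      using m by simp
    also have "\<dots> = ennreal (measure lebesgue (?g ` ?B))"
      by (rule emeasure_eq_measure2) (rule measurable_orthogonal_image[OF g lm])
    also have "measure lebesgue (?g ` ?B) = measure lebesgue ?B"
      by (rule measure_orthogonal_image[OF g lm])
    also have "measure lebesgue ?B = (\<Prod>b\<in>Basis. (u - l) \<bullet> b)"
      using lu by (simp add: measure_lborel_box_eq)
    finally show "emeasure (distr lborel borel f) ?B = (\<Prod>b\<in>Basis. (u - l) \<bullet> b)" .
  qed simp
  also have "\<dots> = distr lborel lborel f" by (rule distr_cong) auto
  finally show ?thesis by simp
qed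

definition cone_meas :: "(real^4) measure" where
  "cone_meas = restrict_space lborel (ball 0 1 - {0})"

lemma sgn_measurable_cone [measurable]: "sgn \<in> cone_meas \<rightarrow>\<^sub>M restrict_space borel S3"
proof -
  have "sgn \<in> borel_measurable (borel :: (real^4) measure)"
    unfolding sgn_div_norm by measurable
  then show ?thesis unfolding cone_meas_def
    by (intro measurable_restrict_space2 measurable_restrict_space1)
       (auto simp: space_restrict_space norm_sgn)
qed

lemma vol3_alt: "vol3 = scale_measure 4 (distr cone_meas (restrict_space borel S3) sgn)"
  by (simp add: vol3_def cone_meas_def)

lemma space_vol3 [simp]: "space vol3 = S3"
  by (simp add: vol3_def space_scale_measure space_restrict_space)

lemma sets_vol3 [measurable_cong]: "sets vol3 = sets (restrict_space borel S3)"
  by (simp add: vol3_def)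

lemma emeasure_vol3:
  assumes "E \<in> sets vol3"
  shows "emeasure vol3 E = 4 * emeasure lborel {x \<in> ball 0 1 - {0}. sgn x \<in> E}"
proof -
  have E: "E \<in> sets (restrict_space borel S3)" using assms by (simp add: sets_vol3)
  have "emeasure vol3 E = 4 * emeasure cone_meas (sgn -` E \<inter> space cone_meas)"
    unfolding vol3_alt by (simp add: emeasure_distr E)
  also have "sgn -` E \<inter> space cone_meas = {x \<in> ball 0 1 - {0}. sgn x \<in> E}"
    by (auto simp: cone_meas_def space_restrict_space)
  also have "emeasure cone_meas \<dots> = emeasure lborel {x \<in> ball 0 1 - {0}. sgn x \<in> E}"
    unfolding cone_meas_def by (rule emeasure_restrict_space) auto
  finally show ?thesis .
qed

lemma sets_cone:
  assumes "E \<in> sets vol3"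
  shows "{x \<in> ball 0 1 - {0}. sgn x \<in> E} \<in> sets borel"
proof -
  have "sgn -` E \<inter> space cone_meas \<in> sets cone_meas"
    by (rule measurable_sets[OF sgn_measurable_cone]) (use assms in \<open>simp add: sets_vol3\<close>)
  moreover have "sgn -` E \<inter> space cone_meas = {x \<in> ball 0 1 - {0}. sgn x \<in> E}"
    by (auto simp: cone_meas_def space_restrict_space)
  ultimately show ?thesis
    by (auto simp: cone_meas_def sets_restrict_space_iff)
qed

lemma emeasure_vol3_S3: "emeasure vol3 S3 = 4 * emeasure lborel (ball (0::real^4) 1)"
proof -
  have "{x \<in> ball 0 1 - {0}. sgn x \<in> S3} = ball (0::real^4) 1 - {0}"
    by (auto simp: norm_sgn)
  moreover have "emeasure lborel (ball (0::real^4) 1 - {0}) = emeasure lborel (ball (0::real^4) 1)"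
    by (subst emeasure_Diff) auto
  moreover have "S3 \<in> sets vol3" using sets.top[of vol3] by simp
  ultimately show ?thesis by (simp add: emeasure_vol3)
qed

lemma emeasure_ball_real4: "emeasure lborel (ball (0::real^4) 1) < top" "emeasure lborel (ball (0::real^4) 1) > 0"
proof -
  show fin: "emeasure lborel (ball (0::real^4) 1) < top"
    using emeasure_lborel_ball_finite[of "0::real^4" 1] by simp
  have "0 < measure lborel (ball (0::real^4) 1)" by simp
  then show "emeasure lborel (ball (0::real^4) 1) > 0"
    using fin by (auto simp: measure_def zero_less_iff_neq_zero)
qed

interpretation vol3: finite_measure vol3
  by standard (simp add: emeasure_vol3_S3 emeasure_ball_real4(1)[THEN less_imp_neq] ennreal_mult_eq_top_iff)

definition area3 :: real where "area3 = measure vol3 S3"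

lemma area3_pos: "area3 > 0"
proof -
  have "measure vol3 S3 = 4 * measure lborel (ball (0::real^4) 1)"
    by (simp add: measure_def emeasure_vol3_S3 enn2real_mult)
  then show ?thesis unfolding area3_def by simp
qed

lemma continuous_measurable_vol3:
  fixes f :: "real^4 \<Rightarrow> 'a::topological_space"
  assumes "continuous_on S3 f"
  shows "f \<in> borel_measurable vol3"
  using borel_measurable_continuous_on_restrict[OF assms]
  by (simp add: measurable_cong_sets[OF sets_vol3 refl])

lemma continuous_bounded_S3:
  fixes f :: "real^4 \<Rightarrow> 'a::real_normed_vector"
  assumes "continuous_on S3 f"
  obtains B where "\<And>x. x \<in> S3 \<Longrightarrow> norm (f x) \<le> B" "B \<ge> 0"
proof -
  have "compact (f ` S3)" using assms by (intro compact_continuous_image) auto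
  then have "bounded (f ` S3)" by (rule compact_imp_bounded)
  then obtain B where "\<forall>x\<in>S3. norm (f x) \<le> B" by (auto simp: bounded_iff)
  then have "\<And>x. x \<in> S3 \<Longrightarrow> norm (f x) \<le> max B 0" by force
  then show ?thesis using that[of "max B 0"] by simp
qed

lemma continuous_integrable_vol3:
  fixes f :: "real^4 \<Rightarrow> 'a::{banach,second_countable_topology}"
  assumes "continuous_on S3 f"
  shows "integrable vol3 f"
proof -
  obtain B where "\<And>x. x \<in> S3 \<Longrightarrow> norm (f x) \<le> B" using continuous_bounded_S3[OF assms] by blast
  then show ?thesis
    by (intro vol3.integrable_const_bound[where B=B] AE_I2 continuous_measurable_vol3 assms) auto
qed

lemma continuous_on_orthogonal:
  fixes R :: "'a::euclidean_space \<Rightarrow> 'a"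
  assumes "orthogonal_transformation R"
  shows "continuous_on A R"
  using assms by (intro linear_continuous_on)
    (simp add: orthogonal_transformation_linear linear_conv_bounded_linear[symmetric])

lemma measurable_orthogonal_vol3:
  assumes "orthogonal_transformation R"
  shows "R \<in> vol3 \<rightarrow>\<^sub>M vol3"
  unfolding measurable_cong_sets[OF sets_vol3 sets_vol3]
  by (intro measurable_restrict_space2 measurable_restrict_space1 borel_measurable_continuous_onI
      continuous_on_orthogonal assms)
     (use orthogonal_transformation_norm[OF assms] in \<open>auto simp: space_restrict_space\<close>)

text \<open>An orthogonal map commutes with \<open>sgn\<close>, hence takes the cone over a set to
  the cone over its image, and the invariance of Lebesgue measure passes to the surface
  measure.\<close>

lemma vol3_rotation:
  fixes R :: "real^4 \<Rightarrow> real^4"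
  assumes R: "orthogonal_transformation R"
  shows "distr vol3 vol3 R = vol3"
proof (rule measure_eqI)
  note cR = continuous_on_orthogonal[OF R, of UNIV] and Rm = measurable_orthogonal_vol3[OF R]
  fix E assume "E \<in> sets (distr vol3 vol3 R)"
  then have E: "E \<in> sets vol3" by simp
  have sR: "sgn (R x) = R (sgn x)" for x
    using orthogonal_transformation_norm[OF R] orthogonal_transformation_scaleR[OF R]
    by (simp add: sgn_div_norm)
  have R0: "R x = 0 \<longleftrightarrow> x = 0" for x
    using orthogonal_transformation_norm[OF R] by (metis norm_eq_zero)
  let ?C = "{x \<in> ball 0 1 - {0}. sgn x \<in> E}"
  have E': "R -` E \<inter> S3 \<in> sets vol3" using measurable_sets[OF Rm E] by simp
  have "emeasure (distr vol3 vol3 R) E = emeasure vol3 (R -` E \<inter> S3)"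
    using Rm E by (simp add: emeasure_distr)
  also have "\<dots> = 4 * emeasure lborel {x \<in> ball 0 1 - {0}. sgn x \<in> R -` E \<inter> S3}"
    by (rule emeasure_vol3[OF E'])
  also have "{x \<in> ball 0 1 - {0}. sgn x \<in> R -` E \<inter> S3} = R -` ?C"
    using R0 by (auto simp: sR orthogonal_transformation_norm[OF R] norm_sgn)
  also have "emeasure lborel (R -` ?C) = emeasure (distr lborel lborel R) ?C"
    using sets_cone[OF E] borel_measurable_continuous_onI[OF cR] by (simp add: emeasure_distr)
  also have "\<dots> = emeasure lborel ?C" by (simp add: lborel_distr_orthogonal[OF R])
  also have "4 * \<dots> = emeasure vol3 E" by (simp add: emeasure_vol3[OF E])
  finally show "emeasure (distr vol3 vol3 R) E = emeasure vol3 E" .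
qed simp

lemma vol3_integral_rotation:
  fixes f :: "real^4 \<Rightarrow> real"
  assumes R: "orthogonal_transformation R" and f: "continuous_on S3 f"
  shows "(LINT x|vol3. f (R x)) = (LINT x|vol3. f x)"
proof -
  note cR = continuous_on_orthogonal[OF R, of UNIV] and Rm = measurable_orthogonal_vol3[OF R]
  have "(LINT x|vol3. f (R x)) = (LINT x|distr vol3 vol3 R. f x)"
    using Rm continuous_measurable_vol3[OF f] by (simp add: integral_distr)
  then show ?thesis by (simp add: vol3_rotation[OF R])
qed

section \<open>Integration by parts along the frame\<close>

lemma linear_frame: "linear (frame i)"
  by (rule linearI) (auto simp: frame_def vec_eq_iff forall_4 algebra_simps)

lemma bounded_linear_frame: "bounded_linear (frame i)"
  by (simp add: linear_frame linear_conv_bounded_linear[symmetric])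

lemmas frame_add = linear_add[OF linear_frame]
  and frame_scaleR = linear_scale[OF linear_frame]
  and frame_has_derivative = bounded_linear_imp_has_derivative[OF bounded_linear_frame]
  and continuous_on_frame [continuous_intros] =
    bounded_linear.continuous_on[OF bounded_linear_frame]

text \<open>Right multiplication by a quaternion unit squares to minus the identity. This produces
  the term \<open>p \<bullet> x\<close> when a zonal function is integrated by parts twice, and
  makes the integral curves of the frame great circles.\<close>

lemma frame_frame [simp]: "frame i (frame i x) = - x"
  by (auto simp: frame_def vec_eq_iff forall_4)

lemma frame_inner_frame [simp]: "frame i x \<bullet> frame i y = x \<bullet> y"
  by (auto simp: frame_def inner_vec_def sum_4 algebra_simps)

lemma frame_skew: "x \<bullet> frame i y = - (frame i x \<bullet> y)"
  by (auto simp: frame_def inner_vec_def sum_4 algebra_simps)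

lemma frame_self [simp]: "x \<bullet> frame i x = 0" "frame i x \<bullet> x = 0"
  by (auto simp: frame_def inner_vec_def sum_4 algebra_simps)

text \<open>Parseval's identity in the basis formed by \<open>x\<close> and the frame, or Euler's
  four-square identity. It evaluates the squared gradient of zonal functions and recovers the norm
  of a tangent vector from its components.\<close>

lemma sum_frame_squares:
  "(\<Sum>i\<in>UNIV. (p \<bullet> frame i x)\<^sup>2) = (p \<bullet> p) * (x \<bullet> x) - (p \<bullet> x)\<^sup>2"
  by (simp add: sum_3 frame_def inner_vec_def sum_4 power2_eq_square algebra_simps)

lemma norm_frame [simp]: "norm (frame i x) = norm x"
  by (simp add: norm_eq_sqrt_inner)

section \<open>Differentiation under the integral sign, and weak derivatives\<close>

lemma has_vector_derivative_iff_quotient: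
  fixes f :: "real \<Rightarrow> 'b::real_normed_vector"
  shows "(f has_vector_derivative D) (at t) \<longleftrightarrow> ((\<lambda>s. (f s - f t) /\<^sub>R (s - t)) \<longlongrightarrow> D) (at t)"
proof -
  have "norm (f s - f t - (s - t) *\<^sub>R D) / norm (s - t) = norm ((f s - f t) /\<^sub>R (s - t) - D)"
    if "s \<noteq> t" for s
  proof -
    have "(f s - f t) /\<^sub>R (s - t) - D = (f s - f t - (s - t) *\<^sub>R D) /\<^sub>R (s - t)"
      using that by (simp add: scaleR_diff_right)
    then show ?thesis by (simp add: divide_inverse mult.commute)
  qed
  then have "((\<lambda>s. norm (f s - f t - (s - t) *\<^sub>R D) / norm (s - t)) \<longlongrightarrow> 0) (at t) \<longleftrightarrow>
      ((\<lambda>s. norm ((f s - f t) /\<^sub>R (s - t) - D)) \<longlongrightarrow> 0) (at t)"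
    by (intro tendsto_cong) (auto simp: eventually_at_filter)
  also have "\<dots> \<longleftrightarrow> ((\<lambda>s. (f s - f t) /\<^sub>R (s - t)) \<longlongrightarrow> D) (at t)"
    by (simp only: tendsto_norm_zero_iff LIM_zero_iff)
  finally show ?thesis
    by (simp add: has_vector_derivative_def has_derivative_iff_norm bounded_linear_scaleR_left)
qed

text \<open>By the mean value inequality the bound on the derivative also bounds the difference
  quotients, so dominated convergence applies to them along every sequence of parameters.\<close>

lemma has_vector_derivative_integral:
  fixes f :: "real \<Rightarrow> 'a \<Rightarrow> 'b::{banach,second_countable_topology}"
  assumes int: "\<And>t. integrable M (f t)"
    and meas: "f' t0 \<in> borel_measurable M"
    and der: "\<And>t x. x \<in> space M \<Longrightarrow> ((\<lambda>t. f t x) has_vector_derivative f' t x) (at t)"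
    and bound: "\<And>t x. x \<in> space M \<Longrightarrow> norm (f' t x) \<le> g x"
    and g: "integrable M g"
  shows "((\<lambda>t. LINT x|M. f t x) has_vector_derivative (LINT x|M. f' t0 x)) (at t0)"
proof -
  let ?F = "\<lambda>t. LINT x|M. f t x" and ?D = "LINT x|M. f' t0 x"
  have lip: "norm ((f s x - f t0 x) /\<^sub>R (s - t0)) \<le> g x" if "x \<in> space M" for s x
  proof -
    have "norm (f s x - f t0 x) \<le> g x * norm (s - t0)"
    proof (rule differentiable_bound[of UNIV "\<lambda>t. f t x" "\<lambda>t h. h *\<^sub>R f' t x"])
      show "((\<lambda>t. f t x) has_derivative (\<lambda>h. h *\<^sub>R f' t x)) (at t within UNIV)" for t
        using der[OF that, of t] by (simp add: has_vector_derivative_def)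
      show "onorm (\<lambda>h. h *\<^sub>R f' t x) \<le> g x" for t
        by (rule onorm_le) (use bound[OF that, of t] in
          \<open>simp add: mult.commute[of "g x"] mult_left_mono\<close>)
    qed auto
    moreover have "0 \<le> g x" using bound[OF that, of t0] norm_ge_zero order_trans by blast
    moreover have "norm ((f s x - f t0 x) /\<^sub>R (s - t0)) = norm (f s x - f t0 x) / norm (s - t0)"
      by (simp add: divide_inverse mult.commute)
    ultimately show ?thesis by (cases "s = t0") (simp_all add: pos_divide_le_eq)
  qed
  have lim: "((\<lambda>s. (?F s - ?F t0) /\<^sub>R (s - t0)) \<longlongrightarrow> ?D) (at t0)"
    unfolding tendsto_at_iff_sequentially comp_def
  proof (intro allI impI)
    fix X :: "nat \<Rightarrow> real" assume X: "\<forall>i. X i \<in> UNIV - {t0}" "X \<longlonglongrightarrow> t0"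
    have "(\<lambda>n. LINT x|M. (f (X n) x - f t0 x) /\<^sub>R (X n - t0)) \<longlonglongrightarrow> ?D"
    proof (rule integral_dominated_convergence[where w=g])
      show "AE x in M. (\<lambda>n. (f (X n) x - f t0 x) /\<^sub>R (X n - t0)) \<longlonglongrightarrow> f' t0 x"
      proof (rule AE_I2)
        fix x assume x: "x \<in> space M"
        have "((\<lambda>s. (f s x - f t0 x) /\<^sub>R (s - t0)) \<longlongrightarrow> f' t0 x) (at t0)"
          using der[OF x, of t0] by (simp only: has_vector_derivative_iff_quotient)
        then show "(\<lambda>n. (f (X n) x - f t0 x) /\<^sub>R (X n - t0)) \<longlonglongrightarrow> f' t0 x"
          using X unfolding tendsto_at_iff_sequentially comp_def by auto
      qed
    qed (use int meas g lip in \<open>auto intro!: borel_measurable_integrable\<close>)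
    then show "(\<lambda>n. (?F (X n) - ?F t0) /\<^sub>R (X n - t0)) \<longlonglongrightarrow> ?D"
      using int by simp
  qed
  then show ?thesis by (simp only: has_vector_derivative_iff_quotient)
qed

text \<open>The test functions of weak derivatives, with the derivative as a plain function.\<close>

definition test_fun :: "(real^4 \<Rightarrow> real) \<Rightarrow> (real^4 \<Rightarrow> real^4 \<Rightarrow> real) \<Rightarrow> bool" where
  "test_fun \<psi> \<psi>' \<longleftrightarrow>
     (\<forall>x. (\<psi> has_derivative \<psi>' x) (at x)) \<and> (\<forall>h. continuous_on UNIV (\<lambda>x. \<psi>' x h))"

text \<open>In finite dimension, continuity of all directional derivatives is continuity of the
  derivative in operator norm, so \<open>test_fun\<close> describes the same functions as the
  definition of \<open>weak_deriv\<close>.\<close>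

lemma test_fun_blinfun:
  assumes "test_fun \<psi> \<psi>'"
  obtains D :: "real^4 \<Rightarrow> ((real^4) \<Rightarrow>\<^sub>L real)"
  where "\<And>x h. D x h = \<psi>' x h" "\<And>x. (\<psi> has_derivative blinfun_apply (D x)) (at x)"
    "continuous_on UNIV D"
proof
  define D where "D = (\<lambda>x. Blinfun (\<psi>' x))"
  have bl: "bounded_linear (\<psi>' x)" for x
    using assms by (auto simp: test_fun_def dest: has_derivative_bounded_linear)
  show D: "D x h = \<psi>' x h" for x h by (simp add: D_def bounded_linear_Blinfun_apply bl)
  then have "blinfun_apply (D x) = \<psi>' x" for x by auto
  then show "(\<psi> has_derivative blinfun_apply (D x)) (at x)" for x
    using assms by (simp add: test_fun_def)
  show "continuous_on UNIV D"
    by (rule continuous_on_blinfun_componentwise) (use assms in \<open>simp add: D test_fun_def\<close>)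
qed

lemma test_fun_continuous:
  assumes "test_fun \<psi> \<psi>'"
  shows "continuous_on S \<psi>" "continuous_on S (\<lambda>x. \<psi>' x (frame i x))"
proof -
  show "continuous_on S \<psi>"
    using assms unfolding test_fun_def
    by (intro continuous_at_imp_continuous_on) (auto dest: has_derivative_continuous)
  obtain D :: "real^4 \<Rightarrow> ((real^4) \<Rightarrow>\<^sub>L real)"
    where D: "\<And>x h. D x h = \<psi>' x h" "continuous_on UNIV D"
    using test_fun_blinfun[OF assms] by metis
  show "continuous_on S (\<lambda>x. \<psi>' x (frame i x))"
    unfolding D(1)[symmetric]
    by (intro continuous_intros continuous_on_subset[OF D(2)]) auto
qed

lemma weak_derivD:
  assumes "weak_deriv i u v" "test_fun \<psi> \<psi>'"
  shows "(LINT x|vol3. \<psi> x *\<^sub>R v x) = - (LINT x|vol3. \<psi>' x (frame i x) *\<^sub>R u x)"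
proof -
  obtain D :: "real^4 \<Rightarrow> ((real^4) \<Rightarrow>\<^sub>L real)" where D: "\<And>x h. D x h = \<psi>' x h"
    "\<And>x. (\<psi> has_derivative blinfun_apply (D x)) (at x)" "continuous_on UNIV D"
    using test_fun_blinfun[OF assms(2)] by metis
  have "(LINT x|vol3. \<psi> x *\<^sub>R v x) = - (LINT x|vol3. D x (frame i x) *\<^sub>R u x)"
    by (rule assms(1)[unfolded weak_deriv_def, THEN conjunct2, THEN conjunct2, rule_format])
       (use D(2,3) in simp)
  then show ?thesis by (simp only: D(1))
qed

lemma weak_derivI:
  assumes "L2 u" "L2 v"
    and "\<And>\<psi> \<psi>'. test_fun \<psi> \<psi>' \<Longrightarrow>
      (LINT x|vol3. \<psi> x *\<^sub>R v x) = - (LINT x|vol3. \<psi>' x (frame i x) *\<^sub>R u x)"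
  shows "weak_deriv i u v"
  unfolding weak_deriv_def
proof (intro conjI assms(1,2) allI impI; elim conjE)
  fix \<psi> :: "real^4 \<Rightarrow> real" and D :: "real^4 \<Rightarrow> ((real^4) \<Rightarrow>\<^sub>L real)"
  assume 1: "\<forall>x. (\<psi> has_derivative blinfun_apply (D x)) (at x)" and 2: "continuous_on UNIV D"
  then have "test_fun \<psi> (\<lambda>x. blinfun_apply (D x))"
    unfolding test_fun_def by (auto intro!: continuous_intros)
  from assms(3)[OF this]
  show "(LINT x|vol3. \<psi> x *\<^sub>R v x) = - (LINT x|vol3. D x (frame i x) *\<^sub>R u x)" .
qed

text \<open>The flow of the frame field \<open>e\<^sub>i\<close> is the rotation \<open>x \<mapsto> cos t x + sin t e\<^sub>i(x)\<close>, which
  preserves \<^const>\<open>vol3\<close>; differentiate at \<open>t = 0\<close>.\<close>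

lemma integral_frame_deriv:
  assumes t: "test_fun \<psi> \<psi>'"
  shows "(LINT x|vol3. \<psi>' x (frame i x)) = 0"
proof -
  define R where "R t x = cos t *\<^sub>R x + sin t *\<^sub>R frame i x" for t and x :: "real^4"
  have inn: "R t x \<bullet> R t y = x \<bullet> y" for t x y
  proof -
    have "R t x \<bullet> R t y = (cos t)\<^sup>2 * (x \<bullet> y) + (sin t)\<^sup>2 * (x \<bullet> y)"
      using frame_skew[of x i y]
      by (simp add: R_def inner_add_left inner_add_right power2_eq_square algebra_simps)
    also have "\<dots> = x \<bullet> y" by (simp add: cos_squared_eq algebra_simps)
    finally show ?thesis .
  qed
  have lin: "linear (R t)" for t
    unfolding R_def by (rule linearI) (simp_all add: frame_add frame_scaleR algebra_simps)
  then have orth: "orthogonal_transformation (R t)" for t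
    using inn by (simp add: orthogonal_transformation_def)
  have S: "R t x \<in> S3" if "x \<in> S3" for t x
    using that orthogonal_transformation_norm[OF orth] by simp
  have contR: "continuous_on A (R t)" for t A
    using lin by (simp add: linear_continuous_on linear_conv_bounded_linear[symmetric])
  have der: "((\<lambda>t. \<psi> (R t x)) has_vector_derivative \<psi>' (R t x) (frame i (R t x))) (at t)" for t x
  proof -
    have 1: "((\<lambda>t. R t x) has_vector_derivative frame i (R t x)) (at t)"
      unfolding R_def
      by (auto intro!: derivative_eq_intros simp: has_vector_derivative_def frame_add frame_scaleR algebra_simps)
    have "(\<psi> has_derivative \<psi>' (R t x)) (at (R t x))" using t by (simp add: test_fun_def)
    from vector_derivative_diff_chain_within[OF 1 has_derivative_at_withinI[OF this]]
    show ?thesis by (simp add: comp_def)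
  qed
  obtain B where B: "\<And>x. x \<in> S3 \<Longrightarrow> norm (\<psi>' x (frame i x)) \<le> B"
    using continuous_bounded_S3[OF test_fun_continuous(2)[OF t]] by blast
  have "((\<lambda>t. LINT x|vol3. \<psi> (R t x)) has_vector_derivative
      (LINT x|vol3. \<psi>' (R 0 x) (frame i (R 0 x)))) (at 0)"
  proof (rule has_vector_derivative_integral[where g="\<lambda>x. B"])
    show "integrable vol3 (\<lambda>x. \<psi> (R t x))" for t
      by (intro continuous_integrable_vol3 continuous_on_compose2[OF test_fun_continuous(1)[OF t, of UNIV]] contR) auto
    show "(\<lambda>x. \<psi>' (R 0 x) (frame i (R 0 x))) \<in> borel_measurable vol3"
      by (simp add: R_def continuous_measurable_vol3 test_fun_continuous(2)[OF t])
  qed (use der B S in \<open>auto\<close>)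
  moreover have "(\<lambda>t. LINT x|vol3. \<psi> (R t x)) = (\<lambda>t. LINT x|vol3. \<psi> x)"
    by (rule ext) (rule vol3_integral_rotation[OF orth test_fun_continuous(1)[OF t]])
  ultimately have "((\<lambda>t. LINT x|vol3. \<psi> x) has_vector_derivative
      (LINT x|vol3. \<psi>' x (frame i x))) (at (0::real))" by (simp add: R_def)
  then show ?thesis
    using has_vector_derivative_const vector_derivative_unique_at by blast
qed

lemma L2_continuous:
  assumes "continuous_on S3 u" shows "L2 u"
  unfolding L2_def using assms
  by (intro conjI continuous_measurable_vol3 continuous_integrable_vol3 continuous_on_power continuous_on_norm)

text \<open>For a constant the weak identity is the vanishing mean of frame derivatives. Constants
  are the second function in Green's identity, and subtracting one leaves the derivatives
  unchanged.\<close>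

lemma weak_deriv_const: "weak_deriv i (\<lambda>x. c) (\<lambda>x. 0)"
proof (rule weak_derivI)
  fix \<psi> \<psi>' assume t: "test_fun \<psi> \<psi>'"
  have "(LINT x|vol3. \<psi>' x (frame i x) *\<^sub>R c) = (LINT x|vol3. \<psi>' x (frame i x)) *\<^sub>R c"
    by (intro integral_scaleR_left impI continuous_integrable_vol3 test_fun_continuous(2)[OF t])
  then show "(LINT x|vol3. \<psi> x *\<^sub>R 0) = - (LINT x|vol3. \<psi>' x (frame i x) *\<^sub>R c)"
    by (simp add: integral_frame_deriv[OF t])
qed (intro L2_continuous continuous_on_const)+

section \<open>Green functions and a Sobolev inequality\<close>

text \<open>Stands in for the Cauchy-Schwarz inequality for integrals. The price is that the Sobolev
  bounds are quadratic in the norms and have an additive constant, which is harmless as only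
  boundedness is wanted.\<close>

lemma abs_mult_le_squares: "\<bar>a\<bar> * b \<le> a\<^sup>2 + b\<^sup>2" for a b :: real
  using sum_squares_bound[of "\<bar>a\<bar>" b] zero_le_power2[of a] zero_le_power2[of b]
  unfolding power2_abs by linarith

lemma L2_integrable_mult:
  fixes u :: "real^4 \<Rightarrow> 'b::euclidean_space"
  assumes f: "continuous_on S3 f" and u: "L2 u"
  shows "integrable vol3 (\<lambda>x. f x *\<^sub>R u x)"
proof (rule Bochner_Integration.integrable_bound)
  show "integrable vol3 (\<lambda>x. (f x)\<^sup>2 + (norm (u x))\<^sup>2)"
  proof (rule Bochner_Integration.integrable_add)
    show "integrable vol3 (\<lambda>x. (f x)\<^sup>2)"
      by (intro continuous_integrable_vol3 continuous_on_power f)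
    show "integrable vol3 (\<lambda>x. (norm (u x))\<^sup>2)" using u by (simp add: L2_def)
  qed
  have [measurable]: "f \<in> borel_measurable vol3" "u \<in> borel_measurable vol3"
    using continuous_measurable_vol3[OF f] u by (auto simp: L2_def)
  show "(\<lambda>x. f x *\<^sub>R u x) \<in> borel_measurable vol3" by measurable
  show "AE x in vol3. norm (f x *\<^sub>R u x) \<le> norm ((f x)\<^sup>2 + (norm (u x))\<^sup>2)"
    by (intro AE_I2) (simp add: abs_of_nonneg abs_mult_le_squares)
qed

text \<open>On the sphere \<open>bump p e x = 1 + e - p \<bullet> x\<close>; in the form below it is smooth and positive on all of
  \<open>\<real>\<^sup>4\<close>, so that functions of it are admissible test functions.\<close>

definition bump :: "real^4 \<Rightarrow> real \<Rightarrow> real^4 \<Rightarrow> real" where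
  "bump p e x = (x - p) \<bullet> (x - p) / 2 + e"

lemma bump_pos: "e > 0 \<Longrightarrow> bump p e x > 0"
  by (simp add: bump_def add_nonneg_pos)

lemma bump_S3: "x \<in> S3 \<Longrightarrow> p \<in> S3 \<Longrightarrow> bump p e x = 1 + e - p \<bullet> x"
  by (simp add: bump_def inner_diff_left inner_diff_right inner_commute norm_eq_1)

lemma bump_le: "x \<in> S3 \<Longrightarrow> p \<in> S3 \<Longrightarrow> bump p e x \<le> 2 + e"
  using Cauchy_Schwarz_ineq2[of p x] by (simp add: bump_S3)

lemma bump_has_derivative [derivative_intros]:
  "(bump p e has_derivative (\<lambda>h. (x - p) \<bullet> h)) (at x)"
  unfolding bump_def by (auto intro!: derivative_eq_intros simp: inner_commute)

lemma continuous_on_bump [continuous_intros]: "continuous_on S (bump p e)"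
  unfolding bump_def by (auto intro!: continuous_intros)

lemma continuous_on_comp_bump:
  assumes "e > 0" "continuous_on {0<..} F"
  shows "continuous_on S (\<lambda>x. F (bump p e x))"
  by (rule continuous_on_compose2[OF assms(2) continuous_on_bump]) (auto simp: bump_pos assms)

lemma comp_bump_has_derivative:
  assumes "e > 0" "\<And>b. b > 0 \<Longrightarrow> (F has_real_derivative F1 b) (at b)"
  shows "((\<lambda>x. F (bump p e x)) has_derivative (\<lambda>h. F1 (bump p e x) * ((x - p) \<bullet> h))) (at x)"
proof -
  have "(F has_derivative (*) (F1 (bump p e x))) (at (bump p e x))"
    using assms(2)[OF bump_pos[OF assms(1)]] by (simp add: has_field_derivative_def)
  from diff_chain_at[OF bump_has_derivative this] show ?thesis by (simp add: comp_def)
qed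

lemma test_fun_bump:
  assumes e: "e > 0" and F: "\<And>b. b > 0 \<Longrightarrow> (F has_real_derivative F1 b) (at b)"
    and c: "continuous_on {0<..} F1"
  shows "test_fun (\<lambda>x. F (bump p e x)) (\<lambda>x h. F1 (bump p e x) * ((x - p) \<bullet> h))"
  unfolding test_fun_def using comp_bump_has_derivative[OF e F]
  by (auto intro!: continuous_intros continuous_on_comp_bump[OF e c])

section \<open>Green's identity for zonal functions\<close>

lemma integral_bump_deriv:
  assumes e: "e > 0" and F: "\<And>b. b > 0 \<Longrightarrow> (F has_real_derivative F1 b) (at b)"
    and c: "continuous_on {0<..} F1" and w: "weak_deriv i u v"
  shows "(LINT x|vol3. F (bump p e x) *\<^sub>R v x) = (LINT x|vol3. (F1 (bump p e x) * (p \<bullet> frame i x)) *\<^sub>R u x)"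
  using weak_derivD[OF w test_fun_bump[OF e F c, of p]]
  by (simp add: inner_diff_left)

text \<open>Two integrations by parts. The first leaves no sign, because the frame derivative of
  \<open>bump p e\<close> is \<open>- (p \<bullet> frame i x)\<close>; in the second,
  \<open>p \<bullet> frame i x\<close> is differentiated to
  \<open>- (p \<bullet> x)\<close>.\<close>

lemma green_frame:
  assumes e: "e > 0" and F: "\<And>b. b > 0 \<Longrightarrow> (F has_real_derivative F1 b) (at b)"
    and F1: "\<And>b. b > 0 \<Longrightarrow> (F1 has_real_derivative F2 b) (at b)"
    and c: "continuous_on {0<..} F2" and v: "weak_deriv i u v" and w: "weak_deriv i v w"
  shows "(LINT x|vol3. F (bump p e x) *\<^sub>R w x) =
    (LINT x|vol3. (F2 (bump p e x) * (p \<bullet> frame i x)\<^sup>2 + F1 (bump p e x) * (p \<bullet> x)) *\<^sub>R u x)"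
proof -
  have c1: "continuous_on {0<..} F1"
    by (rule DERIV_continuous_on) (use F1 in \<open>auto intro: has_field_derivative_at_within\<close>)
  have t: "test_fun (\<lambda>x. F1 (bump p e x) * (p \<bullet> frame i x))
     (\<lambda>x h. F1 (bump p e x) * (p \<bullet> frame i h) + F2 (bump p e x) * ((x - p) \<bullet> h) * (p \<bullet> frame i x))"
    unfolding test_fun_def
    by (auto intro!: continuous_intros continuous_on_comp_bump[OF e c] continuous_on_comp_bump[OF e c1]
        has_derivative_mult comp_bump_has_derivative[OF e F1] has_derivative_inner_right frame_has_derivative)
  have "(LINT x|vol3. F (bump p e x) *\<^sub>R w x)
      = (LINT x|vol3. (F1 (bump p e x) * (p \<bullet> frame i x)) *\<^sub>R v x)"
    by (rule integral_bump_deriv[OF e F c1 w])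
  also have "\<dots> = (LINT x|vol3. (F2 (bump p e x) * (p \<bullet> frame i x)\<^sup>2 + F1 (bump p e x) * (p \<bullet> x)) *\<^sub>R u x)"
    unfolding weak_derivD[OF v t] Bochner_Integration.integral_minus[symmetric]
      scaleR_minus_left[symmetric]
    by (intro Bochner_Integration.integral_cong arg_cong2[where f="(*\<^sub>R)"] refl)
       (simp add: inner_diff_left power2_eq_square algebra_simps)
  finally show ?thesis .
qed

text \<open>Weak form of the Laplacian \<open>(1 - s^2) g'' - 3 s g'\<close> of a zonal function of
  \<open>s = p \<bullet> x\<close> on the three-sphere, in the variable \<open>1 + e - s\<close>.
  The sum of the second derivatives along the frame is the Laplacian because the frame fields are
  geodesic.\<close>

lemma green_zonal:
  assumes e: "e > 0" and p: "p \<in> S3" and F: "\<And>b. b > 0 \<Longrightarrow> (F has_real_derivative F1 b) (at b)"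
    and F1: "\<And>b. b > 0 \<Longrightarrow> (F1 has_real_derivative F2 b) (at b)"
    and c: "continuous_on {0<..} F2"
    and v: "\<And>i. weak_deriv i u (v i)" and w: "\<And>i. weak_deriv i (v i) (w i)"
  shows "(\<Sum>i\<in>UNIV. LINT x|vol3. F (bump p e x) *\<^sub>R w i x) =
    (LINT x|vol3. (F2 (bump p e x) * (1 - (1 + e - bump p e x)\<^sup>2) + 3 * (1 + e - bump p e x) * F1 (bump p e x)) *\<^sub>R u x)"
proof -
  let ?Z = "\<lambda>x. F2 (bump p e x) * (1 - (1 + e - bump p e x)\<^sup>2) + 3 * (1 + e - bump p e x) * F1 (bump p e x)"
  let ?G = "\<lambda>i x. F2 (bump p e x) * (p \<bullet> frame i x)\<^sup>2 + F1 (bump p e x) * (p \<bullet> x)"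
  have c1: "continuous_on {0<..} F1"
    by (rule DERIV_continuous_on) (use F1 in \<open>auto intro: has_field_derivative_at_within\<close>)
  have u: "L2 u" using v[of 1] by (simp add: weak_deriv_def)
  have "(\<Sum>i\<in>UNIV. LINT x|vol3. F (bump p e x) *\<^sub>R w i x) =
    (\<Sum>i\<in>UNIV. LINT x|vol3. ?G i x *\<^sub>R u x)"
    by (simp only: green_frame[OF e F F1 c v w])
  also have "\<dots> = (LINT x|vol3. (\<Sum>i\<in>UNIV. ?G i x *\<^sub>R u x))"
    by (intro Bochner_Integration.integral_sum[symmetric] L2_integrable_mult[OF _ u] continuous_intros
        continuous_on_comp_bump[OF e c] continuous_on_comp_bump[OF e c1])
  also have "\<dots> = (LINT x|vol3. ?Z x *\<^sub>R u x)"
  proof (rule Bochner_Integration.integral_cong)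
    fix x assume "x \<in> space vol3"
    then have x: "x \<in> S3" by simp
    have sq: "(\<Sum>i\<in>UNIV. (p \<bullet> frame i x)\<^sup>2) = 1 - (1 + e - bump p e x)\<^sup>2"
      using x p unfolding sum_frame_squares by (simp add: bump_S3 norm_eq_1)
    have px: "p \<bullet> x = 1 + e - bump p e x" using x p by (simp add: bump_S3)
    have "(\<Sum>i\<in>UNIV. ?G i x)
        = F2 (bump p e x) * (\<Sum>i\<in>UNIV. (p \<bullet> frame i x)\<^sup>2) + 3 * (p \<bullet> x) * F1 (bump p e x)"
      by (simp add: sum.distrib sum_distrib_left)
    then show "(\<Sum>i\<in>UNIV. ?G i x *\<^sub>R u x)
      = ?Z x *\<^sub>R u x"
      by (simp only: scaleR_sum_left[symmetric] sq px)
  qed simp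
  finally show ?thesis .
qed

text \<open>Green's identity for \<open>- ln (bump p e)\<close> and the constant function \<open>1\<close>.\<close>

lemma integral_inverse_bump:
  assumes e: "e > 0" and p: "p \<in> S3"
  shows "(LINT x|vol3. 1 / bump p e x) \<le> 2 * area3"
proof -
  define G where "G b = 1 / b\<^sup>2 * (1 - (1 + e - b)\<^sup>2) + 3 * (1 + e - b) * (- 1 / b)" for b :: real
  have "(\<Sum>i\<in>(UNIV::3 set). LINT x|vol3. - ln (bump p e x) *\<^sub>R (0::real)) = (LINT x|vol3. G (bump p e x) *\<^sub>R 1)"
    unfolding G_def
    by (rule green_zonal[OF e p _ _ _ weak_deriv_const weak_deriv_const])
       (auto intro!: derivative_eq_intros continuous_intros simp: power2_eq_square field_simps)
  then have 0: "(LINT x|vol3. G (bump p e x)) = 0" by simp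
  have cont: "continuous_on S3 (\<lambda>x. G (bump p e x))" "continuous_on S3 (\<lambda>x. 1 / bump p e x)"
    unfolding G_def using bump_pos[OF e] by (auto intro!: continuous_intros simp: less_imp_neq[symmetric])
  \<comment> \<open>The Laplacian of \<open>- ln b\<close> is \<open>2 - 1 / b\<close> up to terms
    of favourable sign, so its vanishing mean bounds the mean of \<open>1 / b\<close> by 2,
    uniformly in \<open>e\<close> and \<open>p\<close>.\<close>
  have "G b + 1 / b \<le> 2" if "b > 0" for b
  proof -
    have "G b + 1 / b = 2 - e / b - (e\<^sup>2 + 2 * e) / b\<^sup>2"
      using that by (simp add: G_def field_simps power2_eq_square)
    moreover have "e / b \<ge> 0" "(e\<^sup>2 + 2 * e) / b\<^sup>2 \<ge> 0" using that e by auto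
    ultimately show ?thesis by linarith
  qed
  then have "(LINT x|vol3. G (bump p e x) + 1 / bump p e x) \<le> (LINT x|vol3. 2)"
    by (intro integral_mono Bochner_Integration.integrable_add continuous_integrable_vol3 cont)
       (auto simp: bump_pos[OF e])
  then show ?thesis
    using 0 by (subst (asm) Bochner_Integration.integral_add)
      (auto simp: continuous_integrable_vol3 cont area3_def)
qed

text \<open>\<open>green p e\<close> is a regularized fundamental solution at \<open>p\<close> of \<open>- \<Delta> + 3/4\<close>, the conformal Laplacian
  of the sphere, and \<open>delta p e\<close> is its image under this operator. It is nonnegative, has mass bounded
  from above and below, and concentrates at \<open>p\<close> as \<open>e\<close> tends to \<open>0\<close>.\<close>

definition green :: "real^4 \<Rightarrow> real \<Rightarrow> real^4 \<Rightarrow> real" where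
  "green p e x = bump p e x powr (-1/2)"

definition delta :: "real^4 \<Rightarrow> real \<Rightarrow> real^4 \<Rightarrow> real" where
  "delta p e x = 3/4 * ((1 + e)\<^sup>2 - 1) * bump p e x powr (-5/2)"

lemma continuous_on_green: "e > 0 \<Longrightarrow> continuous_on S (green p e)"
  unfolding green_def
  by (rule continuous_on_comp_bump[where F="\<lambda>b. b powr (-1/2)"]) (auto intro!: continuous_intros)

lemma continuous_on_delta: "e > 0 \<Longrightarrow> continuous_on S (delta p e)"
  unfolding delta_def
  by (rule continuous_on_mult_left, rule continuous_on_comp_bump[where F="\<lambda>b. b powr (-5/2)"])
     (auto intro!: continuous_intros)

lemma delta_nonneg: "e > 0 \<Longrightarrow> delta p e x \<ge> 0"
  by (simp add: delta_def power2_eq_square algebra_simps)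

text \<open>In the zonal Laplacian of \<open>b powr (-1/2)\<close> the terms in
  \<open>b powr (-3/2)\<close> cancel. There remain 3/4 of the function itself, which is the
  constant of the conformal Laplacian, and a multiple of \<open>b powr (-5/2)\<close> whose factor
  vanishes with \<open>e\<close>.\<close>

lemma delta_green:
  assumes e: "e > 0" and p: "p \<in> S3"
    and v: "\<And>i. weak_deriv i u (v i)" and w: "\<And>i. weak_deriv i (v i) (w i)"
  shows "(LINT x|vol3. delta p e x *\<^sub>R u x) =
    (3/4) *\<^sub>R (LINT x|vol3. green p e x *\<^sub>R u x) - (\<Sum>i\<in>UNIV. LINT x|vol3. green p e x *\<^sub>R w i x)"
proof -
  have u: "L2 u" using v[of 1] by (simp add: weak_deriv_def)
  have d: "((\<lambda>b. b powr a) has_real_derivative a * b powr (a - 1)) (at b)" if "b > 0" for a b :: real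
    using has_real_derivative_powr[OF that] by simp
  have "(\<Sum>i\<in>UNIV. LINT x|vol3. green p e x *\<^sub>R w i x)
     = (LINT x|vol3. (3/4 * bump p e x powr (-5/2) * (1 - (1 + e - bump p e x)\<^sup>2)
       + 3 * (1 + e - bump p e x) * (-1/2 * bump p e x powr (-3/2))) *\<^sub>R u x)"
    unfolding green_def
  proof (rule green_zonal[OF e p _ _ _ v w])
    show "((\<lambda>b. b powr (-1/2)) has_real_derivative -1/2 * b powr (-3/2)) (at b)" if "b > 0" for b :: real
      using d[OF that, of "-1/2"] by simp
    show "((\<lambda>b. -1/2 * b powr (-3/2)) has_real_derivative 3/4 * b powr (-5/2)) (at b)" if "b > 0" for b :: real
      using DERIV_cmult[OF d[OF that, of "-3/2"], of "-1/2"] by simp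
  qed (auto intro!: continuous_intros)
  also have "\<dots> = (LINT x|vol3. (3/4) *\<^sub>R (green p e x *\<^sub>R u x) - delta p e x *\<^sub>R u x)"
  proof (rule Bochner_Integration.integral_cong)
    fix x
    define b where "b = bump p e x"
    have b: "b > 0" using bump_pos[OF e] by (simp add: b_def)
    have 1: "b powr (-3/2) = b * b powr (-5/2)" "b powr (-1/2) = b * b * b powr (-5/2)"
      using powr_add[of b 1 "-5/2"] powr_add[of b 1 "-3/2"] b by simp_all
    have "3/4 * b powr (-5/2) * (1 - (1 + e - b)\<^sup>2) + 3 * (1 + e - b) * (-1/2 * b powr (-3/2))
        = 3/4 * b powr (-1/2) - 3/4 * ((1 + e)\<^sup>2 - 1) * b powr (-5/2)"
      unfolding 1 by (simp add: power2_eq_square field_simps)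
    then show "(3/4 * bump p e x powr (-5/2) * (1 - (1 + e - bump p e x)\<^sup>2)
       + 3 * (1 + e - bump p e x) * (-1/2 * bump p e x powr (-3/2))) *\<^sub>R u x
       = (3/4) *\<^sub>R (green p e x *\<^sub>R u x) - delta p e x *\<^sub>R u x"
      unfolding b_def green_def delta_def by (simp only: scaleR_left_diff_distrib scaleR_scaleR)
  qed simp
  also have "\<dots> = (3/4) *\<^sub>R (LINT x|vol3. green p e x *\<^sub>R u x) - (LINT x|vol3. delta p e x *\<^sub>R u x)"
    by (simp only: Bochner_Integration.integral_diff integral_scaleR_right
        L2_integrable_mult[OF continuous_on_green u, OF e] integrable_scaleR_right
        L2_integrable_mult[OF continuous_on_delta u, OF e])
  finally show ?thesis by simp
qed

text \<open>The square of \<open>green\<close> is \<open>1 / bump\<close>, whose integral is bounded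
  independently of \<open>e\<close> and \<open>p\<close>; so the limit in \<open>e\<close> and the
  supremum over \<open>p\<close> can be taken afterwards.\<close>

lemma norm_green_integral:
  fixes w :: "real^4 \<Rightarrow> 'b::euclidean_space"
  assumes e: "e > 0" and p: "p \<in> S3" and w: "L2 w"
  shows "norm (LINT x|vol3. green p e x *\<^sub>R w x) \<le> 2 * area3 + (LINT x|vol3. (norm (w x))\<^sup>2)"
proof -
  have ib: "integrable vol3 (\<lambda>x. 1 / bump p e x)"
    by (rule continuous_integrable_vol3) (use bump_pos[OF e] in \<open>auto intro!: continuous_intros simp: less_imp_neq[symmetric]\<close>)
  have iw: "integrable vol3 (\<lambda>x. (norm (w x))\<^sup>2)" using w by (simp add: L2_def)
  have "norm (LINT x|vol3. green p e x *\<^sub>R w x) \<le> (LINT x|vol3. norm (green p e x *\<^sub>R w x))"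
    by (rule integral_norm_bound)
  also have "\<dots> \<le> (LINT x|vol3. 1 / bump p e x + (norm (w x))\<^sup>2)"
  proof (rule integral_mono)
    show "integrable vol3 (\<lambda>x. norm (green p e x *\<^sub>R w x))"
      by (intro integrable_norm L2_integrable_mult w continuous_on_green e)
    fix x
    have "(green p e x)\<^sup>2 = bump p e x powr (-1/2 + -1/2)"
      unfolding green_def power2_eq_square powr_add ..
    also have "\<dots> = 1 / bump p e x" using bump_pos[OF e, of p x] by (simp add: powr_minus_divide)
    finally have "(green p e x)\<^sup>2 = 1 / bump p e x" .
    then show "norm (green p e x *\<^sub>R w x) \<le> 1 / bump p e x + (norm (w x))\<^sup>2"
      using abs_mult_le_squares[of "green p e x" "norm (w x)"] by simp
  qed (intro Bochner_Integration.integrable_add ib iw)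
  also have "\<dots> \<le> 2 * area3 + (LINT x|vol3. (norm (w x))\<^sup>2)"
    using integral_inverse_bump[OF e p] by (simp add: ib iw)
  finally show ?thesis .
qed

lemma norm_delta_integral:
  fixes u :: "real^4 \<Rightarrow> 'b::euclidean_space"
  assumes e: "e > 0" and p: "p \<in> S3"
    and v: "\<And>i. weak_deriv i u (v i)" and w: "\<And>i. weak_deriv i (v i) (w i)"
  shows "norm (LINT x|vol3. delta p e x *\<^sub>R u x) \<le> 8 * area3 + (LINT x|vol3. (norm (u x))\<^sup>2)
     + (\<Sum>i\<in>UNIV. LINT x|vol3. (norm (w i x))\<^sup>2)"
proof -
  have L: "L2 u" "\<And>i. L2 (w i)" using v[of 1] w by (auto simp: weak_deriv_def)
  have "norm (LINT x|vol3. delta p e x *\<^sub>R u x) \<le> (3/4) * norm (LINT x|vol3. green p e x *\<^sub>R u x)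
     + (\<Sum>i\<in>UNIV. norm (LINT x|vol3. green p e x *\<^sub>R w i x))"
    unfolding delta_green[OF e p v w]
    by (rule order_trans[OF norm_triangle_ineq4]) (auto intro: norm_sum)
  \<comment> \<open>Four integrals against \<open>green\<close>, one of \<open>u\<close> and one for
    each direction of the frame, contribute \<open>2 * area3\<close> each; the factor 3/4 is
    estimated by 1.\<close>
  also have "\<dots> \<le> (2 * area3 + (LINT x|vol3. (norm (u x))\<^sup>2))
     + (\<Sum>i\<in>(UNIV::3 set). 2 * area3 + (LINT x|vol3. (norm (w i x))\<^sup>2))"
    using norm_green_integral[OF e p L(1)] norm_ge_zero[of "LINT x|vol3. green p e x *\<^sub>R u x"]
    by (intro add_mono sum_mono norm_green_integral[OF e p L(2)]) linarith
  finally show ?thesis by (simp add: sum.distrib)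
qed

text \<open>Both bounds come from the representation of the constant 1: from below because
  \<open>bump\<close> is at most 4, so that \<open>green\<close> is at least 1/2, and from above by
  the general estimate, as \<open>8 + 1\<close>. The factor 3/8 reappears in the pointwise
  bounds.\<close>

lemma delta_mass:
  assumes e: "0 < e" "e \<le> 1" and p: "p \<in> S3"
  shows "(LINT x|vol3. delta p e x) \<ge> 3/8 * area3" "(LINT x|vol3. delta p e x) \<le> 9 * area3"
proof -
  have 1: "(LINT x|vol3. delta p e x) = 3/4 * (LINT x|vol3. green p e x)"
    using delta_green[OF e(1) p weak_deriv_const weak_deriv_const, of "1::real"] by simp
  have "area3 / 2 = (LINT x|vol3. 1/2)" by (simp add: area3_def)
  also have "\<dots> \<le> (LINT x|vol3. green p e x)"
  proof (intro integral_mono continuous_integrable_vol3 continuous_on_green e continuous_on_const)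
    fix x assume "x \<in> space vol3"
    then have "bump p e x \<le> 4" using bump_le[of x p e] p e by simp
    then have "4 powr (-1/2) \<le> green p e x"
      unfolding green_def using bump_pos[OF e(1), of p x] by (intro powr_mono2') auto
    moreover have "(4::real) powr (-1/2) = 1/2"
      using powr_half_sqrt[of "4::real"] by (simp add: powr_minus_divide)
    ultimately show "1/2 \<le> green p e x" by simp
  qed
  finally show "(LINT x|vol3. delta p e x) \<ge> 3/8 * area3" using 1 by simp
  show "(LINT x|vol3. delta p e x) \<le> 9 * area3"
    using norm_delta_integral[OF e(1) p weak_deriv_const weak_deriv_const, of "1::real"]
    by (simp add: area3_def)
qed

section \<open>Concentration at the centre and pointwise bounds\<close>

lemma delta_tendsto:
  fixes u :: "real^4 \<Rightarrow> 'b::euclidean_space"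
  assumes u: "continuous_on S3 u" and p: "p \<in> S3"
  shows "((\<lambda>e. LINT x|vol3. delta p e x *\<^sub>R (u x - u p)) \<longlongrightarrow> 0) (at_right 0)"
proof (rule tendstoI)
  fix r :: real assume r: "r > 0"
  obtain B where B: "\<And>x. x \<in> S3 \<Longrightarrow> norm (u x) \<le> B" "B \<ge> 0" using continuous_bounded_S3[OF u] by blast
  \<comment> \<open>With the mass bound \<open>9 * area3\<close>, the points near \<open>p\<close>
    contribute at most \<open>r / 2\<close>.\<close>
  define \<eta> where "\<eta> = r / (18 * area3)"
  have \<eta>: "\<eta> > 0" using r area3_pos by (simp add: \<eta>_def)
  obtain d where d: "d > 0" "\<And>x. x \<in> S3 \<Longrightarrow> dist x p < d \<Longrightarrow> dist (u x) (u p) < \<eta>"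
    using u p \<eta> unfolding continuous_on_iff by metis
  \<comment> \<open>At distance at least \<open>d\<close> from the centre \<open>bump\<close> is at
    least \<open>d^2 / 2\<close>, so \<open>delta\<close> is bounded there by a constant times the
    vanishing factor \<open>(1 + e)^2 - 1\<close>.\<close>
  define C where "C = 2 * B * (3/4 * (d\<^sup>2/2) powr (-5/2))"
  have bd: "norm (LINT x|vol3. delta p e x *\<^sub>R (u x - u p)) \<le> r/2 + C * ((1 + e)\<^sup>2 - 1) * area3"
    if e: "0 < e" "e \<le> 1" for e
  proof -
    have e2: "(1 + e)\<^sup>2 - 1 \<ge> 0" using e by (simp add: power2_eq_square algebra_simps)
    have id: "integrable vol3 (\<lambda>x. delta p e x)"
      by (intro continuous_integrable_vol3 continuous_on_delta e)
    have "norm (LINT x|vol3. delta p e x *\<^sub>R (u x - u p))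
        \<le> (LINT x|vol3. norm (delta p e x *\<^sub>R (u x - u p)))"
      by (rule integral_norm_bound)
    also have "\<dots> \<le> (LINT x|vol3. \<eta> * delta p e x + C * ((1 + e)\<^sup>2 - 1))"
    proof (rule integral_mono)
      show "integrable vol3 (\<lambda>x. norm (delta p e x *\<^sub>R (u x - u p)))"
        by (intro continuous_integrable_vol3 continuous_intros continuous_on_delta e u)
      show "integrable vol3 (\<lambda>x. \<eta> * delta p e x + C * ((1 + e)\<^sup>2 - 1))" using id by simp
      fix x assume "x \<in> space vol3" then have x: "x \<in> S3" by simp
      note dn = delta_nonneg[OF e(1), of p x]
      have C0: "C \<ge> 0" using B by (simp add: C_def)
      show "norm (delta p e x *\<^sub>R (u x - u p)) \<le> \<eta> * delta p e x + C * ((1 + e)\<^sup>2 - 1)"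
      proof (cases "dist x p < d")
        case True
        then have "norm (u x - u p) \<le> \<eta>" using d(2)[OF x] by (simp add: dist_norm)
        then have "norm (delta p e x *\<^sub>R (u x - u p)) \<le> \<eta> * delta p e x"
          using mult_left_mono[OF _ dn, of "norm (u x - u p)" \<eta>] dn by (simp add: mult.commute[of \<eta>])
        moreover have "C * ((1 + e)\<^sup>2 - 1) \<ge> 0" using C0 e2 by simp
        ultimately show ?thesis by linarith
      next
        case False
        then have "d\<^sup>2 \<le> (norm (x - p))\<^sup>2" using d(1) by (simp add: dist_norm power_mono)
        then have "d\<^sup>2/2 \<le> bump p e x" using e by (simp add: bump_def power2_norm_eq_inner)
        then have "bump p e x powr (-5/2) \<le> (d\<^sup>2/2) powr (-5/2)"
          using d(1) by (intro powr_mono2') auto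
        then have "delta p e x \<le> 3/4 * ((1 + e)\<^sup>2 - 1) * (d\<^sup>2/2) powr (-5/2)"
          unfolding delta_def using e2 by (intro mult_left_mono) auto
        moreover have "norm (u x - u p) \<le> 2 * B"
          using norm_triangle_ineq4[of "u x" "u p"] B(1)[OF x] B(1)[OF p] by linarith
        ultimately have "delta p e x * norm (u x - u p) \<le> (3/4 * ((1 + e)\<^sup>2 - 1) * (d\<^sup>2/2) powr (-5/2)) * (2 * B)"
          using dn e2 by (intro mult_mono) auto
        also have "\<dots> = C * ((1 + e)\<^sup>2 - 1)" by (simp add: C_def)
        finally have "norm (delta p e x *\<^sub>R (u x - u p)) \<le> C * ((1 + e)\<^sup>2 - 1)" using dn by simp
        moreover have "\<eta> * delta p e x \<ge> 0" using \<eta> dn by simp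
        ultimately show ?thesis by linarith
      qed
    qed
    also have "\<dots> = \<eta> * (LINT x|vol3. delta p e x) + C * ((1 + e)\<^sup>2 - 1) * area3"
      using id by (simp add: area3_def)
    also have "\<eta> * (LINT x|vol3. delta p e x) \<le> \<eta> * (9 * area3)"
      using delta_mass(2)[OF e p] \<eta> by (intro mult_left_mono) auto
    also have "\<eta> * (9 * area3) = r/2" using area3_pos by (simp add: \<eta>_def)
    finally show ?thesis by simp
  qed
  have "((\<lambda>e. r/2 + C * ((1 + e)\<^sup>2 - 1) * area3) \<longlongrightarrow> r/2 + C * ((1 + 0)\<^sup>2 - 1) * area3) (at_right 0)"
    by (intro tendsto_intros)
  then have "\<forall>\<^sub>F e in at_right 0. r/2 + C * ((1 + e)\<^sup>2 - 1) * area3 < r"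
    by (rule order_tendstoD(2)) (use r in simp)
  moreover have "\<forall>\<^sub>F e::real in at_right 0. 0 < e \<and> e \<le> 1"
    by (auto simp: eventually_at_right_field intro!: exI[of _ 1])
  ultimately show "\<forall>\<^sub>F e in at_right 0. dist (LINT x|vol3. delta p e x *\<^sub>R (u x - u p)) 0 < r"
  proof eventually_elim
    case (elim e)
    then show ?case using bd[of e] by simp
  qed
qed

text \<open>As the mass is only bounded below, the average is compared with \<open>u p\<close> times
  the mass. The bound \<open>g\<close> may depend on \<open>e\<close>: in the Lipschitz estimate it
  contains an average at the pole that vanishes only in the limit.\<close>

lemma norm_le_delta_limit:
  fixes u :: "real^4 \<Rightarrow> 'b::euclidean_space"
  assumes u: "continuous_on S3 u" and p: "p \<in> S3"
    and b: "\<forall>\<^sub>F e in at_right 0. norm (LINT x|vol3. delta p e x *\<^sub>R u x) \<le> g e"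
    and g: "(g \<longlongrightarrow> B) (at_right 0)"
  shows "3/8 * area3 * norm (u p) \<le> B"
proof -
  have "\<forall>\<^sub>F e::real in at_right 0. 0 < e \<and> e \<le> 1"
    by (auto simp: eventually_at_right_field intro!: exI[of _ 1])
  with b have "\<forall>\<^sub>F e in at_right 0. 3/8 * area3 * norm (u p)
      \<le> g e + norm (LINT x|vol3. delta p e x *\<^sub>R (u x - u p))"
  proof eventually_elim
    case (elim e)
    then have e: "0 < e" "e \<le> 1" by auto
    have i: "integrable vol3 (\<lambda>x. delta p e x *\<^sub>R u x)" "integrable vol3 (\<lambda>x. delta p e x *\<^sub>R u p)"
      by (intro continuous_integrable_vol3 continuous_intros continuous_on_delta e u)+
    have "(LINT x|vol3. delta p e x) *\<^sub>R u p = (LINT x|vol3. delta p e x *\<^sub>R u p)"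
      by (intro integral_scaleR_left[symmetric] impI continuous_integrable_vol3 continuous_on_delta e)
    also have "\<dots> = (LINT x|vol3. delta p e x *\<^sub>R u x) - (LINT x|vol3. delta p e x *\<^sub>R (u x - u p))"
      using i by (simp add: scaleR_diff_right)
    finally have eq: "(LINT x|vol3. delta p e x) *\<^sub>R u p = \<dots>" .
    have "norm ((LINT x|vol3. delta p e x) *\<^sub>R u p) \<le> norm (LINT x|vol3. delta p e x *\<^sub>R u x)
       + norm (LINT x|vol3. delta p e x *\<^sub>R (u x - u p))"
      unfolding eq by (rule norm_triangle_ineq4)
    moreover have "3/8 * area3 * norm (u p) \<le> norm ((LINT x|vol3. delta p e x) *\<^sub>R u p)"
      using mult_right_mono[OF order_trans[OF delta_mass(1)[OF e p] abs_ge_self] norm_ge_zero[of "u p"]]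
      by simp
    ultimately show ?case using elim by linarith
  qed
  moreover have "((\<lambda>e. g e + norm (LINT x|vol3. delta p e x *\<^sub>R (u x - u p))) \<longlongrightarrow> B + 0) (at_right 0)"
    by (intro tendsto_add g tendsto_norm_zero delta_tendsto u p)
  ultimately have "3/8 * area3 * norm (u p) \<le> B + 0"
    using tendsto_lowerbound[OF _ _ trivial_limit_at_right_real] by blast
  then show ?thesis by simp
qed

lemma sobolev_sup:
  fixes u :: "real^4 \<Rightarrow> 'b::euclidean_space"
  assumes u: "continuous_on S3 u" and p: "p \<in> S3"
    and v: "\<And>i. weak_deriv i u (v i)" and w: "\<And>i. weak_deriv i (v i) (w i)"
  shows "3/8 * area3 * norm (u p) \<le> 8 * area3 + (LINT x|vol3. (norm (u x))\<^sup>2)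
     + (\<Sum>i\<in>UNIV. LINT x|vol3. (norm (w i x))\<^sup>2)"
  by (rule norm_le_delta_limit[OF u p _ tendsto_const])
     (auto simp: eventually_at_right_field intro!: exI[of _ 1] norm_delta_integral[OF _ p v w])

section \<open>Uniqueness of weak derivatives\<close>

lemma norm_lincomb_square_le:
  fixes y z :: "'b::real_normed_vector"
  shows "(norm (a *\<^sub>R y + b *\<^sub>R z))\<^sup>2 \<le> 2 * a\<^sup>2 * (norm y)\<^sup>2 + 2 * b\<^sup>2 * (norm z)\<^sup>2"
proof -
  have "norm (a *\<^sub>R y + b *\<^sub>R z) \<le> \<bar>a\<bar> * norm y + \<bar>b\<bar> * norm z"
    using norm_triangle_ineq[of "a *\<^sub>R y" "b *\<^sub>R z"] by simp
  then have "(norm (a *\<^sub>R y + b *\<^sub>R z))\<^sup>2 \<le> (\<bar>a\<bar> * norm y + \<bar>b\<bar> * norm z)\<^sup>2"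
    by (intro power_mono) auto
  also have "\<dots> \<le> 2 * (\<bar>a\<bar> * norm y)\<^sup>2 + 2 * (\<bar>b\<bar> * norm z)\<^sup>2"
    using sum_squares_bound[of "\<bar>a\<bar> * norm y" "\<bar>b\<bar> * norm z"] by (simp add: power2_sum)
  finally show ?thesis by (simp add: power_mult_distrib)
qed

lemma L2_lincomb:
  fixes u :: "real^4 \<Rightarrow> 'b::euclidean_space"
  assumes "L2 u" "L2 u'"
  shows "L2 (\<lambda>x. a *\<^sub>R u x + b *\<^sub>R u' x)"
  unfolding L2_def
proof
  have [measurable]: "u \<in> borel_measurable vol3" "u' \<in> borel_measurable vol3"
    using assms by (auto simp: L2_def)
  show "(\<lambda>x. a *\<^sub>R u x + b *\<^sub>R u' x) \<in> borel_measurable vol3" by measurable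
  show "integrable vol3 (\<lambda>x. (norm (a *\<^sub>R u x + b *\<^sub>R u' x))\<^sup>2)"
  proof (rule Bochner_Integration.integrable_bound)
    show "integrable vol3 (\<lambda>x. 2 * a\<^sup>2 * (norm (u x))\<^sup>2 + 2 * b\<^sup>2 * (norm (u' x))\<^sup>2)"
      using assms by (simp add: L2_def)
    show "AE x in vol3. norm ((norm (a *\<^sub>R u x + b *\<^sub>R u' x))\<^sup>2)
        \<le> norm (2 * a\<^sup>2 * (norm (u x))\<^sup>2 + 2 * b\<^sup>2 * (norm (u' x))\<^sup>2)"
      by (intro AE_I2) (simp add: norm_lincomb_square_le)
  qed measurable
qed

lemma weak_deriv_lincomb:
  assumes 1: "weak_deriv i u v" and 2: "weak_deriv i u' v'"
  shows "weak_deriv i (\<lambda>x. a *\<^sub>R u x + b *\<^sub>R u' x) (\<lambda>x. a *\<^sub>R v x + b *\<^sub>R v' x)"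
proof (rule weak_derivI)
  have L: "L2 u" "L2 v" "L2 u'" "L2 v'" using 1 2 by (auto simp: weak_deriv_def)
  then show "L2 (\<lambda>x. a *\<^sub>R u x + b *\<^sub>R u' x)" "L2 (\<lambda>x. a *\<^sub>R v x + b *\<^sub>R v' x)"
    by (auto intro: L2_lincomb)
  fix \<psi> \<psi>' assume t: "test_fun \<psi> \<psi>'"
  have lin: "(LINT x|vol3. f x *\<^sub>R (a *\<^sub>R w x + b *\<^sub>R w' x))
      = a *\<^sub>R (LINT x|vol3. f x *\<^sub>R w x) + b *\<^sub>R (LINT x|vol3. f x *\<^sub>R w' x)"
    if "continuous_on S3 f" "L2 w" "L2 w'" for f and w w' :: "real^4 \<Rightarrow> 'a"
  proof -
    have "(LINT x|vol3. f x *\<^sub>R (a *\<^sub>R w x + b *\<^sub>R w' x))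
        = (LINT x|vol3. a *\<^sub>R (f x *\<^sub>R w x) + b *\<^sub>R (f x *\<^sub>R w' x))"
      by (simp add: scaleR_add_right mult.commute)
    then show ?thesis
      using L2_integrable_mult[OF that(1,2)] L2_integrable_mult[OF that(1,3)]
      by (simp del: scaleR_scaleR)
  qed
  show "(LINT x|vol3. \<psi> x *\<^sub>R (a *\<^sub>R v x + b *\<^sub>R v' x)) =
      - (LINT x|vol3. \<psi>' x (frame i x) *\<^sub>R (a *\<^sub>R u x + b *\<^sub>R u' x))"
    using weak_derivD[OF 1 t] weak_derivD[OF 2 t]
    by (simp add: lin L test_fun_continuous[OF t])
qed

section \<open>Density of test functions\<close>

lemma real_polynomial_function_test_fun:
  assumes "real_polynomial_function \<psi>"
  shows "\<exists>\<psi>'. test_fun \<psi> \<psi>'"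
  using assms
proof induction
  case (linear f)
  then have "test_fun f (\<lambda>x. f)"
    by (auto simp: test_fun_def bounded_linear_imp_has_derivative)
  then show ?case by (rule exI[of _ "\<lambda>x. f"])
next
  case (const c)
  have "test_fun (\<lambda>x. c) (\<lambda>x h. 0)" by (auto simp: test_fun_def)
  then show ?case by (rule exI[of _ "\<lambda>x h. 0"])
next
  case (add f g)
  then obtain f' g' where "test_fun f f'" "test_fun g g'" by blast
  then have "test_fun (\<lambda>x. f x + g x) (\<lambda>x h. f' x h + g' x h)"
    by (auto simp: test_fun_def intro!: continuous_intros has_derivative_add)
  then show ?case by (rule exI[of _ "\<lambda>x h. f' x h + g' x h"])
next
  case (mult f g)
  then obtain f' g' where fg: "test_fun f f'" "test_fun g g'" by blast
  then have "test_fun (\<lambda>x. f x * g x) (\<lambda>x h. f x * g' x h + f' x h * g x)"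
    using test_fun_continuous(1)[of f f' UNIV] test_fun_continuous(1)[of g g' UNIV]
    by (auto simp: test_fun_def intro!: continuous_intros has_derivative_mult)
  then show ?case by (rule exI[of _ "\<lambda>x h. f x * g' x h + f' x h * g x"])
qed

text \<open>Polynomials are test functions on the whole space, and by Stone-Weierstrass they are
  uniformly dense on the sphere; the error is \<open>e\<close> times the integral of
  \<open>\<bar>f x\<bar>\<close>.\<close>

lemma continuous_integral_zero:
  fixes f :: "real^4 \<Rightarrow> real"
  assumes f: "integrable vol3 f" and h: "continuous_on S3 h"
    and zero: "\<And>\<psi> \<psi>'. test_fun \<psi> \<psi>' \<Longrightarrow> (LINT x|vol3. \<psi> x * f x) = 0"
  shows "(LINT x|vol3. h x * f x) = 0"
proof -
  have int: "integrable vol3 (\<lambda>x. g x * f x)" if g: "continuous_on S3 g" for g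
  proof -
    obtain B where B: "\<And>x. x \<in> S3 \<Longrightarrow> norm (g x) \<le> B" "B \<ge> 0"
      using continuous_bounded_S3[OF g] by blast
    have [measurable]: "g \<in> borel_measurable vol3" "f \<in> borel_measurable vol3"
      using continuous_measurable_vol3[OF g] f by auto
    show ?thesis
      by (rule Bochner_Integration.integrable_bound[where f="\<lambda>x. B * f x"])
         (use f B in \<open>auto simp: abs_mult intro!: mult_right_mono\<close>)
  qed
  have "\<bar>LINT x|vol3. h x * f x\<bar> \<le> e * (LINT x|vol3. \<bar>f x\<bar>)" if e: "e > 0" for e
  proof -
    obtain g where g: "real_polynomial_function g" "\<And>x. x \<in> S3 \<Longrightarrow> \<bar>h x - g x\<bar> < e"
      using Stone_Weierstrass_real_polynomial_function[OF _ h e] by auto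
    obtain g' where t: "test_fun g g'" using real_polynomial_function_test_fun[OF g(1)] by blast
    have cg: "continuous_on S3 g" by (rule test_fun_continuous[OF t])
    have "(LINT x|vol3. h x * f x) = (LINT x|vol3. (h x - g x) * f x)"
      using zero[OF t] int[OF h] int[OF cg] by (simp add: left_diff_distrib)
    also have "\<bar>\<dots>\<bar> \<le> (LINT x|vol3. \<bar>(h x - g x) * f x\<bar>)"
      by (rule integral_abs_bound)
    also have "\<dots> \<le> (LINT x|vol3. e * \<bar>f x\<bar>)"
    proof (rule integral_mono)
      show "integrable vol3 (\<lambda>x. \<bar>(h x - g x) * f x\<bar>)"
        by (intro integrable_abs int continuous_on_diff h cg)
      show "integrable vol3 (\<lambda>x. e * \<bar>f x\<bar>)" using f by simp
      fix x assume "x \<in> space vol3"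
      then show "\<bar>(h x - g x) * f x\<bar> \<le> e * \<bar>f x\<bar>"
        unfolding abs_mult using g(2)[of x] by (intro mult_right_mono) auto
    qed
    finally show ?thesis by simp
  qed
  then have "\<bar>LINT x|vol3. h x * f x\<bar> \<le> 0"
    by (intro tendsto_lowerbound[of "\<lambda>e. e * (LINT x|vol3. \<bar>f x\<bar>)" _ "at_right 0"])
       (auto intro!: tendsto_mult_left_zero tendsto_ident_at simp: eventually_at_right_field intro: exI[of _ 1])
  then show ?thesis by simp
qed

text \<open>Continuous cutoffs converge to the indicator of a closed set, so \<open>f\<close> has
  integral 0 over closed sets. These form an intersection-stable generator of the Borel sets, and a
  Dynkin argument covers the rest.\<close>

lemma AE_zero_if_orthogonal:
  fixes f :: "real^4 \<Rightarrow> real"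
  assumes f: "integrable vol3 f"
    and zero: "\<And>\<psi> \<psi>'. test_fun \<psi> \<psi>' \<Longrightarrow> (LINT x|vol3. \<psi> x * f x) = 0"
  shows "AE x in vol3. f x = 0"
proof (rule density_unique_real)
  have [measurable]: "f \<in> borel_measurable vol3" using f by simp
  have S: "B \<inter> S3 \<in> sets vol3" if "B \<in> sets borel" for B
    using that by (auto simp: sets_vol3 sets_restrict_space)
  have si: "set_integrable vol3 (B \<inter> S3) f" if "B \<in> sets borel" for B
    using integrable_mult_indicator[OF S[OF that] f] by (simp add: set_integrable_def)
  have cl: "(LINT x:(K \<inter> S3)|vol3. f x) = 0" if K: "closed K" "K \<noteq> {}" for K
  proof -
    \<comment> \<open>For \<open>n > 0\<close> this cutoff is 1 on \<open>K\<close> and 0 from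
      distance \<open>1 / n\<close> on.\<close>
    define h where "h n x = max 0 (1 - real n * infdist x K)" for n x
    have ch: "continuous_on A (h n)" for n A
      unfolding h_def by (intro continuous_intros)
    have "(\<lambda>n. LINT x|vol3. h n x * f x) \<longlonglongrightarrow> (LINT x|vol3. indicator (K \<inter> S3) x *\<^sub>R f x)"
    proof (rule integral_dominated_convergence[where w="\<lambda>x. \<bar>f x\<bar>"])
      show "AE x in vol3. (\<lambda>n. h n x * f x) \<longlonglongrightarrow> indicator (K \<inter> S3) x *\<^sub>R f x"
      proof (rule AE_I2)
        fix x assume "x \<in> space vol3" then have x: "x \<in> S3" by simp
        have "(\<lambda>n. h n x) \<longlonglongrightarrow> indicator K x"
        proof (cases "x \<in> K")
          case True then show ?thesis by (simp add: h_def)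
        next
          case False
          then have d: "infdist x K > 0"
            using K by (metis in_closed_iff_infdist_zero infdist_nonneg less_eq_real_def)
          then obtain N where N: "1 < real N * infdist x K" using reals_Archimedean3 by blast
          have "h n x = 0" if "n \<ge> N" for n
          proof -
            have "real N * infdist x K \<le> real n * infdist x K"
              using that d by (intro mult_right_mono) auto
            then show ?thesis using N by (simp add: h_def)
          qed
          then have "\<forall>\<^sub>F n in sequentially. h n x = 0" by (auto simp: eventually_sequentially)
          then show ?thesis using False by (simp add: tendsto_eventually)
        qed
        then show "(\<lambda>n. h n x * f x) \<longlonglongrightarrow> indicator (K \<inter> S3) x *\<^sub>R f x"
          using x by (auto intro!: tendsto_intros simp: indicator_inter_arith)
      qed
      show "(\<lambda>x. h n x * f x) \<in> borel_measurable vol3" for n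
        using continuous_measurable_vol3[OF ch] by simp
      have "0 \<le> h n x \<and> h n x \<le> 1" for n x by (simp add: h_def infdist_nonneg)
      then show "AE x in vol3. norm (h n x * f x) \<le> \<bar>f x\<bar>" for n
        by (intro AE_I2) (simp add: abs_mult mult_left_le_one_le)
      show "(\<lambda>x. indicator (K \<inter> S3) x *\<^sub>R f x) \<in> borel_measurable vol3"
        using S[of K] K by measurable
    qed (use f in auto)
    moreover have "(LINT x|vol3. h n x * f x) = 0" for n
      by (rule continuous_integral_zero[OF f ch zero])
    ultimately show ?thesis
      by (simp add: set_lebesgue_integral_def LIMSEQ_const_iff)
  qed
  have all: "(LINT x:(B \<inter> S3)|vol3. f x) = 0" if "B \<in> sets borel" for B
  proof -
    have B: "B \<in> sigma_sets UNIV (Collect closed)" using that by (simp add: borel_eq_closed)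
    have st2: "Collect closed \<subseteq> Pow (UNIV :: (real^4) set)" by simp
    have st: "Int_stable (Collect closed :: (real^4) set set)" by (auto simp: Int_stable_def)
    have bo: "A \<in> sets borel" if "A \<in> sigma_sets UNIV (Collect closed)" for A :: "(real^4) set"
      using that by (simp add: borel_eq_closed)
    show ?thesis
      using st st2 B
    proof (induction rule: sigma_sets_induct_disjoint)
      case (basic A) then show ?case using cl[of A] by (cases "A = {}") (auto simp: set_lebesgue_integral_def)
    next
      case empty show ?case by (simp add: set_lebesgue_integral_def)
    next
      case (compl A)
      have "(LINT x:(UNIV \<inter> S3)|vol3. f x) = (LINT x:(A \<inter> S3) \<union> ((UNIV - A) \<inter> S3)|vol3. f x)"
        by (rule arg_cong[where f="\<lambda>A. LINT x:A|vol3. f x"]) auto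
      also have "\<dots> = (LINT x:(A \<inter> S3)|vol3. f x) + (LINT x:((UNIV - A) \<inter> S3)|vol3. f x)"
        using bo[OF compl(1)] by (intro set_integral_Un si) auto
      finally show ?case using cl[of UNIV] compl by simp
    next
      case (union A)
      have "(LINT x:(\<Union>i. A i \<inter> S3)|vol3. f x) = (\<Sum>i. LINT x:(A i \<inter> S3)|vol3. f x)"
      proof (rule lebesgue_integral_countable_add)
        show "A i \<inter> S3 \<in> sets vol3" for i
          by (intro S bo) (use union(2) in auto)
        show "i \<noteq> j \<Longrightarrow> A i \<inter> S3 \<inter> (A j \<inter> S3) = {}" for i j
          using union(1) by (auto simp: disjoint_family_on_def)
        have "\<Union>(range A) \<in> sets borel"
          by (intro sets.countable_UN bo) (use union(2) bo in auto)
        from si[OF this] show "set_integrable vol3 (\<Union>i. A i \<inter> S3) f" by simp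
      qed
      then show ?case using union(3) by simp
    qed
  qed
  fix A assume "A \<in> sets vol3"
  then obtain B where "B \<in> sets borel" "A = B \<inter> S3"
    by (auto simp: sets_vol3 sets_restrict_space)
  then show "(LINT x:A|vol3. f x) = (LINT x:A|vol3. 0)" using all by simp
qed (use f in auto)

lemma weak_deriv_unique:
  fixes v :: "real^4 \<Rightarrow> 'b::euclidean_space"
  assumes v: "weak_deriv i u v" and v': "weak_deriv i u v'"
  shows "AE x in vol3. v x = v' x"
proof -
  have L: "L2 v" "L2 v'" using v v' by (auto simp: weak_deriv_def)
  have int: "integrable vol3 v" "integrable vol3 v'"
    using L2_integrable_mult[OF continuous_on_const[of _ 1]] L by auto
  have "AE x in vol3. (v x - v' x) \<bullet> b = 0" for b
  proof (rule AE_zero_if_orthogonal)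
    show "integrable vol3 (\<lambda>x. (v x - v' x) \<bullet> b)" using int by simp
    fix \<psi> \<psi>' assume t: "test_fun \<psi> \<psi>'"
    have i: "integrable vol3 (\<lambda>x. \<psi> x *\<^sub>R v x)" "integrable vol3 (\<lambda>x. \<psi> x *\<^sub>R v' x)"
      using L test_fun_continuous[OF t] by (auto intro: L2_integrable_mult)
    have "(LINT x|vol3. \<psi> x *\<^sub>R v x - \<psi> x *\<^sub>R v' x) = 0"
      using i weak_derivD[OF v t] weak_derivD[OF v' t] by simp
    then have "(LINT x|vol3. (\<psi> x *\<^sub>R v x - \<psi> x *\<^sub>R v' x) \<bullet> b) = 0"
      using i by (simp only: integral_inner_left Bochner_Integration.integrable_diff inner_zero_left)
    then show "(LINT x|vol3. \<psi> x * ((v x - v' x) \<bullet> b)) = 0"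
      by (simp add: inner_diff_left right_diff_distrib)
  qed
  then have "AE x in vol3. \<forall>b\<in>Basis. (v x - v' x) \<bullet> b = 0"
    by (intro AE_finite_allI) auto
  then show ?thesis
    by eventually_elim (simp add: euclidean_eq_iff[where 'a='b] inner_diff_left)
qed

text \<open>Equality almost everywhere does not carry over measurability with respect to Borel sets,
  hence the third assumption.\<close>

lemma weak_deriv_cong_AE:
  assumes w: "weak_deriv i u v" and eq: "AE x in vol3. u x = u' x" and m: "L2 u'"
  shows "weak_deriv i u' v"
proof (rule weak_derivI)
  show "L2 v" using w by (simp add: weak_deriv_def)
  have [measurable]: "u \<in> borel_measurable vol3" "u' \<in> borel_measurable vol3"
    using w m by (auto simp: weak_deriv_def L2_def)
  fix \<psi> \<psi>' assume t: "test_fun \<psi> \<psi>'"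
  have [measurable]: "(\<lambda>x. \<psi>' x (frame i x)) \<in> borel_measurable vol3"
    by (intro continuous_measurable_vol3 test_fun_continuous[OF t])
  have "(LINT x|vol3. \<psi>' x (frame i x) *\<^sub>R u x) = (LINT x|vol3. \<psi>' x (frame i x) *\<^sub>R u' x)"
    by (rule integral_cong_AE) (use eq in \<open>auto elim: AE_mp\<close>)
  then show "(LINT x|vol3. \<psi> x *\<^sub>R v x) = - (LINT x|vol3. \<psi>' x (frame i x) *\<^sub>R u' x)"
    using weak_derivD[OF w t] by simp
qed (rule m)

lemma weak_deriv_wd: "weak_deriv i u v \<Longrightarrow> weak_deriv i u (wd i u)"
  unfolding wd_def by (rule someI[of "weak_deriv i u"])

section \<open>Lipschitz continuity\<close>

lemma sph_S3: "norm \<omega> = 1 \<Longrightarrow> sph \<zeta> \<omega> \<in> S3"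
proof -
  assume "norm \<omega> = 1"
  then have "(\<omega>$1)\<^sup>2 + (\<omega>$2)\<^sup>2 + (\<omega>$3)\<^sup>2 = 1"
    by (simp add: norm_eq_1 inner_vec_def sum_3 power2_eq_square)
  moreover have "sph \<zeta> \<omega> \<bullet> sph \<zeta> \<omega>
      = (cos \<zeta>)\<^sup>2 + (sin \<zeta>)\<^sup>2 * ((\<omega>$1)\<^sup>2 + (\<omega>$2)\<^sup>2 + (\<omega>$3)\<^sup>2)"
    by (simp add: sph_def inner_vec_def sum_4 power2_eq_square algebra_simps)
  ultimately show ?thesis by (simp add: norm_eq_1)
qed

lemma sph_pi: "sph pi \<omega> = sph pi \<omega>'"
  by (simp add: sph_def)

text \<open>In quaternions the meridian is \<open>exp (\<zeta> \<omega>)\<close> with \<omega>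
  imaginary of square -1, so its velocity is its right product with \<omega>: a combination of the
  frame with constant coefficients.\<close>

lemma sph_has_vector_derivative:
  assumes "norm \<omega> = 1"
  shows "((\<lambda>\<zeta>. sph \<zeta> \<omega>) has_vector_derivative (\<Sum>k\<in>UNIV. \<omega>$k *\<^sub>R frame k (sph \<zeta> \<omega>))) (at \<zeta> within S)"
proof -
  have "(\<omega>$1)\<^sup>2 + (\<omega>$2)\<^sup>2 + (\<omega>$3)\<^sup>2 = 1"
    using assms by (simp add: norm_eq_1 inner_vec_def sum_3 power2_eq_square)
  then have "sin \<zeta> * ((\<omega>$1)\<^sup>2 + (\<omega>$2)\<^sup>2 + (\<omega>$3)\<^sup>2) = sin \<zeta>" by simp
  then have w3: "sin \<zeta> * (\<omega>$1 * \<omega>$1) + (sin \<zeta> * (\<omega>$2 * \<omega>$2) + sin \<zeta> * (\<omega>$3 * \<omega>$3)) = sin \<zeta>"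
    by (simp add: power2_eq_square algebra_simps)
  have eq: "(\<Sum>k\<in>UNIV. \<omega>$k *\<^sub>R frame k (sph \<zeta> \<omega>))
      = vector [- sin \<zeta>, cos \<zeta> * \<omega>$1, cos \<zeta> * \<omega>$2, cos \<zeta> * \<omega>$3]"
    using w3 by (simp add: vec_eq_iff forall_4 sum_3 frame_def sph_def algebra_simps)
  have "((\<lambda>\<zeta>. cos \<zeta> *\<^sub>R vector [1, 0, 0, 0] + sin \<zeta> *\<^sub>R vector [0, \<omega>$1, \<omega>$2, \<omega>$3] :: real^4)
      has_vector_derivative (- sin \<zeta>) *\<^sub>R vector [1, 0, 0, 0] + cos \<zeta> *\<^sub>R vector [0, \<omega>$1, \<omega>$2, \<omega>$3])
      (at \<zeta> within S)"
    by (auto intro!: derivative_eq_intros simp: has_vector_derivative_def algebra_simps)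
  moreover have "sph \<zeta> \<omega> = cos \<zeta> *\<^sub>R vector [1, 0, 0, 0] + sin \<zeta> *\<^sub>R vector [0, \<omega>$1, \<omega>$2, \<omega>$3]" for \<zeta>
    by (simp add: sph_def vec_eq_iff forall_4)
  moreover have "vector [- sin \<zeta>, cos \<zeta> * \<omega>$1, cos \<zeta> * \<omega>$2, cos \<zeta> * \<omega>$3]
      = (- sin \<zeta>) *\<^sub>R vector [1, 0, 0, 0] + cos \<zeta> *\<^sub>R (vector [0, \<omega>$1, \<omega>$2, \<omega>$3] :: real^4)"
    by (simp add: vec_eq_iff forall_4)
  ultimately show ?thesis unfolding eq by simp
qed

section \<open>Averages along a meridian\<close>

lemma delta_profile_deriv:
  fixes e :: real
  assumes "b > 0"
  shows "((\<lambda>b. 3/4 * ((1 + e)\<^sup>2 - 1) * b powr (-5/2)) has_real_derivative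
    3/4 * ((1 + e)\<^sup>2 - 1) * (-5/2 * b powr (-7/2))) (at b)"
  using DERIV_cmult[OF has_real_derivative_powr[OF assms, of "-5/2"], of "3/4 * ((1 + e)\<^sup>2 - 1)"] by simp

text \<open>\<open>bump\<close> is symmetric in its centre and its argument, and skewness of
  \<open>frame k\<close> moves the field from the centre to \<open>x\<close>. This puts the
  derivative in the form in which it can be integrated by parts.\<close>

lemma delta_path_has_vector_derivative:
  assumes e: "e > 0" and w: "norm \<omega> = 1"
  shows "((\<lambda>\<zeta>. delta (sph \<zeta> \<omega>) e x) has_vector_derivative
     (\<Sum>k\<in>UNIV. \<omega>$k * (3/4 * ((1 + e)\<^sup>2 - 1) * (-5/2 * bump (sph \<zeta> \<omega>) e x powr (-7/2))
        * (sph \<zeta> \<omega> \<bullet> frame k x)))) (at \<zeta>)"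
proof -
  let ?F = "\<lambda>b. 3/4 * ((1 + e)\<^sup>2 - 1) * b powr (-5/2)"
  let ?F1 = "\<lambda>b. 3/4 * ((1 + e)\<^sup>2 - 1) * (-5/2 * b powr (-7/2))"
  define p where "p = sph \<zeta> \<omega>"
  define p' where "p' = (\<Sum>k\<in>UNIV. \<omega>$k *\<^sub>R frame k p)"
  have sym: "bump q e x = bump x e q" for q
    by (simp add: bump_def inner_diff_left inner_diff_right inner_commute)
  note dF = delta_profile_deriv[of _ e]
  have 1: "((\<lambda>q. ?F (bump x e q)) has_derivative (\<lambda>h. ?F1 (bump x e p) * ((p - x) \<bullet> h))) (at p)"
    by (rule comp_bump_has_derivative[OF e dF])
  have 2: "((\<lambda>\<zeta>. sph \<zeta> \<omega>) has_vector_derivative p') (at \<zeta>)"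
    unfolding p'_def p_def by (rule sph_has_vector_derivative[OF w])
  have "((\<lambda>\<zeta>. ?F (bump x e (sph \<zeta> \<omega>))) has_vector_derivative ?F1 (bump x e p) * ((p - x) \<bullet> p')) (at \<zeta>)"
    using vector_derivative_diff_chain_within[OF 2 has_derivative_at_withinI[OF 1[unfolded p_def]]]
    by (simp add: comp_def p_def)
  moreover have "(p - x) \<bullet> p' = (\<Sum>k\<in>UNIV. \<omega>$k * (p \<bullet> frame k x))"
    by (simp add: p'_def inner_sum_right inner_diff_left frame_skew[of x] inner_commute[of "frame _ x"])
  moreover have "?F1 (bump x e p) * (\<Sum>k\<in>UNIV. \<omega>$k * (p \<bullet> frame k x))
     = (\<Sum>k\<in>UNIV. \<omega>$k * (?F1 (bump x e p) * (p \<bullet> frame k x)))"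
    by (simp add: sum_distrib_left mult.left_commute)
  ultimately show ?thesis unfolding delta_def sym p_def by simp
qed

text \<open>The inner product is invariant under left translations on the unit quaternions, so a derivative of
  \<^const>\<open>delta\<close> in its centre is minus a frame derivative in its argument, which can be
  integrated by parts.\<close>

lemma delta_path_lipschitz:
  fixes u :: "real^4 \<Rightarrow> 'b::euclidean_space"
  assumes u: "continuous_on S3 u" and e: "e > 0" and w: "norm \<omega> = 1"
    and v: "\<And>k. weak_deriv k u (v k)"
    and C: "\<And>k p. p \<in> S3 \<Longrightarrow> norm (LINT x|vol3. delta p e x *\<^sub>R v k x) \<le> C"
  shows "norm ((LINT x|vol3. delta (sph \<zeta> \<omega>) e x *\<^sub>R u x) - (LINT x|vol3. delta (sph \<zeta>' \<omega>) e x *\<^sub>R u x))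
     \<le> 3 * C * \<bar>\<zeta> - \<zeta>'\<bar>"
proof -
  let ?F = "\<lambda>b. 3/4 * ((1 + e)\<^sup>2 - 1) * b powr (-5/2)"
  let ?F1 = "\<lambda>b. 3/4 * ((1 + e)\<^sup>2 - 1) * (-5/2 * b powr (-7/2))"
  let ?g = "\<lambda>\<zeta> k x. ?F1 (bump (sph \<zeta> \<omega>) e x) * (sph \<zeta> \<omega> \<bullet> frame k x)"
  note dF = delta_profile_deriv[of _ e]
  have cF1: "continuous_on {0<..} ?F1" by (auto intro!: continuous_intros)
  have cb: "continuous_on S3 (\<lambda>x. ?F1 (bump p e x))" for p
    by (rule continuous_on_comp_bump[OF e cF1])
  have w1: "\<bar>\<omega>$k\<bar> \<le> 1" for k using component_le_norm_cart[of \<omega> k] w by simp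
  define K where "K \<zeta> x = (\<Sum>k\<in>UNIV. \<omega>$k * ?g \<zeta> k x)" for \<zeta> x
  obtain B where B: "\<And>x. x \<in> S3 \<Longrightarrow> norm (u x) \<le> B" "B \<ge> 0" using continuous_bounded_S3[OF u] by blast
  \<comment> \<open>Uses \<open>bump\<close> at least \<open>e\<close>, hence blows up as
    \<open>e\<close> tends to 0. It only justifies differentiation under the integral; the Lipschitz
    constant comes from \<open>C\<close>.\<close>
  define M where "M = \<bar>3/4 * ((1 + e)\<^sup>2 - 1)\<bar> * (5/2 * e powr (-7/2))"
  have Kb: "\<bar>K \<zeta> x\<bar> \<le> 3 * M" if "x \<in> S3" for \<zeta> x
  proof -
    have "\<bar>\<omega>$k * ?g \<zeta> k x\<bar> \<le> 1 * (M * 1)" for k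
      unfolding abs_mult[of "\<omega>$k"] abs_mult[of "?F1 (bump (sph \<zeta> \<omega>) e x)"]
    proof (intro mult_mono w1)
      have "bump (sph \<zeta> \<omega>) e x powr (-7/2) \<le> e powr (-7/2)"
        using e by (intro powr_mono2') (auto simp: bump_def)
      then show "\<bar>?F1 (bump (sph \<zeta> \<omega>) e x)\<bar> \<le> M"
        unfolding M_def abs_mult[of "3/4 * ((1 + e)\<^sup>2 - 1)"] by (intro mult_left_mono) (auto simp: abs_mult)
      have "\<bar>sph \<zeta> \<omega> \<bullet> frame k x\<bar> \<le> norm (sph \<zeta> \<omega>) * norm (frame k x)" by (rule Cauchy_Schwarz_ineq2)
      then show "\<bar>sph \<zeta> \<omega> \<bullet> frame k x\<bar> \<le> 1" using that sph_S3[OF w, of \<zeta>] by simp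
    qed (auto simp: M_def)
    then have "(\<Sum>k\<in>UNIV. \<bar>\<omega>$k * ?g \<zeta> k x\<bar>) \<le> (\<Sum>k\<in>(UNIV::3 set). M)"
      by (intro sum_mono) simp
    then show ?thesis unfolding K_def using sum_abs[of "\<lambda>k. \<omega>$k * ?g \<zeta> k x" UNIV]
      by simp
  qed
  have Kc: "continuous_on S3 (K \<zeta>)" for \<zeta>
    unfolding K_def
    by (intro continuous_intros cb)
  let ?U = "\<lambda>\<zeta>. LINT x|vol3. delta (sph \<zeta> \<omega>) e x *\<^sub>R u x"
  have d: "(?U has_vector_derivative (LINT x|vol3. K \<zeta> x *\<^sub>R u x)) (at \<zeta>)" for \<zeta>
  proof (rule has_vector_derivative_integral[where g="\<lambda>x. 3 * M * B"])
    show "integrable vol3 (\<lambda>x. delta (sph t \<omega>) e x *\<^sub>R u x)" for t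
      by (intro continuous_integrable_vol3 continuous_intros continuous_on_delta e u)
    show "(\<lambda>x. K \<zeta> x *\<^sub>R u x) \<in> borel_measurable vol3"
      by (intro continuous_measurable_vol3 continuous_intros Kc u)
    show "((\<lambda>t. delta (sph t \<omega>) e x *\<^sub>R u x) has_vector_derivative K t x *\<^sub>R u x) (at t)" for t x
      using has_vector_derivative_scaleR[OF _ has_vector_derivative_const, of "\<lambda>t. delta (sph t \<omega>) e x" "K t x" t UNIV "u x"]
        delta_path_has_vector_derivative[OF e w, of x t]
      by (simp add: K_def has_real_derivative_iff_has_vector_derivative)
    show "norm (K t x *\<^sub>R u x) \<le> 3 * M * B" if "x \<in> space vol3" for t x
      using that Kb[of x t] B by (simp add: mult_mono)
  qed simp
  have Leq: "(LINT x|vol3. K \<zeta> x *\<^sub>R u x) = (\<Sum>k\<in>UNIV. \<omega>$k *\<^sub>R (LINT x|vol3. delta (sph \<zeta> \<omega>) e x *\<^sub>R v k x))" for \<zeta>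
  proof -
    have ib: "(LINT x|vol3. delta (sph \<zeta> \<omega>) e x *\<^sub>R v k x)
        = (LINT x|vol3. ?g \<zeta> k x *\<^sub>R u x)" for k
      unfolding delta_def by (rule integral_bump_deriv[OF e dF cF1 v])
    have i: "integrable vol3 (\<lambda>x. ?g \<zeta> k x *\<^sub>R u x)" for k
      by (intro continuous_integrable_vol3 continuous_intros u cb)
    have "(LINT x|vol3. K \<zeta> x *\<^sub>R u x)
       = (LINT x|vol3. (\<Sum>k\<in>UNIV. \<omega>$k *\<^sub>R (?g \<zeta> k x *\<^sub>R u x)))"
      by (simp only: K_def scaleR_sum_left scaleR_scaleR)
    also have "\<dots> = (\<Sum>k\<in>UNIV. \<omega>$k *\<^sub>R (LINT x|vol3. ?g \<zeta> k x *\<^sub>R u x))"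
      using i by (simp only: Bochner_Integration.integral_sum integrable_scaleR_right integral_scaleR_right)
    also have "\<dots> = (\<Sum>k\<in>UNIV. \<omega>$k *\<^sub>R (LINT x|vol3. delta (sph \<zeta> \<omega>) e x *\<^sub>R v k x))"
      by (simp only: ib)
    finally show ?thesis .
  qed
  have "norm (LINT x|vol3. K \<zeta> x *\<^sub>R u x) \<le> 3 * C" for \<zeta>
  proof -
    have "norm (LINT x|vol3. K \<zeta> x *\<^sub>R u x) \<le> (\<Sum>k\<in>UNIV. norm (\<omega>$k *\<^sub>R (LINT x|vol3. delta (sph \<zeta> \<omega>) e x *\<^sub>R v k x)))"
      unfolding Leq by (rule norm_sum)
    also have "\<dots> \<le> (\<Sum>k\<in>(UNIV::3 set). 1 * C)"
      unfolding norm_scaleR real_norm_def by (intro sum_mono mult_mono w1 C sph_S3 w) auto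
    finally show ?thesis by simp
  qed
  then have "norm (?U \<zeta> - ?U \<zeta>') \<le> 3 * C * norm (\<zeta> - \<zeta>')"
    by (intro differentiable_bound[of UNIV ?U "\<lambda>\<zeta> h. h *\<^sub>R (LINT x|vol3. K \<zeta> x *\<^sub>R u x)"])
       (use d in \<open>auto simp: has_vector_derivative_def mult.commute[of "3 * C"] intro!: onorm_le mult_left_mono\<close>)
  then show ?thesis by simp
qed

text \<open>The representation formula is applied to the first derivatives \<open>v k\<close>, so
  third derivatives bound the averages of the gradient uniformly in \<open>e\<close>. Only those
  whose last two directions agree occur, since the Laplacian is the sum of the pure second frame
  derivatives.\<close>

lemma lipschitz_south_pole:
  fixes u :: "real^4 \<Rightarrow> 'b::euclidean_space"
  assumes u: "continuous_on S3 u" and v: "\<And>k. weak_deriv k u (v k)"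
    and v2: "\<And>k i. weak_deriv i (v k) (v2 k i)" and v3: "\<And>k i. weak_deriv i (v2 k i) (v3 k i)"
  obtains C where "\<And>\<zeta> \<omega>. norm \<omega> = 1 \<Longrightarrow> norm (u (sph \<zeta> \<omega>) - u (sph pi \<omega>)) \<le> C * \<bar>\<zeta> - pi\<bar>"
proof -
  define D where "D k = 8 * area3 + (LINT x|vol3. (norm (v k x))\<^sup>2)
     + (\<Sum>i\<in>UNIV. LINT x|vol3. (norm (v3 k i x))\<^sup>2)" for k
  define C where "C = (\<Sum>k\<in>UNIV. D k)"
  have "D k \<ge> 0" for k using area3_pos by (auto simp: D_def intro!: add_nonneg_nonneg sum_nonneg)
  then have DC: "D k \<le> C" for k unfolding C_def by (intro member_le_sum) auto
  have bound: "norm (LINT x|vol3. delta p e x *\<^sub>R v k x) \<le> C" if "e > 0" "p \<in> S3" for e p k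
    using norm_delta_integral[OF that v2 v3, of k] DC[of k] unfolding D_def by linarith
  have main: "3/8 * area3 * norm (u (sph \<zeta> \<omega>) - u (sph pi \<omega>)) \<le> 3 * C * \<bar>\<zeta> - pi\<bar> + 0" if w: "norm \<omega> = 1" for \<zeta> \<omega>
  proof -
    define S where "S = sph pi \<omega>"
    \<comment> \<open>With unnormalized masses the averages of a function need not converge to its
      values; after this subtraction the average at the pole tends to 0.\<close>
    define u0 where "u0 x = u x - u S" for x
    have S: "S \<in> S3" unfolding S_def by (rule sph_S3[OF w])
    have v': "weak_deriv k u0 (v k)" for k
      using weak_deriv_lincomb[OF v weak_deriv_const[of k "u S"], where a=1 and b="-1"] by (simp add: u0_def[abs_def])
    have c: "continuous_on S3 u0" unfolding u0_def by (intro continuous_intros u)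
    have "3/8 * area3 * norm (u0 (sph \<zeta> \<omega>)) \<le> 3 * C * \<bar>\<zeta> - pi\<bar> + 0"
    proof (rule norm_le_delta_limit[OF c sph_S3[OF w]])
      show "((\<lambda>e. 3 * C * \<bar>\<zeta> - pi\<bar> + norm (LINT x|vol3. delta S e x *\<^sub>R (u0 x - u0 S)))
          \<longlongrightarrow> 3 * C * \<bar>\<zeta> - pi\<bar> + 0) (at_right 0)"
        by (intro tendsto_add tendsto_const tendsto_norm_zero delta_tendsto c S)
      have "norm (LINT x|vol3. delta (sph \<zeta> \<omega>) e x *\<^sub>R u0 x)
          \<le> 3 * C * \<bar>\<zeta> - pi\<bar> + norm (LINT x|vol3. delta S e x *\<^sub>R (u0 x - u0 S))" if e: "e > 0" for e
      proof -
        have "u0 S = 0" by (simp add: u0_def)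
        then show ?thesis
          using delta_path_lipschitz[OF c e w v' bound[OF e], of \<zeta> pi]
            norm_triangle_sub[of "LINT x|vol3. delta (sph \<zeta> \<omega>) e x *\<^sub>R u0 x" "LINT x|vol3. delta S e x *\<^sub>R u0 x"]
          unfolding S_def by simp
      qed
      then show "\<forall>\<^sub>F e in at_right 0. norm (LINT x|vol3. delta (sph \<zeta> \<omega>) e x *\<^sub>R u0 x)
          \<le> 3 * C * \<bar>\<zeta> - pi\<bar> + norm (LINT x|vol3. delta S e x *\<^sub>R (u0 x - u0 S))"
        by (auto simp: eventually_at_right_field intro!: exI[of _ 1])
    qed
    then show ?thesis by (simp add: u0_def S_def)
  qed
  show thesis
  proof (rule that)
    fix \<zeta> and \<omega> :: "real^3" assume "norm \<omega> = 1"
    from main[OF this, of \<zeta>] show "norm (u (sph \<zeta> \<omega>) - u (sph pi \<omega>)) \<le> (8 * C / area3) * \<bar>\<zeta> - pi\<bar>"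
      using area3_pos by (simp add: field_simps)
  qed
qed

section \<open>Sobolev spaces of tensor fields\<close>

definition l2sq :: "(real^4 \<Rightarrow> 'b::euclidean_space) \<Rightarrow> real" where
  "l2sq u = (LINT x|vol3. (norm (u x))\<^sup>2)"

lemma l2sq_nonneg: "l2sq u \<ge> 0"
  by (simp add: l2sq_def)

lemma l2sq_cong: "(\<And>x. x \<in> S3 \<Longrightarrow> u x = v x) \<Longrightarrow> l2sq u = l2sq v"
  unfolding l2sq_def by (intro Bochner_Integration.integral_cong) auto

lemma l2sq_lincomb:
  fixes u :: "real^4 \<Rightarrow> 'b::euclidean_space"
  assumes "L2 u" "L2 u'"
  shows "l2sq (\<lambda>x. a *\<^sub>R u x + b *\<^sub>R u' x) \<le> 2 * a\<^sup>2 * l2sq u + 2 * b\<^sup>2 * l2sq u'"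
proof -
  have i: "integrable vol3 (\<lambda>x. (norm (u x))\<^sup>2)" "integrable vol3 (\<lambda>x. (norm (u' x))\<^sup>2)"
    using assms by (auto simp: L2_def)
  have "l2sq (\<lambda>x. a *\<^sub>R u x + b *\<^sub>R u' x) \<le> (LINT x|vol3. 2 * a\<^sup>2 * (norm (u x))\<^sup>2 + 2 * b\<^sup>2 * (norm (u' x))\<^sup>2)"
    unfolding l2sq_def
    by (intro integral_mono norm_lincomb_square_le) (use i L2_lincomb[OF assms, of a b] in \<open>auto simp: L2_def\<close>)
  then show ?thesis using i by (simp add: l2sq_def)
qed

lemma l2sq_add_le:
  fixes u :: "real^4 \<Rightarrow> 'b::euclidean_space"
  assumes "L2 u" "L2 u'" "l2sq u \<le> a" "l2sq u' \<le> b"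
  shows "l2sq (\<lambda>x. u x + u' x) \<le> 2 * a + 2 * b"
  using l2sq_lincomb[OF assms(1,2), of 1 1] assms(3,4) by simp

lemma L2_add:
  fixes u :: "real^4 \<Rightarrow> 'b::euclidean_space"
  shows "L2 u \<Longrightarrow> L2 u' \<Longrightarrow> L2 (\<lambda>x. u x + u' x)"
  using L2_lincomb[of u u' 1 1] by simp

lemma L2_cong: "(\<And>x. x \<in> S3 \<Longrightarrow> u x = v x) \<Longrightarrow> L2 u = L2 v"
  unfolding L2_def
  by (intro conj_cong measurable_cong Bochner_Integration.integrable_cong) auto

lemma L2_scaleR_sum:
  fixes f :: "3 \<Rightarrow> real^4 \<Rightarrow> 'b::euclidean_space"
  assumes "\<And>m. L2 (f m)"
  shows "L2 (\<lambda>x. \<Sum>m\<in>UNIV. c m *\<^sub>R f m x)"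
  using L2_lincomb[OF L2_lincomb[OF assms[of 1] assms[of 2], of "c 1" "c 2"] assms[of 3], of 1 "c 3"]
  by (simp add: sum_3)

lemma l2sq_scaleR_sum_le:
  fixes f :: "3 \<Rightarrow> real^4 \<Rightarrow> 'b::euclidean_space"
  assumes L: "\<And>m. L2 (f m)" and q: "\<And>m. l2sq (f m) \<le> B" and c: "\<And>m. \<bar>c m\<bar> \<le> 1"
  shows "l2sq (\<lambda>x. \<Sum>m\<in>UNIV. c m *\<^sub>R f m x) \<le> 10 * B"
proof -
  have B: "B \<ge> 0" using q[of 1] l2sq_nonneg[of "f 1"] by linarith
  have cq: "(c m)\<^sup>2 * l2sq (f m) \<le> B" for m
  proof -
    have "(c m)\<^sup>2 \<le> 1" using c[of m] by (simp add: abs_square_le_1)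
    then have "(c m)\<^sup>2 * l2sq (f m) \<le> 1 * B" by (intro mult_mono q l2sq_nonneg) auto
    then show ?thesis by simp
  qed
  \<comment> \<open>The inequality for two summands gives 4 here and, applied once more,
    \<open>2 * 4 + 2 = 10\<close> for three.\<close>
  have "l2sq (\<lambda>x. c 1 *\<^sub>R f 1 x + c 2 *\<^sub>R f 2 x) \<le> 4 * B"
    using l2sq_lincomb[OF L[of 1] L[of 2], of "c 1" "c 2"] cq[of 1] cq[of 2] by simp
  moreover have "l2sq (\<lambda>x. 1 *\<^sub>R (c 1 *\<^sub>R f 1 x + c 2 *\<^sub>R f 2 x) + c 3 *\<^sub>R f 3 x)
      \<le> 2 * l2sq (\<lambda>x. c 1 *\<^sub>R f 1 x + c 2 *\<^sub>R f 2 x) + 2 * (c 3)\<^sup>2 * l2sq (f 3)"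
    using l2sq_lincomb[OF L2_lincomb[OF L[of 1] L[of 2]] L[of 3], of 1 "c 1" "c 2" "c 3"] by simp
  ultimately show ?thesis using cq[of 3] by (simp add: sum_3)
qed

lemma weak_deriv_scaleR_sum:
  fixes f :: "3 \<Rightarrow> real^4 \<Rightarrow> 'b::euclidean_space"
  assumes w: "\<And>m. weak_deriv i (f m) (g m)"
  shows "weak_deriv i (\<lambda>x. \<Sum>m\<in>UNIV. c m *\<^sub>R f m x) (\<lambda>x. \<Sum>m\<in>UNIV. c m *\<^sub>R g m x)"
  using weak_deriv_lincomb[OF weak_deriv_lincomb[OF w[of 1] w[of 2], of "c 1" "c 2"] w[of 3], of 1 "c 3"]
  by (simp add: sum_3)

lemma weak_deriv_add:
  fixes u :: "real^4 \<Rightarrow> 'b::euclidean_space"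
  shows "weak_deriv i u v \<Longrightarrow> weak_deriv i u' v' \<Longrightarrow> weak_deriv i (\<lambda>x. u x + u' x) (\<lambda>x. v x + v' x)"
  using weak_deriv_lincomb[of i u v u' v' 1 1] by simp

lemma weak_deriv_cong:
  assumes w: "weak_deriv i u v" and u: "\<And>x. x \<in> S3 \<Longrightarrow> u x = u' x" and v: "\<And>x. x \<in> S3 \<Longrightarrow> v x = v' x"
  shows "weak_deriv i u' v'"
proof (rule weak_derivI)
  show "L2 u'" "L2 v'"
    using w L2_cong[of u u'] L2_cong[of v v'] u v by (auto simp: weak_deriv_def)
  fix \<psi> \<psi>' assume t: "test_fun \<psi> \<psi>'"
  have "(LINT x|vol3. \<psi> x *\<^sub>R v' x) = (LINT x|vol3. \<psi> x *\<^sub>R v x)"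
    "(LINT x|vol3. \<psi>' x (frame i x) *\<^sub>R u' x) = (LINT x|vol3. \<psi>' x (frame i x) *\<^sub>R u x)"
    by (intro Bochner_Integration.integral_cong; simp add: u v)+
  then show "(LINT x|vol3. \<psi> x *\<^sub>R v' x) = - (LINT x|vol3. \<psi>' x (frame i x) *\<^sub>R u' x)"
    using weak_derivD[OF w t] by simp
qed

section \<open>Connection coefficients and covariant derivatives in the frame\<close>

lemma conn_eq: "conn i j k x = frame j (frame i x) \<bullet> frame k x"
  unfolding conn_def by (simp add: frechet_derivative_at[OF frame_has_derivative, symmetric])

text \<open>The frame is left invariant on the unit quaternions, so its connection coefficients are
  constant on the sphere; \<open>axis 1 1\<close> is the quaternion 1.\<close>

definition conn0 :: "3 \<Rightarrow> 3 \<Rightarrow> 3 \<Rightarrow> real" where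
  "conn0 i j k = conn i j k (axis 1 1)"

lemma conn_S3: "x \<in> S3 \<Longrightarrow> conn i j k x = conn0 i j k"
proof -
  assume "x \<in> S3"
  then have "x \<bullet> x = 1" by (simp add: norm_eq_1)
  moreover have "\<forall>i j k. conn i j k x = (x \<bullet> x) * conn0 i j k"
    unfolding conn0_def conn_eq
    by (simp add: forall_3 frame_def inner_vec_def sum_4 axis_def algebra_simps)
  ultimately show ?thesis by simp
qed

lemma abs_conn0_le: "\<bar>conn0 i j k\<bar> \<le> 1"
  using Cauchy_Schwarz_ineq2[of "frame j (frame i (axis 1 1))" "frame k (axis 1 1)"]
  by (simp add: conn0_def conn_eq)

text \<open>The derivative of \<open>frame i\<close> along itself is \<open>- x\<close>, which has
  no tangential part: the frame fields are geodesic.\<close>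

lemma conn0_diag: "conn0 i i k = 0"
  by (simp add: conn0_def conn_eq)

lemma cov_single: "cov T [i] = wd i (T [])"
  by (rule ext) simp

lemma cov_cov_double: "x \<in> S3 \<Longrightarrow> cov (cov T) [i, j] x = wd i (wd j (T [])) x - (\<Sum>m\<in>UNIV. conn0 i j m *\<^sub>R wd m (T []) x)"
  by (simp add: cov_single conn_S3)

lemma cov_double: "x \<in> S3 \<Longrightarrow> cov T [i, j] x = wd i (T [j]) x - (\<Sum>m\<in>UNIV. conn0 i j m *\<^sub>R T [m] x)"
  by (simp add: conn_S3)

text \<open>The recursion of \<open>cov\<close> is unfolded for the outer derivative only. The inner
  terms \<open>cov T [k, j]\<close> stay closed, because it is their norms that \<open>Hnorm\<close>
  controls.\<close>

lemma cov_cov_triple: "x \<in> S3 \<Longrightarrow> cov (cov T) [i, k, j] x = wd i (cov T [k, j]) x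
    - (\<Sum>m\<in>UNIV. conn0 i k m *\<^sub>R cov T [m, j] x) - (\<Sum>m\<in>UNIV. conn0 i j m *\<^sub>R cov T [k, m] x)"
  by (simp add: conn_S3 numeral_2_eq_2 del: cov.simps(2)) (simp add: conn_S3 numeral_2_eq_2 cov.simps(2)[of "cov T"] del: cov.simps(2))

lemma Hnorm_component:
  assumes "k \<le> s" "length js = r + k" "Hnorm r s T \<le> M"
  shows "l2sq ((cov ^^ k) T js) \<le> M\<^sup>2"
proof -
  have fin: "finite {js :: 3 list. length js = n}" for n
    using finite_lists_length_eq[of "UNIV :: 3 set" n] by simp
  let ?S = "\<Sum>k\<le>s. \<Sum>js\<in>{js. length js = r + k}. l2sq ((cov ^^ k) T js)"
  have "l2sq ((cov ^^ k) T js) \<le> (\<Sum>js\<in>{js. length js = r + k}. l2sq ((cov ^^ k) T js))"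
    using assms fin by (intro member_le_sum) (auto simp: l2sq_nonneg)
  also have "\<dots> \<le> ?S"
    using assms by (intro member_le_sum) (auto simp: l2sq_nonneg sum_nonneg)
  finally have "l2sq ((cov ^^ k) T js) \<le> ?S" .
  moreover have "?S = (Hnorm r s T)\<^sup>2"
    by (simp add: Hnorm_def l2sq_def sum_nonneg)
  moreover have "(Hnorm r s T)\<^sup>2 \<le> M\<^sup>2"
    using assms(3) by (intro power_mono) (auto simp: Hnorm_def sum_nonneg)
  ultimately show ?thesis by linarith
qed

text \<open>Phrased with the representatives \<open>wd\<close>, since these are what
  \<open>cov\<close> and thus the Sobolev norms are built from.\<close>

definition H2_scalar :: "(real^4 \<Rightarrow> 'b::euclidean_space) \<Rightarrow> bool" where
  "H2_scalar u \<longleftrightarrow> (\<forall>i. weak_deriv i u (wd i u)) \<and> (\<forall>i j. weak_deriv i (wd j u) (wd i (wd j u)))"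

lemma in_H_H2_scalar:
  assumes "in_H 0 s T" "2 \<le> s"
  shows "H2_scalar (T [])"
proof -
  have "\<exists>v. weak_deriv i (T []) v" for i
    using assms unfolding in_H_def by (elim conjE allE[of _ "0::nat"]) auto
  moreover have "\<exists>v. weak_deriv i (cov T [j]) v" for i j
    using assms unfolding in_H_def by (elim conjE allE[of _ "1::nat"]) (auto simp del: cov.simps)
  ultimately show ?thesis unfolding H2_scalar_def cov_single using weak_deriv_wd by blast
qed

text \<open>The choice \<open>wd\<close> need not be linear. The derivative of a combination agrees
  with the combination of the derivatives almost everywhere by uniqueness, and this is enough to
  differentiate weakly once more.\<close>

lemma H2_scalar_lincomb:
  fixes u :: "real^4 \<Rightarrow> 'b::euclidean_space"
  assumes u: "H2_scalar u" and u': "H2_scalar u'"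
  shows "H2_scalar (\<lambda>x. a *\<^sub>R u x + b *\<^sub>R u' x)"
proof -
  let ?w = "\<lambda>x. a *\<^sub>R u x + b *\<^sub>R u' x"
  have 1: "weak_deriv i ?w (\<lambda>x. a *\<^sub>R wd i u x + b *\<^sub>R wd i u' x)" for i
    using u u' by (intro weak_deriv_lincomb) (auto simp: H2_scalar_def)
  have 2: "weak_deriv i ?w (wd i ?w)" for i by (rule weak_deriv_wd[OF 1])
  have 3: "weak_deriv i (wd j ?w) (\<lambda>x. a *\<^sub>R wd i (wd j u) x + b *\<^sub>R wd i (wd j u') x)" for i j
  proof (rule weak_deriv_cong_AE[OF _ weak_deriv_unique[OF 1 2]])
    show "weak_deriv i (\<lambda>x. a *\<^sub>R wd j u x + b *\<^sub>R wd j u' x) (\<lambda>x. a *\<^sub>R wd i (wd j u) x + b *\<^sub>R wd i (wd j u') x)"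
      using u u' by (intro weak_deriv_lincomb) (auto simp: H2_scalar_def)
    show "L2 (wd j ?w)" using 2[of j] by (simp add: weak_deriv_def)
  qed
  show ?thesis unfolding H2_scalar_def using 2 weak_deriv_wd[OF 3] by blast
qed

text \<open>On functions the pure second covariant derivatives are iterated frame derivatives, as
  the diagonal connection coefficients vanish. These are the ones that occur in the representation
  formula.\<close>

lemma Hnorm2_scalar:
  assumes "Hnorm 0 2 T \<le> M"
  shows "l2sq (T []) \<le> M\<^sup>2" "l2sq (wd i (wd i (T []))) \<le> M\<^sup>2"
proof -
  show "l2sq (T []) \<le> M\<^sup>2" using Hnorm_component[OF _ _ assms, of 0 "[]"] by simp
  have "l2sq (cov (cov T) [i, i]) \<le> M\<^sup>2"
    using Hnorm_component[OF _ _ assms, of 2 "[i, i]"] by (simp add: numeral_2_eq_2)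
  moreover have "l2sq (cov (cov T) [i, i]) = l2sq (wd i (wd i (T [])))"
    by (rule l2sq_cong) (simp add: cov_cov_double conn0_diag del: cov.simps)
  ultimately show "l2sq (wd i (wd i (T []))) \<le> M\<^sup>2" by simp
qed

section \<open>Sup bounds for functions and one-forms\<close>

lemma sobolev_sup_l2sq:
  fixes u :: "real^4 \<Rightarrow> 'b::euclidean_space"
  assumes u: "continuous_on S3 u" and p: "p \<in> S3"
    and v: "\<And>i. weak_deriv i u (v i)" and w: "\<And>i. weak_deriv i (v i) (w i)"
    and q: "l2sq u \<le> B" "\<And>i. l2sq (w i) \<le> B"
  shows "norm (u p) \<le> 8 * (8 * area3 + 4 * B) / (3 * area3)"
proof -
  have "(\<Sum>i\<in>UNIV. l2sq (w i)) \<le> (\<Sum>i\<in>(UNIV::3 set). B)" by (intro sum_mono q)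
  then have "3/8 * area3 * norm (u p) \<le> 8 * area3 + 4 * B"
    using sobolev_sup[OF u p v w] q(1) by (simp add: l2sq_def)
  then show ?thesis using area3_pos by (simp add: field_simps)
qed

lemma sobolev_scalar:
  fixes u :: "real^4 \<Rightarrow> 'b::euclidean_space"
  assumes u: "continuous_on S3 u" and p: "p \<in> S3" and h: "in_H 0 s (scal u)" "2 \<le> s"
    and M: "Hnorm 0 2 (scal u) \<le> M"
  shows "norm (u p) \<le> 8 * (8 * area3 + 4 * M\<^sup>2) / (3 * area3)"
proof (rule sobolev_sup_l2sq[OF u p])
  have "H2_scalar u" using in_H_H2_scalar[OF h] by (simp add: scal_def)
  then show "weak_deriv i u (wd i u)" "weak_deriv i (wd i u) (wd i (wd i u))" for i
    by (auto simp: H2_scalar_def)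
  show "l2sq u \<le> M\<^sup>2" "l2sq (wd i (wd i u)) \<le> M\<^sup>2" for i
    using Hnorm2_scalar[OF M] by (auto simp: scal_def)
qed

text \<open>The sup bound is applied to a single frame component. Its frame derivatives are
  recovered from the covariant derivatives by adding back connection terms, whose coefficients are
  constants of size at most 1.\<close>

lemma sobolev_rank_one:
  fixes T :: "'b::euclidean_space tensor"
  assumes u: "continuous_on S3 (T [j])" and p: "p \<in> S3" and h: "in_H 1 s T" "2 \<le> s"
    and M: "Hnorm 1 2 T \<le> M"
  shows "norm (T [j] p) \<le> 8 * (8 * area3 + 4 * (1000 * M\<^sup>2)) / (3 * area3)"
proof -
  have w1: "weak_deriv i (T [j]) (wd i (T [j]))" for i j
  proof -
    have "\<exists>v. weak_deriv i (T [j]) v"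
      using h unfolding in_H_def by (elim conjE allE[of _ "0::nat"]) auto
    then show ?thesis using weak_deriv_wd by blast
  qed
  have w2: "weak_deriv i (cov T [k, j]) (wd i (cov T [k, j]))" for i j k
  proof -
    have "\<exists>v. weak_deriv i (cov T [k, j]) v"
      using h unfolding in_H_def by (elim conjE allE[of _ "1::nat"]) (auto simp del: cov.simps)
    then show ?thesis using weak_deriv_wd by blast
  qed
  have L: "L2 (T [j])" "L2 (wd i (T [j]))" "L2 (cov T [i, j])" "L2 (wd i (cov T [k, j]))" for i j k
    using w1[of i j] w2[of i k j] w2[of i i j] unfolding weak_deriv_def by auto
  have q0: "l2sq (T [j]) \<le> M\<^sup>2" for j using Hnorm_component[OF _ _ M, of 0 "[j]"] by simp
  have q1: "l2sq (cov T [i, j]) \<le> M\<^sup>2" for i j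
    using Hnorm_component[OF _ _ M, of 1 "[i, j]"] by (simp del: cov.simps)
  have q2: "l2sq (cov (cov T) [i, k, j]) \<le> M\<^sup>2" for i k j
    using Hnorm_component[OF _ _ M, of 2 "[i, k, j]"] by (simp add: numeral_2_eq_2 del: cov.simps)
  have L3: "L2 (cov (cov T) [i, k, j])" for i k j
    using h unfolding in_H_def by (elim conjE allE[of _ "2::nat"]) (auto simp: numeral_2_eq_2 simp del: cov.simps)
  \<comment> \<open>A second derivative of the component along direction \<open>i\<close>, obtained
    by weakly differentiating the relation between \<open>cov T [i, j]\<close> and the frame
    derivative of \<open>T [j]\<close>.\<close>
  define z where "z i x = wd i (cov T [i, j]) x + (\<Sum>m\<in>UNIV. conn0 i j m *\<^sub>R wd i (T [m]) x)" for i x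
  have eq1: "wd i (T [j]) x = cov T [i, j] x + (\<Sum>m\<in>UNIV. conn0 i j m *\<^sub>R T [m] x)" if "x \<in> S3" for i j x
    using cov_double[OF that, of T i j] by simp
  have z: "weak_deriv i (wd i (T [j])) (z i)" for i
  proof (rule weak_deriv_cong)
    show "weak_deriv i (\<lambda>x. cov T [i, j] x + (\<Sum>m\<in>UNIV. conn0 i j m *\<^sub>R T [m] x)) (z i)"
      unfolding z_def[abs_def] by (intro weak_deriv_add weak_deriv_scaleR_sum w1 w2)
  qed (simp_all only: eq1)
  have eq2: "z i x = cov (cov T) [i, i, j] x + (\<Sum>m\<in>UNIV. conn0 i j m *\<^sub>R (cov T [i, m] x + wd i (T [m]) x))"
    if "x \<in> S3" for i x
    using cov_cov_triple[OF that, of T i i j]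
    by (simp add: z_def conn0_diag scaleR_add_right sum.distrib del: cov.simps)
  have q3: "l2sq (wd i (T [m])) \<le> 22 * M\<^sup>2" for i m
  proof -
    have "l2sq (wd i (T [m])) = l2sq (\<lambda>x. cov T [i, m] x + (\<Sum>n\<in>UNIV. conn0 i m n *\<^sub>R T [n] x))"
      by (rule l2sq_cong) (rule eq1)
    also have "\<dots> \<le> 2 * M\<^sup>2 + 2 * (10 * M\<^sup>2)"
      by (intro l2sq_add_le l2sq_scaleR_sum_le L2_scaleR_sum L q0 q1 abs_conn0_le)
    finally show ?thesis by simp
  qed
  have "l2sq (z i) \<le> 1000 * M\<^sup>2" for i
  proof -
    have "l2sq (z i) = l2sq (\<lambda>x. cov (cov T) [i, i, j] x + (\<Sum>m\<in>UNIV. conn0 i j m *\<^sub>R (cov T [i, m] x + wd i (T [m]) x)))"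
      by (rule l2sq_cong) (rule eq2)
    \<comment> \<open>The combination rules give \<open>2 + 20 * (2 + 44) = 922\<close>; the 22
      inside is \<open>2 + 2 * 10\<close>.\<close>
    also have "\<dots> \<le> 2 * M\<^sup>2 + 2 * (10 * (2 * M\<^sup>2 + 2 * (22 * M\<^sup>2)))"
      by (intro l2sq_add_le l2sq_scaleR_sum_le L2_scaleR_sum L2_add L L3 q1 q2 q3 abs_conn0_le)
    also have "\<dots> \<le> 1000 * M\<^sup>2" by simp
    finally show ?thesis .
  qed
  moreover have "l2sq (T [j]) \<le> 1000 * M\<^sup>2" using q0[of j] zero_le_power2[of M] by linarith
  ultimately show ?thesis by (intro sobolev_sup_l2sq[OF u p w1 z])
qed

section \<open>Bounds for solutions\<close>

lemma CbH_bound: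
  assumes "CbH r k s U"
  obtains M where "\<And>\<tau>. \<tau> \<in> Itau \<Longrightarrow> in_H r s (U \<tau>)" "\<And>\<tau>. \<tau> \<in> Itau \<Longrightarrow> Hnorm r s (U \<tau>) \<le> M"
proof -
  obtain D where D: "D 0 = U" "\<forall>j\<le>k. (\<forall>\<tau>\<in>Itau. in_H r s (D j \<tau>)) \<and> bounded ((\<lambda>\<tau>. Hnorm r s (D j \<tau>)) ` Itau)"
    using assms unfolding CbH_def by blast
  then have "bounded ((\<lambda>\<tau>. Hnorm r s (U \<tau>)) ` Itau)" by auto
  then obtain M where "\<forall>\<tau>\<in>Itau. norm (Hnorm r s (U \<tau>)) \<le> M" by (auto simp: bounded_iff)
  then show thesis using that[of M] D by fastforce
qed

lemma CbH_scalar_bounded: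
  fixes u :: "real \<Rightarrow> real^4 \<Rightarrow> 'b::euclidean_space"
  assumes "CbH 0 0 2 (\<lambda>\<tau>. scal (u \<tau>))" "\<And>\<tau>. \<tau> \<in> Itau \<Longrightarrow> continuous_on S3 (u \<tau>)"
  obtains B where "\<And>\<tau> x. \<tau> \<in> Itau \<Longrightarrow> x \<in> S3 \<Longrightarrow> norm (u \<tau> x) \<le> B"
proof -
  obtain M where "\<And>\<tau>. \<tau> \<in> Itau \<Longrightarrow> in_H 0 2 (scal (u \<tau>))" "\<And>\<tau>. \<tau> \<in> Itau \<Longrightarrow> Hnorm 0 2 (scal (u \<tau>)) \<le> M"
    using CbH_bound[OF assms(1)] by blast
  then show thesis
    by (intro that[of "8 * (8 * area3 + 4 * M\<^sup>2) / (3 * area3)"] sobolev_scalar[OF assms(2) _ _ order_refl])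
qed

text \<open>The components are bounded separately and combined by Parseval's identity, which has no
  normal term for a tangential field.\<close>

lemma CbH_oneform_bounded:
  assumes "CbH 1 0 2 (\<lambda>\<tau>. oneform (A \<tau>))" "\<And>\<tau>. \<tau> \<in> Itau \<Longrightarrow> continuous_on S3 (A \<tau>)"
    and tang: "\<And>\<tau> x. \<tau> \<in> Itau \<Longrightarrow> x \<in> S3 \<Longrightarrow> A \<tau> x \<bullet> x = 0"
  obtains B where "\<And>\<tau> x. \<tau> \<in> Itau \<Longrightarrow> x \<in> S3 \<Longrightarrow> norm (A \<tau> x) \<le> B"
proof -
  obtain M where M: "\<And>\<tau>. \<tau> \<in> Itau \<Longrightarrow> in_H 1 2 (oneform (A \<tau>))" "\<And>\<tau>. \<tau> \<in> Itau \<Longrightarrow> Hnorm 1 2 (oneform (A \<tau>)) \<le> M"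
    using CbH_bound[OF assms(1)] by blast
  define b where "b = 8 * (8 * area3 + 4 * (1000 * M\<^sup>2)) / (3 * area3)"
  have b0: "b \<ge> 0" using area3_pos by (simp add: b_def)
  show thesis
  proof (rule that)
    fix \<tau> x assume t: "\<tau> \<in> Itau" and x: "x \<in> S3"
    have c: "continuous_on S3 (oneform (A \<tau>) [j])" for j
      unfolding oneform_def by (auto intro!: continuous_intros assms(2)[OF t])
    have "\<bar>A \<tau> x \<bullet> frame j x\<bar> \<le> b" for j
      using sobolev_rank_one[OF c[of j] x M(1)[OF t] order_refl M(2)[OF t]]
      by (simp add: b_def oneform_def)
    then have "(A \<tau> x \<bullet> frame j x)\<^sup>2 \<le> b\<^sup>2" for j
      using power_mono[of "\<bar>A \<tau> x \<bullet> frame j x\<bar>" b 2] by simp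
    then have "(\<Sum>j\<in>UNIV. (A \<tau> x \<bullet> frame j x)\<^sup>2) \<le> (\<Sum>j\<in>(UNIV::3 set). b\<^sup>2)"
      by (intro sum_mono)
    then have "(norm (A \<tau> x))\<^sup>2 \<le> 3 * b\<^sup>2"
      using x tang[OF t x] by (simp add: sum_frame_squares norm_eq_1 power2_norm_eq_inner)
    also have "\<dots> \<le> (2 * b)\<^sup>2" by (simp add: power_mult_distrib)
    finally show "norm (A \<tau> x) \<le> 2 * b" by (rule power2_le_imp_le) (use b0 in simp)
  qed
qed

lemma ms_solution_bounded:
  assumes "ms_solution 2 \<phi> A A0"
  obtains B where "B \<ge> 0" "\<And>\<tau> x. \<tau> \<in> Itau \<Longrightarrow> x \<in> S3 \<Longrightarrow> cmod (\<phi> \<tau> x) \<le> B"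
    "\<And>\<tau> x. \<tau> \<in> Itau \<Longrightarrow> x \<in> S3 \<Longrightarrow> norm (A \<tau> x) \<le> B"
    "\<And>\<tau> x. \<tau> \<in> Itau \<Longrightarrow> x \<in> S3 \<Longrightarrow> \<bar>A0 \<tau> x\<bar> \<le> B"
proof -
  have *: "continuous_on S3 (\<phi> \<tau>)" "continuous_on S3 (A \<tau>)" "continuous_on S3 (A0 \<tau>)"
    "x \<in> S3 \<Longrightarrow> A \<tau> x \<bullet> x = 0" if "\<tau> \<in> Itau" for \<tau> x
    using assms that unfolding ms_solution_def by auto
  have C: "CbH 0 0 2 (\<lambda>\<tau>. scal (\<phi> \<tau>))" "CbH 1 0 2 (\<lambda>\<tau>. oneform (A \<tau>))" "CbH 0 0 2 (\<lambda>\<tau>. scal (A0 \<tau>))"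
    using assms unfolding ms_solution_def by (elim conjE allE[of _ "0::nat"]; simp)+
  obtain B1 where 1: "\<And>\<tau> x. \<tau> \<in> Itau \<Longrightarrow> x \<in> S3 \<Longrightarrow> norm (\<phi> \<tau> x) \<le> B1"
    using CbH_scalar_bounded[OF C(1) *(1)] by blast
  obtain B2 where 2: "\<And>\<tau> x. \<tau> \<in> Itau \<Longrightarrow> x \<in> S3 \<Longrightarrow> norm (A \<tau> x) \<le> B2"
    using CbH_oneform_bounded[OF C(2) *(2,4)] by blast
  obtain B3 where 3: "\<And>\<tau> x. \<tau> \<in> Itau \<Longrightarrow> x \<in> S3 \<Longrightarrow> norm (A0 \<tau> x) \<le> B3"
    using CbH_scalar_bounded[OF C(3) *(3)] by blast
  show thesis
    by (rule that[of "\<bar>B1\<bar> + \<bar>B2\<bar> + \<bar>B3\<bar>"]) (use 1 2 3 in \<open>force simp del: atLeastAtMost_iff mem_sphere\<close>)+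
qed

text \<open>Difference quotients converge in the second Sobolev space, so they are eventually within
  distance 1 of the derivative \<open>V\<close> there, and the sup bound applies to them with a
  constant independent of \<sigma>.\<close>

lemma time_lipschitz:
  fixes \<phi> :: "real \<Rightarrow> real^4 \<Rightarrow> 'b::euclidean_space"
  assumes C: "CbH 0 1 2 (\<lambda>\<tau>. scal (\<phi> \<tau>))" and c: "\<And>\<tau>. \<tau> \<in> Itau \<Longrightarrow> continuous_on S3 (\<phi> \<tau>)"
    and t: "\<tau> \<in> Itau"
  obtains K where "\<forall>\<^sub>F \<sigma> in at \<tau> within Itau. \<forall>x\<in>S3. norm (\<phi> \<sigma> x - \<phi> \<tau> x) \<le> K * \<bar>\<sigma> - \<tau>\<bar>"
proof -
  obtain D where D0: "D 0 = (\<lambda>\<tau>. scal (\<phi> \<tau>))"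
    and DH: "\<forall>j\<le>1. \<forall>\<tau>\<in>Itau. in_H 0 2 (D j \<tau>)"
    and Dt: "\<forall>j<1. \<forall>\<tau>\<in>Itau. has_time_deriv 0 2 Itau (D j) (D (Suc j) \<tau>) \<tau>"
    using C unfolding CbH_def by blast
  define V where "V = D 1 \<tau>"
  have inH: "in_H 0 2 (scal (\<phi> \<tau>))" if "\<tau> \<in> Itau" for \<tau>
    using DH[rule_format, of 0 \<tau>] that D0 by simp
  have HV: "H2_scalar (V [])" using in_H_H2_scalar[OF DH[rule_format, of 1 \<tau>]] t by (simp add: V_def)
  have dt: "has_time_deriv 0 2 Itau (\<lambda>\<tau>. scal (\<phi> \<tau>)) V \<tau>"
    using Dt[rule_format, of 0 \<tau>] t D0 by (simp add: V_def)
  define T where "T \<sigma> = (\<lambda>js x. (scal (\<phi> \<sigma>) js x - scal (\<phi> \<tau>) js x) /\<^sub>R (\<sigma> - \<tau>) - V js x)" for \<sigma>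
  \<comment> \<open>Dominates each of the squared norms of \<open>V\<close> that enter the sup
    bound.\<close>
  define N where "N = l2sq (V []) + (\<Sum>i\<in>UNIV. l2sq (wd i (wd i (V []))))"
  define B where "B = 2 * 1\<^sup>2 + 2 * N"
  define K where "K = 8 * (8 * area3 + 4 * B) / (3 * area3)"
  have "\<forall>\<^sub>F \<sigma> in at \<tau> within Itau. Hnorm 0 2 (T \<sigma>) < 1"
    using order_tendstoD(2)[OF dt[unfolded has_time_deriv_def], of 1] by (simp add: T_def)
  moreover have "\<forall>\<^sub>F \<sigma> in at \<tau> within Itau. \<sigma> \<in> Itau \<and> \<sigma> \<noteq> \<tau>"
    by (simp add: eventually_at_filter)
  ultimately have "\<forall>\<^sub>F \<sigma> in at \<tau> within Itau. \<forall>x\<in>S3. norm (\<phi> \<sigma> x - \<phi> \<tau> x) \<le> K * \<bar>\<sigma> - \<tau>\<bar>"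
  proof eventually_elim
    case (elim \<sigma>)
    then have s: "\<sigma> \<in> Itau" "\<sigma> \<noteq> \<tau>" and H: "Hnorm 0 2 (T \<sigma>) \<le> 1" by auto
    define w where "w = T \<sigma> []"
    \<comment> \<open>The sup bound needs a continuous function. \<open>V\<close> is only a Sobolev
      function, so the bound is applied to the quotient \<open>q\<close> itself, while its norms are
      estimated through \<open>q = w + V\<close>.\<close>
    define q where "q x = (\<phi> \<sigma> x - \<phi> \<tau> x) /\<^sub>R (\<sigma> - \<tau>)" for x
    have w_eq: "w = (\<lambda>x. 1 *\<^sub>R (inverse (\<sigma> - \<tau>) *\<^sub>R \<phi> \<sigma> x + (- inverse (\<sigma> - \<tau>)) *\<^sub>R \<phi> \<tau> x) + (-1) *\<^sub>R V [] x)"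
      by (simp add: w_def T_def scal_def scaleR_diff_right)
    have "H2_scalar (\<phi> \<sigma>)" "H2_scalar (\<phi> \<tau>)" using in_H_H2_scalar[OF inH[OF s(1)]] in_H_H2_scalar[OF inH[OF t]] by (auto simp: scal_def)
    then have Hw: "H2_scalar w" unfolding w_eq by (intro H2_scalar_lincomb HV)
    have q_eq: "q = (\<lambda>x. w x + V [] x)" by (simp add: q_def[abs_def] w_def T_def scal_def)
    have Lw: "L2 w" "L2 (wd i (wd i w))" and LV: "L2 (V [])" "L2 (wd i (wd i (V [])))" for i
      using Hw HV by (auto simp: H2_scalar_def weak_deriv_def)
    have QV: "l2sq (V []) \<le> N" "l2sq (wd i (wd i (V []))) \<le> N" for i
      unfolding N_def
      by (auto simp: l2sq_nonneg sum_nonneg intro!: add_increasing member_le_sum[where f="\<lambda>i. l2sq (wd i (wd i (V [])))"])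
    have qb: "norm (q x) \<le> K" if x: "x \<in> S3" for x
      unfolding K_def
    proof (rule sobolev_sup_l2sq[OF _ x])
      show "continuous_on S3 q" unfolding q_def by (intro continuous_intros c s t)
      show "weak_deriv i q (\<lambda>x. wd i w x + wd i (V []) x)"
        "weak_deriv i (\<lambda>x. wd i w x + wd i (V []) x) (\<lambda>x. wd i (wd i w) x + wd i (wd i (V [])) x)" for i
        unfolding q_eq using Hw HV by (auto intro!: weak_deriv_add simp: H2_scalar_def)
      show "l2sq q \<le> B" unfolding q_eq B_def using Hnorm2_scalar(1)[OF H]
        by (intro l2sq_add_le Lw LV QV) (simp add: w_def)
      show "l2sq (\<lambda>x. wd i (wd i w) x + wd i (wd i (V [])) x) \<le> B" for i
        unfolding B_def using Hnorm2_scalar(2)[OF H, of i]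
        by (intro l2sq_add_le Lw LV QV) (simp add: w_def)
    qed
    show ?case
    proof
      fix x assume "x \<in> S3"
      have "norm (q x) = norm (\<phi> \<sigma> x - \<phi> \<tau> x) / \<bar>\<sigma> - \<tau>\<bar>"
        by (simp add: q_def divide_inverse mult.commute)
      then show "norm (\<phi> \<sigma> x - \<phi> \<tau> x) \<le> K * \<bar>\<sigma> - \<tau>\<bar>"
        using qb[OF \<open>x \<in> S3\<close>] s by (simp add: pos_divide_le_eq)
    qed
  qed
  then show thesis by (rule that)
qed

text \<open>An iterated second frame derivative is a second covariant derivative plus first
  derivatives with constant coefficients, so it inherits one more weak derivative.\<close>

lemma in_H_3_lipschitz:
  fixes u :: "real^4 \<Rightarrow> 'b::euclidean_space"
  assumes h: "in_H 0 3 (scal u)" and c: "continuous_on S3 u"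
  obtains C where "\<And>\<zeta> \<omega>. norm \<omega> = 1 \<Longrightarrow> norm (u (sph \<zeta> \<omega>) - u (sph pi \<omega>)) \<le> C * \<bar>\<zeta> - pi\<bar>"
proof -
  have H: "H2_scalar u" using in_H_H2_scalar[OF h] by (simp add: scal_def)
  let ?T = "scal u"
  have w: "weak_deriv l (cov (cov ?T) [i, k]) (wd l (cov (cov ?T) [i, k]))" for l i k
  proof -
    have "\<exists>v. weak_deriv l (cov (cov ?T) [i, k]) v"
      using h unfolding in_H_def by (elim conjE allE[of _ "2::nat"]) (auto simp: numeral_2_eq_2 simp del: cov.simps)
    then show ?thesis using weak_deriv_wd by blast
  qed
  have eq: "wd i (wd k u) x = cov (cov ?T) [i, k] x + (\<Sum>m\<in>UNIV. conn0 i k m *\<^sub>R wd m u x)"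
    if "x \<in> S3" for i k x
    using cov_cov_double[OF that, of ?T i k] by (simp add: scal_def)
  have 3: "weak_deriv i (wd i (wd k u)) (\<lambda>x. wd i (cov (cov ?T) [i, k]) x + (\<Sum>m\<in>UNIV. conn0 i k m *\<^sub>R wd i (wd m u) x))" for i k
  proof (rule weak_deriv_cong)
    show "weak_deriv i (\<lambda>x. cov (cov ?T) [i, k] x + (\<Sum>m\<in>UNIV. conn0 i k m *\<^sub>R wd m u x))
      (\<lambda>x. wd i (cov (cov ?T) [i, k]) x + (\<Sum>m\<in>UNIV. conn0 i k m *\<^sub>R wd i (wd m u) x))"
      using H by (intro weak_deriv_add weak_deriv_scaleR_sum w) (auto simp: H2_scalar_def)
  qed (simp_all only: eq)
  show thesis
    by (rule lipschitz_south_pole[OF c _ _ 3, of "\<lambda>k. wd k u"]) (use H that in \<open>auto simp: H2_scalar_def\<close>)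
qed

section \<open>Static coordinates\<close>

lemma one_plus_tanh_square: "1 + (tanh z)\<^sup>2 = cosh (2 * z) / (cosh z)\<^sup>2" for z :: real
  by (simp add: tanh_def power_divide cosh_double add_divide_distrib)

lemma one_minus_tanh_square: "1 - (tanh z)\<^sup>2 = 1 / (cosh z)\<^sup>2" for z :: real
proof -
  have "1 / (cosh z)\<^sup>2 = ((cosh z)\<^sup>2 - (sinh z)\<^sup>2) / (cosh z)\<^sup>2" by (simp add: hyperbolic_pythagoras)
  then show ?thesis by (simp add: diff_divide_distrib power_divide tanh_def)
qed

text \<open>\<open>tau H\<close> is the Gudermannian function of \<open>H * \<eta>\<close>; both
  identities come from double angle formulas, circular for \<open>tau\<close> and hyperbolic for
  \<eta>.\<close>

lemma cos_tau: "cos (tau H \<eta>) = 1 / cosh (H * \<eta>)"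
  and sin_tau: "sin (tau H \<eta>) = tanh (H * \<eta>)"
proof -
  define z where "z = H * \<eta> / 2"
  have c: "cosh z \<noteq> 0" by simp
  have z2: "H * \<eta> = 2 * z" by (simp add: z_def)
  note D = one_plus_tanh_square[of z]
  have p: "1 + (tanh z)\<^sup>2 > 0" by (simp add: add_pos_nonneg)
  have "cos (tau H \<eta>) = (1 - (tanh z)\<^sup>2) / (1 + (tanh z)\<^sup>2)"
    using p by (simp add: tau_def z_def[symmetric] cos_double cos_arctan sin_arctan power_divide diff_divide_distrib)
  also have "1 - (tanh z)\<^sup>2 = 1 / (cosh z)\<^sup>2"
    by (rule one_minus_tanh_square)
  finally show "cos (tau H \<eta>) = 1 / cosh (H * \<eta>)" unfolding D z2 using c by simp
  have "sin (tau H \<eta>) = 2 * tanh z / (1 + (tanh z)\<^sup>2)"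
    using p by (simp add: tau_def z_def[symmetric] sin_double cos_arctan sin_arctan flip: power2_eq_square)
  also have "\<dots> = 2 * sinh z * cosh z / cosh (2 * z)" unfolding D
    by (simp add: tanh_def power2_eq_square)
  also have "\<dots> = tanh (H * \<eta>)" unfolding z2 tanh_def sinh_double[of z] ..
  finally show "sin (tau H \<eta>) = tanh (H * \<eta>)" .
qed

lemma deriv_tau: "deriv (tau H) \<eta> = H / cosh (H * \<eta>)"
proof (rule DERIV_imp_deriv)
  define z where "z = H * \<eta> / 2"
  have c: "cosh z \<noteq> 0" by simp
  have "(tau H has_real_derivative 2 * ((1 - (tanh z)\<^sup>2) * (H / 2) / (1 + (tanh z)\<^sup>2))) (at \<eta>)"
    unfolding tau_def[abs_def] z_def
    by (auto intro!: derivative_eq_intros simp: divide_simps)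
  moreover have z2: "H * \<eta> = 2 * z" by (simp add: z_def)
  ultimately show "(tau H has_real_derivative H / cosh (H * \<eta>)) (at \<eta>)"
    unfolding one_plus_tanh_square one_minus_tanh_square z2 using c by simp
qed

lemma Omega_eq: "Omega H \<eta> = H / cosh (H * \<eta>)"
  by (simp add: Omega_def cos_tau)

text \<open>\<open>arctan\<close> is 1-Lipschitz and
  \<open>1 - tanh (x / 2) = 2 / (exp x + 1)\<close>. The bound has the shape of the conformal
  factor, so one estimate at fixed \<open>r\<close> serves both.\<close>

lemma half_pi_minus_tau: "\<bar>tau H \<eta> - pi/2\<bar> \<le> 4 / cosh (H * \<eta>)" if "H * \<eta> \<ge> 0"
proof -
  define x where "x = tanh (H * \<eta> / 2)"
  have x: "x < 1" by (simp add: x_def tanh_real_lt_1)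
  have "\<bar>arctan x - arctan 1\<bar> \<le> 1 * \<bar>x - 1\<bar>"
  proof -
    have "norm (arctan x - arctan 1) \<le> 1 * norm (x - 1)"
    proof (rule field_differentiable_bound[of UNIV arctan "\<lambda>x. inverse (1 + x\<^sup>2)"])
      show "norm (inverse (1 + z\<^sup>2)) \<le> 1" for z :: real
        by (simp add: abs_of_nonneg inverse_le_1_iff)
    qed (auto intro: DERIV_arctan[THEN has_field_derivative_at_within])
    then show ?thesis by simp
  qed
  moreover have "tau H \<eta> - pi/2 = 2 * (arctan x - arctan 1)"
    by (simp add: tau_def x_def arctan_one)
  ultimately have 1: "\<bar>tau H \<eta> - pi/2\<bar> \<le> 2 * (1 - x)" using x by (simp add: abs_mult)
  define E where "E = exp (H * \<eta>)"
  have E: "E \<ge> 1" using that by (simp add: E_def)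
  have "x = (1 - 1 / E) / (1 + 1 / E)"
  proof -
    have "exp (- 2 * (H * \<eta> / 2)) = 1 / E" by (simp add: E_def exp_minus inverse_eq_divide)
    then show ?thesis by (simp only: x_def tanh_real_altdef)
  qed
  also have "1 - 1 / E = (E - 1) / E" using E by (simp add: diff_divide_distrib)
  also have "1 + 1 / E = (E + 1) / E" using E by (simp add: add_divide_distrib)
  also have "(E - 1) / E / ((E + 1) / E) = (E - 1) / (E + 1)" using E by simp
  finally have "x = (E - 1) / (E + 1)" .
  then have "2 * (1 - x) = 4 / (E + 1)" using E by (simp add: field_simps)
  also have "\<dots> \<le> 4 / cosh (H * \<eta>)"
  proof (rule divide_left_mono)
    have ce: "cosh (H * \<eta>) = (exp (H * \<eta>) + exp (- (H * \<eta>))) / 2"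
      by (simp add: cosh_def)
    have "b \<le> 1 \<Longrightarrow> 1 \<le> a \<Longrightarrow> (a + b) / 2 \<le> a + 1" for a b :: real by simp
    from this[of "exp (- (H * \<eta>))" E]
    show "cosh (H * \<eta>) \<le> E + 1" using E that unfolding ce E_def by simp
  qed (use E in auto)
  finally show ?thesis using 1 by linarith
qed

section \<open>The static chart and its derivatives\<close>

lemma abs_sinh_le_cosh: "\<bar>sinh x\<bar> \<le> cosh x" for x :: real
  using sinh_less_cosh_real[of x] sinh_less_cosh_real[of "- x"] by (simp add: abs_if)

lemma inverse_cosh_le: "1 / cosh x \<le> 2 * exp (- \<bar>x\<bar>)" for x :: real
proof -
  have "exp \<bar>x\<bar> / 2 \<le> cosh x"
    by (simp add: cosh_def abs_if)
  then have "1 / cosh x \<le> 1 / (exp \<bar>x\<bar> / 2)"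
    by (intro divide_left_mono) auto
  then show ?thesis by (simp add: exp_minus inverse_eq_divide)
qed

text \<open>The value of \<open>- tan \<zeta>\<close> at a static point: a function of
  \<open>r\<close> divided by \<open>cosh (H * t)\<close>, which makes the approach to the pole
  explicit.\<close>

definition st_k :: "real \<Rightarrow> real \<Rightarrow> real \<Rightarrow> real" where
  "st_k H t r = H * r / (sqrt (F_st H r) * cosh (H * t))"

lemma F_st_pos: "0 < H \<Longrightarrow> 0 \<le> r \<Longrightarrow> r < 1 / H \<Longrightarrow> F_st H r > 0"
proof -
  assume "0 < H" "0 \<le> r" "r < 1 / H"
  then have "0 \<le> H * r" "H * r < 1" by (auto simp: field_simps)
  then have "(H * r)\<^sup>2 < 1\<^sup>2" by (intro power_strict_mono) auto
  then show ?thesis by (simp add: F_st_def power_mult_distrib)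
qed

lemma cosh_arsinh_st:
  assumes "F > 0" "F \<le> (1::real)"
  shows "cosh (arsinh (sqrt F * sinh x)) = sqrt (F * (sinh x)\<^sup>2 + 1)"
    "sqrt F * cosh x \<le> cosh (arsinh (sqrt F * sinh x))"
proof -
  show eq: "cosh (arsinh (sqrt F * sinh x)) = sqrt (F * (sinh x)\<^sup>2 + 1)"
    using assms by (simp add: cosh_arsinh_real power_mult_distrib)
  have "F * (cosh x)\<^sup>2 \<le> F * (sinh x)\<^sup>2 + 1"
    using assms by (simp add: cosh_square_eq algebra_simps)
  then have "sqrt (F * (cosh x)\<^sup>2) \<le> sqrt (F * (sinh x)\<^sup>2 + 1)" by (rule real_sqrt_le_mono)
  then show "sqrt F * cosh x \<le> cosh (arsinh (sqrt F * sinh x))"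
    unfolding eq by (simp add: real_sqrt_mult)
qed

text \<open>In the embedding of de Sitter space into Minkowski space the static coordinates satisfy
  \<open>sinh (H \<eta>) = sqrt F sinh (H t)\<close>, \<open>cosh (H \<eta>) sin \<zeta> = H r\<close> and
  \<open>- cosh (H \<eta>) cos \<zeta> = sqrt F cosh (H t)\<close>.\<close>

lemma static_coords:
  assumes H: "0 < H" and r: "0 \<le> r" "r < 1 / H"
  shows "eta_st H t r = arsinh (sqrt (F_st H r) * sinh (H * t)) / H"
    and "zeta_st H t r = pi - arctan (st_k H t r)"
proof -
  define f c k where "f = sqrt (F_st H r)" and "c = cosh (H * t)" and "k = st_k H t r"
  define \<eta> \<zeta> where "\<eta> = arsinh (f * sinh (H * t)) / H" and "\<zeta> = pi - arctan k"
  note F = F_st_pos[OF H r]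
  have f: "f > 0" "f\<^sup>2 = 1 - H\<^sup>2 * r\<^sup>2" using F by (auto simp: f_def F_st_def)
  have c: "c > 0" by (simp add: c_def)
  have k: "k \<ge> 0" "k * (f * c) = H * r" using f c H r by (auto simp: k_def st_k_def f_def[symmetric] c_def[symmetric])
  define q where "q = sqrt (1 + k\<^sup>2)"
  have q: "q > 0" "q\<^sup>2 = 1 + k\<^sup>2" by (auto simp: q_def add_pos_nonneg)
  \<comment> \<open>The equation of the hyperboloid, from \<open>f^2 + H^2 * r^2 = 1\<close>; here
    \<open>q\<close> is the reciprocal of \<open>\<bar>cos \<zeta>\<bar>\<close>.\<close>
  have "(f * sinh (H * t))\<^sup>2 + 1 = (f * c * q)\<^sup>2"
  proof -
    have "(f * c * q)\<^sup>2 = (f * c)\<^sup>2 + (k * (f * c))\<^sup>2"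
      unfolding power_mult_distrib q(2) by (simp add: power_mult_distrib algebra_simps)
    also have "\<dots> = f\<^sup>2 * c\<^sup>2 + H\<^sup>2 * r\<^sup>2" unfolding k(2) by (simp add: power_mult_distrib)
    also have "\<dots> = f\<^sup>2 * (sinh (H * t))\<^sup>2 + (f\<^sup>2 + H\<^sup>2 * r\<^sup>2)"
      by (simp add: c_def cosh_square_eq algebra_simps)
    finally show ?thesis by (simp add: f(2) power_mult_distrib)
  qed
  then have ch: "cosh (H * \<eta>) = f * c * q"
    using H f c q by (simp add: \<eta>_def cosh_arsinh_real real_sqrt_unique)
  have sh: "sinh (H * \<eta>) = f * sinh (H * t)" using H by (simp add: \<eta>_def sinh_arsinh_real)
  have ct: "cos (tau H \<eta>) = 1 / (f * c * q)" and stau: "sin (tau H \<eta>) = f * sinh (H * t) / (f * c * q)"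
    by (simp_all add: cos_tau sin_tau tanh_def ch sh)
  have sz: "sin \<zeta> = k / q" and cz: "cos \<zeta> = - 1 / q"
    by (simp_all add: \<zeta>_def sin_arctan cos_arctan q_def)
  have "H * r < 1" using r H by (simp add: field_simps)
  then have "k / q < 1 / (f * c * q)"
    using k(2) f c q by (simp add: field_simps)
  then have reg: "(\<eta>, \<zeta>) \<in> static_region H"
    using k(1) arctan_ubound[of k] by (simp add: static_region_def sz ct) (simp add: \<zeta>_def)
  have "sin (tau H \<eta>) / \<bar>cos \<zeta>\<bar> = tanh (H * t)"
    using f c q by (simp add: stau cz tanh_def c_def[symmetric])
  moreover have "sin \<zeta> / (H * cos (tau H \<eta>)) = r"
    using k(2) H q f c by (simp add: sz ct field_simps)
  ultimately have "static_chart H (\<eta>, \<zeta>) = (t, r)"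
    using H by (simp add: static_chart_def artanh_tanh_real)
  \<comment> \<open>The inverse chart is a definite description: it is evaluated by exhibiting a
    preimage in the region, which injectivity makes the only one.\<close>
  then have "the_inv_into (static_region H) (static_chart H) (t, r) = (\<eta>, \<zeta>)"
    by (rule the_inv_into_f_eq[OF static_chart_inj[OF H] _ reg])
  then show "eta_st H t r = arsinh (sqrt (F_st H r) * sinh (H * t)) / H"
    "zeta_st H t r = pi - arctan (st_k H t r)"
    by (simp_all add: eta_st_def zeta_st_def \<eta>_def \<zeta>_def f_def k_def)
qed

lemma F_st_le_1: "F_st H r \<le> 1"
  by (simp add: F_st_def)

lemma cosh_eta_st:
  assumes H: "0 < H" and r: "0 \<le> r" "r < 1 / H"
  shows "cosh (H * eta_st H t r) = sqrt (F_st H r * (sinh (H * t))\<^sup>2 + 1)"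
    "sqrt (F_st H r) * cosh (H * t) \<le> cosh (H * eta_st H t r)"
  using cosh_arsinh_st[OF F_st_pos[OF assms] F_st_le_1, of "H * t"] H
  by (simp_all add: static_coords[OF assms])

lemma deriv_eta_st_t:
  assumes H: "0 < H" and r: "0 \<le> r" "r < 1 / H"
  shows "\<bar>deriv (\<lambda>t. eta_st H t r) t\<bar> \<le> 1"
proof -
  note F = F_st_pos[OF assms]
  let ?f = "sqrt (F_st H r)"
  have "((\<lambda>t. ?f * sinh (H * t)) has_real_derivative ?f * cosh (H * t) * H) (at t)"
    by (auto intro!: derivative_eq_intros)
  from DERIV_cdivide[OF DERIV_chain2[OF arsinh_real_has_field_derivative this], of H]
  have "((\<lambda>t. eta_st H t r) has_real_derivative
      ?f * cosh (H * t) / sqrt ((?f * sinh (H * t))\<^sup>2 + 1)) (at t)"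
    unfolding static_coords[OF assms] using H by simp
  then have "deriv (\<lambda>t. eta_st H t r) t = ?f * cosh (H * t) / sqrt ((?f * sinh (H * t))\<^sup>2 + 1)"
    by (rule DERIV_imp_deriv)
  also have "sqrt ((?f * sinh (H * t))\<^sup>2 + 1) = cosh (H * eta_st H t r)"
    using F by (simp add: cosh_eta_st[OF assms] power_mult_distrib)
  finally show ?thesis using cosh_eta_st(2)[OF assms, of t] F by simp
qed

lemma sqrt_F_st_has_derivative:
  assumes "F_st H r > 0"
  shows "((\<lambda>r. sqrt (F_st H r)) has_real_derivative - (H\<^sup>2 * r) / sqrt (F_st H r)) (at r)"
proof -
  have Fd: "(F_st H has_real_derivative - (2 * H\<^sup>2 * r)) (at r)"
    unfolding F_st_def[abs_def] by (auto intro!: derivative_eq_intros)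
  show ?thesis
    using DERIV_chain2[where f=sqrt and g="F_st H", OF DERIV_real_sqrt[OF assms] Fd]
    by (simp add: inverse_eq_divide)
qed

text \<open>This derivative does not decay in \<open>t\<close>. In \<open>A_r\<close> the decay of
  its term is supplied by the component \<open>f_Aeta\<close>.\<close>

lemma deriv_eta_st_r:
  assumes H: "0 < H" and r: "0 < r" "r < 1 / H"
  shows "\<bar>deriv (\<lambda>r. eta_st H t r) r\<bar> \<le> H * r / F_st H r"
proof -
  have r0: "0 \<le> r" using r by simp
  note F = F_st_pos[OF H r0 r(2)]
  let ?f = "\<lambda>r. sqrt (F_st H r)"
  let ?D = "(- (H\<^sup>2 * r) / ?f r) * sinh (H * t) / sqrt ((?f r * sinh (H * t))\<^sup>2 + 1) / H"
  note fd = sqrt_F_st_has_derivative[OF F]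
  from DERIV_cdivide[OF DERIV_chain2[OF arsinh_real_has_field_derivative DERIV_cmult_right[OF fd, of "sinh (H * t)"]], of H]
  have "((\<lambda>r. arsinh (?f r * sinh (H * t)) / H) has_real_derivative ?D) (at r)"
    by (simp add: mult_ac)
  \<comment> \<open>The explicit formula holds only inside the horizon; an open interval of such
    radii is enough for a derivative at \<open>r\<close>.\<close>
  then have "((\<lambda>r. eta_st H t r) has_real_derivative ?D) (at r)"
    by (rule has_field_derivative_transform_within_open[of _ _ _ "{0<..<1/H}"])
       (use r in \<open>auto simp: static_coords[OF H]\<close>)
  then have "deriv (\<lambda>r. eta_st H t r) r = ?D"
    by (rule DERIV_imp_deriv)
  also have "sqrt ((?f r * sinh (H * t))\<^sup>2 + 1) = cosh (H * eta_st H t r)"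
    using F by (simp add: cosh_eta_st[OF H r0 r(2)] power_mult_distrib)
  finally have "\<bar>deriv (\<lambda>r. eta_st H t r) r\<bar> = (H * r / ?f r) * (\<bar>sinh (H * t)\<bar> / cosh (H * eta_st H t r))"
    using H r F by (simp add: abs_mult power2_eq_square)
  also have "\<dots> \<le> (H * r / ?f r) * (cosh (H * t) / (?f r * cosh (H * t)))"
  proof (intro mult_left_mono frac_le)
    show "\<bar>sinh (H * t)\<bar> \<le> cosh (H * t)" by (rule abs_sinh_le_cosh)
    show "?f r * cosh (H * t) \<le> cosh (H * eta_st H t r)" by (rule cosh_eta_st(2)[OF H r0 r(2)])
  qed (use H r F in auto)
  also have "\<dots> = H * r / (?f r * ?f r)" using F by simp
  also have "?f r * ?f r = F_st H r" using F by simp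
  finally show ?thesis .
qed

lemma norm_frame_comb_le:
  assumes "norm \<omega> = 1" "norm x = 1"
  shows "norm (\<Sum>k\<in>UNIV. \<omega>$k *\<^sub>R frame k x) \<le> 3"
proof -
  have "norm (\<Sum>k\<in>UNIV. \<omega>$k *\<^sub>R frame k x) \<le> (\<Sum>k\<in>UNIV. norm (\<omega>$k *\<^sub>R frame k x))" by (rule norm_sum)
  also have "\<dots> \<le> (\<Sum>k\<in>(UNIV::3 set). 1)"
    using assms component_le_norm_cart[of \<omega>] by (intro sum_mono) simp
  finally show ?thesis by simp
qed

lemma sph_curve_derivative:
  assumes "norm \<omega> = 1" and z: "(z has_real_derivative z') (at s)"
  shows "norm (vector_derivative (\<lambda>s. sph (z s) \<omega>) (at s)) \<le> 3 * \<bar>z'\<bar>"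
proof -
  let ?e = "\<Sum>k\<in>UNIV. \<omega>$k *\<^sub>R frame k (sph (z s) \<omega>)"
  have "((\<lambda>s. sph (z s) \<omega>) has_vector_derivative z' *\<^sub>R ?e) (at s)"
    using vector_diff_chain_at[OF z[unfolded has_real_derivative_iff_has_vector_derivative]
        sph_has_vector_derivative[OF assms(1)]] by (simp add: comp_def)
  then have "vector_derivative (\<lambda>s. sph (z s) \<omega>) (at s) = z' *\<^sub>R ?e" by (rule vector_derivative_at)
  then show ?thesis
    using norm_frame_comb_le[OF assms(1), of "sph (z s) \<omega>"] sph_S3[OF assms(1), of "z s"]
    by (simp add: mult.commute mult_left_mono)
qed

lemma point_st_eq:
  assumes "0 < H" "0 \<le> r" "r < 1 / H"
  shows "point_st H t r \<omega> = sph (pi - arctan (st_k H t r)) \<omega>"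
  by (simp add: point_st_def static_coords[OF assms])

lemma abs_divide_one_plus_square_le: "\<bar>a / (1 + x\<^sup>2)\<bar> \<le> \<bar>a\<bar>" for a x :: real
proof -
  have p: "0 < 1 + x\<^sup>2" by (simp add: add_pos_nonneg)
  then have "\<bar>a\<bar> / (1 + x\<^sup>2) \<le> \<bar>a\<bar> / 1" using p by (intro divide_left_mono) auto
  moreover have "\<bar>a / (1 + x\<^sup>2)\<bar> = \<bar>a\<bar> / (1 + x\<^sup>2)" using p by (simp add: abs_divide)
  ultimately show ?thesis by simp
qed

lemma point_st_deriv_t:
  assumes H: "0 < H" and r: "0 \<le> r" "r < 1 / H" and w: "norm \<omega> = 1"
  shows "norm (vector_derivative (\<lambda>t. point_st H t r \<omega>) (at t))
    \<le> 3 * (H\<^sup>2 * r / sqrt (F_st H r)) / cosh (H * t)"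
proof -
  note F = F_st_pos[OF H r]
  define a where "a = H * r / sqrt (F_st H r)"
  let ?z = "(a * sinh (H * t) * H / (cosh (H * t))\<^sup>2) / (1 + (a / cosh (H * t))\<^sup>2)"
  have a: "a \<ge> 0" using F H r by (simp add: a_def)
  have k: "st_k H t r = a / cosh (H * t)" for t by (simp add: st_k_def a_def)
  have d: "((\<lambda>t. pi - arctan (st_k H t r)) has_real_derivative
      ?z) (at t)"
    unfolding k by (auto intro!: derivative_eq_intros simp: power2_eq_square divide_inverse)
  have "\<bar>?z\<bar> \<le> \<bar>a * sinh (H * t) * H / (cosh (H * t))\<^sup>2\<bar>"
    by (rule abs_divide_one_plus_square_le)
  also have "\<dots> = a * H * \<bar>sinh (H * t)\<bar> / (cosh (H * t))\<^sup>2"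
    using a H by (simp add: abs_mult)
  also have "\<dots> \<le> a * H * cosh (H * t) / (cosh (H * t))\<^sup>2"
  proof (intro divide_right_mono mult_left_mono)
    show "\<bar>sinh (H * t)\<bar> \<le> cosh (H * t)" by (rule abs_sinh_le_cosh)
  qed (use a H in auto)
  also have "\<dots> = a * H / cosh (H * t)" by (simp add: power2_eq_square)
  finally have "3 * \<bar>?z\<bar>
      \<le> 3 * (a * H) / cosh (H * t)" by simp
  moreover have "a * H = H\<^sup>2 * r / sqrt (F_st H r)" by (simp add: a_def power2_eq_square)
  ultimately show ?thesis
    unfolding point_st_eq[OF H r] using sph_curve_derivative[OF w d] by simp
qed

text \<open>\<open>st_k\<close> depends on \<open>t\<close> only through the factor
  \<open>1 / cosh (H * t)\<close>, which survives differentiation in \<open>r\<close>; so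
  \<open>K\<close> can be chosen independently of \<open>t\<close> and \<omega>.\<close>

lemma point_st_deriv_r:
  assumes H: "0 < H" and r: "0 < r" "r < 1 / H"
  obtains K where "\<And>t \<omega>. norm \<omega> = 1 \<Longrightarrow>
    norm (vector_derivative (\<lambda>r. point_st H t r \<omega>) (at r)) \<le> K / cosh (H * t)"
proof -
  have r0: "0 \<le> r" using r by simp
  note F = F_st_pos[OF H r0 r(2)]
  let ?f = "\<lambda>r. sqrt (F_st H r)"
  note fd = sqrt_F_st_has_derivative[OF F]
  define b where "b = (H * ?f r - H * r * (- (H\<^sup>2 * r) / ?f r)) / (?f r * ?f r)"
  have "((\<lambda>r. H * r / ?f r) has_real_derivative b) (at r)"
    unfolding b_def using F by (intro DERIV_divide fd DERIV_cmult_Id) simp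
  from DERIV_cdivide[OF this]
  have kd: "((\<lambda>r. st_k H t r) has_real_derivative b / cosh (H * t)) (at r)" for t
    by (simp add: st_k_def[abs_def])
  have zd: "((\<lambda>r. pi - arctan (st_k H t r)) has_real_derivative
      - ((b / cosh (H * t)) / (1 + (st_k H t r)\<^sup>2))) (at r)" for t
    using DERIV_diff[OF DERIV_const DERIV_chain2[where f=arctan and g="\<lambda>r. st_k H t r", OF DERIV_arctan kd], of pi]
    by (simp add: inverse_eq_divide mult.commute)
  show thesis
  proof (rule that)
    fix t and \<omega> :: "real^3" assume w: "norm \<omega> = 1"
    have ev: "\<forall>\<^sub>F r in nhds r. point_st H t r \<omega> = sph (pi - arctan (st_k H t r)) \<omega>"
      using r by (auto simp: eventually_nhds point_st_eq[OF H] intro!: exI[of _ "{0<..<1/H}"])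
    have "vector_derivative (\<lambda>r. point_st H t r \<omega>) (at r)
        = vector_derivative (\<lambda>r. sph (pi - arctan (st_k H t r)) \<omega>) (at r)"
      by (rule vector_derivative_cong_eq) (use ev in auto)
    then have "norm (vector_derivative (\<lambda>r. point_st H t r \<omega>) (at r))
        \<le> 3 * \<bar>- ((b / cosh (H * t)) / (1 + (st_k H t r)\<^sup>2))\<bar>"
      using sph_curve_derivative[OF w zd] by simp
    also have "\<dots> \<le> 3 * \<bar>b / cosh (H * t)\<bar>"
      using abs_divide_one_plus_square_le[of "b / cosh (H * t)" "st_k H t r"] by simp
    also have "\<dots> = (3 * \<bar>b\<bar>) / cosh (H * t)" by (simp add: abs_divide)
    finally show "norm (vector_derivative (\<lambda>r. point_st H t r \<omega>) (at r)) \<le> (3 * \<bar>b\<bar>) / cosh (H * t)" .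
  qed
qed

lemma zeta_st_bound:
  assumes H: "0 < H" and r: "0 \<le> r" "r < 1 / H"
  shows "\<bar>zeta_st H t r - pi\<bar> \<le> (H * r / sqrt (F_st H r)) / cosh (H * t)"
    "\<bar>sin (zeta_st H t r)\<bar> \<le> (H * r / sqrt (F_st H r)) / cosh (H * t)"
proof -
  note F = F_st_pos[OF H r]
  have k: "st_k H t r = (H * r / sqrt (F_st H r)) / cosh (H * t)" "st_k H t r \<ge> 0"
    using F H r by (auto simp: st_k_def)
  have "\<bar>arctan (st_k H t r)\<bar> \<le> st_k H t r"
    using k(2) arctan_le_self[of "st_k H t r"] by simp
  then show 1: "\<bar>zeta_st H t r - pi\<bar> \<le> (H * r / sqrt (F_st H r)) / cosh (H * t)"
    unfolding static_coords(2)[OF assms] k(1)[symmetric] by simp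
  have "\<bar>sin (zeta_st H t r)\<bar> = \<bar>sin (pi - zeta_st H t r)\<bar>" by simp
  also have "\<dots> \<le> \<bar>pi - zeta_st H t r\<bar>" by (rule abs_sin_x_le_abs_x)
  finally show "\<bar>sin (zeta_st H t r)\<bar> \<le> (H * r / sqrt (F_st H r)) / cosh (H * t)" using 1 by linarith
qed

text \<open>At fixed \<zeta> the map \<open>sph\<close> is affine in \<omega>, with linear part
  \<open>sin \<zeta>\<close> times an isometric embedding.\<close>

lemma norm_frechet_derivative_sph:
  "norm (frechet_derivative (\<lambda>\<omega>. sph \<zeta> \<omega>) (at \<omega>) v) = \<bar>sin \<zeta>\<bar> * norm v"
proof -
  define L where "L v = (vector [0, sin \<zeta> * v$1, sin \<zeta> * v$2, sin \<zeta> * v$3] :: real^4)" for v :: "real^3"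
  have "bounded_linear L"
    unfolding linear_conv_bounded_linear[symmetric]
    by (rule linearI) (auto simp: L_def vec_eq_iff forall_4 algebra_simps)
  then have "((\<lambda>\<omega>. vector [cos \<zeta>, 0, 0, 0] + L \<omega>) has_derivative (\<lambda>h. 0 + L h)) (at \<omega>)"
    by (intro has_derivative_add has_derivative_const bounded_linear_imp_has_derivative)
  moreover have "(\<lambda>\<omega>. vector [cos \<zeta>, 0, 0, 0] + L \<omega>) = (\<lambda>\<omega>. sph \<zeta> \<omega>)"
    by (auto simp: L_def sph_def vec_eq_iff forall_4)
  ultimately have "((\<lambda>\<omega>. sph \<zeta> \<omega>) has_derivative L) (at \<omega>)" by simp
  then have "frechet_derivative (\<lambda>\<omega>. sph \<zeta> \<omega>) (at \<omega>) = L" by (metis frechet_derivative_at)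
  moreover have "L v \<bullet> L v = (sin \<zeta>)\<^sup>2 * (v \<bullet> v)"
    by (simp add: L_def inner_vec_def sum_3 sum_4 power2_eq_square algebra_simps)
  ultimately show ?thesis by (simp add: norm_eq_sqrt_inner real_sqrt_mult)
qed

section \<open>The curvature of de Sitter space\<close>

lemma pd_eq: "(f has_derivative f') (at p) \<Longrightarrow> pd a f p = f' (axis a 1)"
  unfolding pd_def using frechet_derivative_at[of f f' p] by simp

lemma axis_component [simp]: "axis a x $ b = (if b = a then x else 0)"
  by (simp add: axis_def)

text \<open>\<open>lam\<close> is the conformal factor of the stereographic chart.\<close>

definition den :: "real^4 \<Rightarrow> real" where
  "den p = (p$2)\<^sup>2 + (p$3)\<^sup>2 + (p$4)\<^sup>2 + 1"

definition lam :: "real^4 \<Rightarrow> real" where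
  "lam p = 2 / den p"

lemma den_pos: "den p > 0"
  unfolding den_def by (intro add_nonneg_pos) auto

lemma lam_pos: "lam p > 0"
  unfolding lam_def using den_pos by simp

lemma lam_relation: "lam p * ((p$2)\<^sup>2 + (p$3)\<^sup>2 + (p$4)\<^sup>2 + 1) = 2"
  using den_pos[of p] by (simp add: lam_def den_def[symmetric])

section \<open>The stereographic chart\<close>

lemma nth_has_derivative: "((\<lambda>p::real^'n. p $ i) has_derivative (\<lambda>h. h $ i)) (at p)"
  by (rule bounded_linear_imp_has_derivative[OF bounded_linear_vec_nth])

lemma lam_has_derivative:
  "(lam has_derivative (\<lambda>h. - (lam p)\<^sup>2 * (p$2 * h$2 + p$3 * h$3 + p$4 * h$4))) (at p)"
proof -
  have "(den has_derivative (\<lambda>h. 2 * (p$2 * h$2 + p$3 * h$3 + p$4 * h$4))) (at p)"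
    unfolding den_def[abs_def]
    by (auto intro!: derivative_eq_intros nth_has_derivative simp: algebra_simps)
  from has_derivative_divide[OF has_derivative_const[of 2] this] den_pos[of p]
  have d: "(lam has_derivative (\<lambda>h. - 2 * (inverse (den p) * (2 * (p$2 * h$2 + p$3 * h$3 + p$4 * h$4)) * inverse (den p))
      + 0 / den p)) (at p)"
    unfolding lam_def[abs_def] by simp
  have "- 2 * (inverse d * (2 * X) * inverse d) + 0 / d = - (2 / d)\<^sup>2 * X" for d X :: real
    by (simp add: power2_eq_square inverse_eq_divide)
  then show ?thesis using d by (simp only: lam_def)
qed

lemma stereo_eq: "stereo p = vector [1 - lam p, lam p * p$2, lam p * p$3, lam p * p$4]"
proof -
  have "(p$2)\<^sup>2 + (p$3)\<^sup>2 + (p$4)\<^sup>2 = den p - 1" by (simp add: den_def)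
  then show ?thesis
    using den_pos[of p] by (simp add: stereo_def lam_def Let_def vec_eq_iff forall_4 diff_divide_distrib)
qed

lemma pd_stereo: "pd a stereo p = vector [(lam p)\<^sup>2 * (p$2 * axis a 1 $ 2 + p$3 * axis a 1 $ 3 + p$4 * axis a 1 $ 4),
    lam p * axis a 1 $ 2 - (lam p)\<^sup>2 * (p$2 * axis a 1 $ 2 + p$3 * axis a 1 $ 3 + p$4 * axis a 1 $ 4) * p$2,
    lam p * axis a 1 $ 3 - (lam p)\<^sup>2 * (p$2 * axis a 1 $ 2 + p$3 * axis a 1 $ 3 + p$4 * axis a 1 $ 4) * p$3,
    lam p * axis a 1 $ 4 - (lam p)\<^sup>2 * (p$2 * axis a 1 $ 2 + p$3 * axis a 1 $ 3 + p$4 * axis a 1 $ 4) * p$4]"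
proof -
  let ?D = "\<lambda>h::real^4. - (lam p)\<^sup>2 * (p$2 * h$2 + p$3 * h$3 + p$4 * h$4)"
  have 1: "((\<lambda>p. (1 - lam p) *\<^sub>R axis 1 1 + (lam p * p$2) *\<^sub>R axis 2 1 + (lam p * p$3) *\<^sub>R axis 3 1
      + (lam p * p$4) *\<^sub>R (axis 4 1 :: real^4)) has_derivative
     (\<lambda>h. (- ?D h) *\<^sub>R axis 1 1 + (lam p * h$2 + ?D h * p$2) *\<^sub>R axis 2 1
      + (lam p * h$3 + ?D h * p$3) *\<^sub>R axis 3 1 + (lam p * h$4 + ?D h * p$4) *\<^sub>R axis 4 1)) (at p)"
    by (intro has_derivative_add has_derivative_scaleR_left has_derivative_mult lam_has_derivative nth_has_derivative
        has_derivative_diff[OF has_derivative_const, of _ _ _ 1, simplified])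
  have eq: "(\<lambda>p. (1 - lam p) *\<^sub>R axis 1 1 + (lam p * p$2) *\<^sub>R axis 2 1 + (lam p * p$3) *\<^sub>R axis 3 1
      + (lam p * p$4) *\<^sub>R (axis 4 1 :: real^4)) = stereo"
    by (rule ext) (simp add: stereo_eq vec_eq_iff forall_4)
  show ?thesis unfolding pd_eq[OF 1[unfolded eq]]
    by (simp add: vec_eq_iff forall_4)
qed

text \<open>Stereographic projection is conformal, so the metric is diagonal with entries 1 and
  three times \<open>- warp H p\<close>.\<close>

definition warp :: "real \<Rightarrow> real^4 \<Rightarrow> real" where
  "warp H p = (cosh (H * p$1))\<^sup>2 / H\<^sup>2 * (lam p)\<^sup>2"

lemma pd_stereo_inner:
  "pd a stereo p \<bullet> pd b stereo p = (if a = b \<and> a \<noteq> 1 then (lam p)\<^sup>2 else 0)"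
proof -
  note r = lam_relation[of p]
  have "\<forall>a b. pd a stereo p \<bullet> pd b stereo p = (if a = b \<and> a \<noteq> 1 then (lam p)\<^sup>2 else 0)"
  proof -
    \<comment> \<open>With general components in place of axis vectors, all sixteen cases are one
      polynomial identity modulo \<open>lam_relation\<close>.\<close>
    have *: "(lam p)\<^sup>2 * x * ((lam p)\<^sup>2 * y) + (lam p * a2 - (lam p)\<^sup>2 * x * p$2) * (lam p * b2 - (lam p)\<^sup>2 * y * p$2)
       + (lam p * a3 - (lam p)\<^sup>2 * x * p$3) * (lam p * b3 - (lam p)\<^sup>2 * y * p$3)
       + (lam p * a4 - (lam p)\<^sup>2 * x * p$4) * (lam p * b4 - (lam p)\<^sup>2 * y * p$4)
       = (lam p)\<^sup>2 * (a2 * b2 + a3 * b3 + a4 * b4)"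
      if "x = p$2 * a2 + p$3 * a3 + p$4 * a4" "y = p$2 * b2 + p$3 * b3 + p$4 * b4" for x y a2 a3 a4 b2 b3 b4
      using that r by algebra
    show ?thesis
      unfolding pd_stereo inner_vec_def sum_4 vector_4_nth inner_real_def
      by (subst *[OF refl refl]) (simp add: forall_4)
  qed
  then show ?thesis by blast
qed

lemma ds_metric_eq: "ds_metric H p = (\<chi> a b. if a = b then (if a = 1 then 1 else - warp H p) else 0)"
proof -
  have "pd a (\<lambda>q::real^4. q$1) p = (if a = 1 then 1 else 0)" for a p
    by (subst pd_eq[OF nth_has_derivative]) auto
  then show ?thesis
    by (simp add: ds_metric_def pd_stereo_inner warp_def vec_eq_iff)
qed

text \<open>\<open>matrix_inv\<close> is a choice of a two-sided inverse, so it is identified by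
  multiplying it with the explicit one.\<close>

lemma matrix_inv_diag:
  fixes d :: "'n::finite \<Rightarrow> real"
  assumes "\<And>a. d a \<noteq> 0"
  shows "matrix_inv (\<chi> a b. if a = b then d a else 0) = (\<chi> a b. if a = b then 1 / d a else 0)"
proof -
  let ?A = "(\<chi> a b. if a = b then d a else 0) :: real^'n^'n"
  let ?B = "(\<chi> a b. if a = b then 1 / d a else 0) :: real^'n^'n"
  have AB: "?A ** ?B = mat 1" "?B ** ?A = mat 1"
  proof -
    have e: "(\<Sum>k\<in>UNIV. (if i = k then x i else 0) * (if k = j then y k else 0)) = (if i = j then x i * y i else 0)"
      for i j :: 'n and x y :: "'n \<Rightarrow> real"
    proof -
      have "(if i = k then x i else 0) * (if k = j then y k else 0)
          = (if k = i then (if i = j then x i * y i else 0) else 0)" for k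
        by auto
      then show ?thesis by (simp add: sum.delta)
    qed
    show "?A ** ?B = mat 1" "?B ** ?A = mat 1"
      using e[of _ d _ "\<lambda>a. 1 / d a"] e[of _ "\<lambda>a. 1 / d a" _ d] assms
      by (simp_all add: matrix_matrix_mult_def mat_def vec_eq_iff)
  qed
  then have "?A ** matrix_inv ?A = mat 1 \<and> matrix_inv ?A ** ?A = mat 1"
    unfolding matrix_inv_def by (intro someI[of "\<lambda>B. ?A ** B = mat 1 \<and> B ** ?A = mat 1" ?B]) simp
  then have "matrix_inv ?A ** ?A = mat 1" ..
  then have "matrix_inv ?A = matrix_inv ?A ** (?A ** ?B)" using AB by simp
  also have "\<dots> = ?B" using \<open>matrix_inv ?A ** ?A = mat 1\<close> by (simp add: matrix_mul_assoc)
  finally show ?thesis .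
qed

lemma warp_pos: "H \<noteq> 0 \<Longrightarrow> warp H p > 0"
  using lam_pos[of p] by (simp add: warp_def)

lemma matrix_inv_ds_metric:
  assumes "H \<noteq> 0"
  shows "matrix_inv (ds_metric H p) $ a $ b = (if a = b then (if a = 1 then 1 else - 1 / warp H p) else 0)"
proof -
  have "matrix_inv (ds_metric H p) = (\<chi> a b. if a = b then 1 / (if a = 1 then 1 else - warp H p) else 0)"
    unfolding ds_metric_eq using warp_pos[OF assms, of p] by (subst matrix_inv_diag) auto
  then show ?thesis by simp
qed

text \<open>Half the logarithmic derivative of \<^const>\<open>warp\<close>.\<close>

definition dlog :: "real \<Rightarrow> 4 \<Rightarrow> real^4 \<Rightarrow> real" where
  "dlog H c p = (if c = 1 then H * tanh (H * p$1) else - lam p * p$c)"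

lemma cosh_nth_has_derivative:
  "((\<lambda>p::real^4. cosh (H * p$1)) has_derivative (\<lambda>h. (H * h$1) * sinh (H * p$1))) (at p)"
  by (rule DERIV_compose_FDERIV[OF _ has_derivative_mult_right[OF nth_has_derivative]])
     (auto intro!: derivative_eq_intros)

lemma warp_has_derivative:
  "(warp H has_derivative (\<lambda>h. 2 * warp H p * (dlog H 1 p * h$1 + dlog H 2 p * h$2 + dlog H 3 p * h$3 + dlog H 4 p * h$4))) (at p)"
proof -
  let ?X = "\<lambda>h::real^4. p$2 * h$2 + p$3 * h$3 + p$4 * h$4"
  let ?u = "\<lambda>p::real^4. 1 / H * (cosh (H * p$1) * lam p)"
  have "(?u has_derivative (\<lambda>h. 1 / H * (cosh (H * p$1) * (- (lam p)\<^sup>2 * ?X h) + (H * h$1) * sinh (H * p$1) * lam p))) (at p)"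
    by (intro has_derivative_mult_right has_derivative_mult cosh_nth_has_derivative lam_has_derivative)
  then have "(?u has_derivative (\<lambda>h. ?u p * (H * tanh (H * p$1) * h$1 - lam p * ?X h))) (at p)"
  proof (rule has_derivative_eq_rhs, intro ext)
    fix h :: "real^4"
    have e: "i * (C * (- L\<^sup>2 * X) + H * y * (C * T) * L) = i * (C * L) * (H * T * y - L * X)" for i C L X y T :: real
      by algebra
    have "sinh (H * p$1) = cosh (H * p$1) * tanh (H * p$1)" by (simp add: tanh_def)
    then show "1 / H * (cosh (H * p$1) * (- (lam p)\<^sup>2 * ?X h) + (H * h$1) * sinh (H * p$1) * lam p)
        = ?u p * (H * tanh (H * p$1) * h$1 - lam p * ?X h)" by (simp only: e)
  qed
  from has_derivative_power[OF this, of 2]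
  have "((\<lambda>p. (?u p)\<^sup>2) has_derivative (\<lambda>h. 2 * (?u p)\<^sup>2 * (H * tanh (H * p$1) * h$1 - lam p * ?X h))) (at p)"
    by (rule has_derivative_eq_rhs) (auto simp: fun_eq_iff power2_eq_square)
  moreover have "(\<lambda>p. (?u p)\<^sup>2) = warp H"
    by (auto simp: fun_eq_iff warp_def power_divide power_mult_distrib)
  moreover have "(\<lambda>h. 2 * (?u p)\<^sup>2 * (H * tanh (H * p$1) * h$1 - lam p * ?X h)) =
      (\<lambda>h. 2 * warp H p * (dlog H 1 p * h$1 + dlog H 2 p * h$2 + dlog H 3 p * h$3 + dlog H 4 p * h$4))"
    by (auto simp: fun_eq_iff warp_def dlog_def power_divide power_mult_distrib algebra_simps)
  ultimately show ?thesis by simp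
qed

section \<open>Christoffel symbols and Ricci curvature\<close>

lemma pd_const: "pd a (\<lambda>q. c) p = 0"
  by (simp add: pd_def)

lemma pd_uminus_warp: "pd c (\<lambda>q. - warp H q) p = - (2 * warp H p * dlog H c p)"
proof -
  have "\<forall>c. pd c (\<lambda>q. - warp H q) p = - (2 * warp H p * dlog H c p)"
    by (simp add: pd_eq[OF has_derivative_minus[OF warp_has_derivative]] forall_4)
  then show ?thesis by blast
qed

lemma pd_ds_metric: "pd c (\<lambda>q. ds_metric H q $ a $ b) p = (if a = b \<and> a \<noteq> 1 then - (2 * warp H p * dlog H c p) else 0)"
  by (cases "a = b"; cases "a = 1") (simp_all add: ds_metric_eq pd_const pd_uminus_warp)

text \<open>In terms of half logarithmic derivatives the factor \<open>warp\<close> cancels against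
  the inverse metric in all symbols with a spatial upper index; it remains only in those with upper
  index 1.\<close>

definition ds_gamma :: "real \<Rightarrow> 4 \<Rightarrow> 4 \<Rightarrow> 4 \<Rightarrow> real^4 \<Rightarrow> real" where
  "ds_gamma H c a b p = (if c = 1 then (if a = b \<and> a \<noteq> 1 then dlog H 1 p * warp H p else 0)
     else (if c = b then dlog H a p else 0) + (if c = a then dlog H b p else 0)
       - (if a = b \<and> a \<noteq> 1 then dlog H c p else 0))"

lemma sum_half_delta:
  fixes y :: "'n::finite \<Rightarrow> real"
  shows "(\<Sum>d\<in>UNIV. 1/2 * (if c = d then X else 0) * y d) = 1/2 * X * y c"
proof -
  have "(\<Sum>d\<in>UNIV. 1/2 * (if c = d then X else 0) * y d) = (\<Sum>d\<in>UNIV. if d = c then 1/2 * X * y c else 0)"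
    by (rule sum.cong) auto
  then show ?thesis by simp
qed

lemma christoffel_ds_metric:
  assumes "H \<noteq> 0"
  shows "christoffel (ds_metric H) c a b = ds_gamma H c a b"
proof
  fix p
  have w: "warp H p \<noteq> 0" using warp_pos[OF assms, of p] by simp
  have "christoffel (ds_metric H) c a b p = (1/2 * (if c = 1 then 1 else - 1 / warp H p) *
     (pd a (\<lambda>q. ds_metric H q $ c $ b) p + pd b (\<lambda>q. ds_metric H q $ c $ a) p - pd c (\<lambda>q. ds_metric H q $ a $ b) p))"
    unfolding christoffel_def matrix_inv_ds_metric[OF assms] by (rule sum_half_delta)
  also have "\<dots> = ds_gamma H c a b p"
    using w by (auto simp: pd_ds_metric ds_gamma_def field_simps)
  finally show "christoffel (ds_metric H) c a b p = ds_gamma H c a b p" .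
qed

definition dlog_deriv :: "real \<Rightarrow> 4 \<Rightarrow> 4 \<Rightarrow> real^4 \<Rightarrow> real" where
  "dlog_deriv H d c p = (if c = 1 then (if d = 1 then H\<^sup>2 * (1 - (tanh (H * p$1))\<^sup>2) else 0)
     else if d = 1 then 0 else (lam p)\<^sup>2 * p$d * p$c - (if d = c then lam p else 0))"

lemma cases_4: "i = 1 \<or> i = 2 \<or> i = 3 \<or> i = (4::4)"
  using exhaust_4[of i] by blast

lemma dlog_has_derivative:
  "(dlog H c has_derivative (\<lambda>h. \<Sum>d\<in>UNIV. dlog_deriv H d c p * h$d)) (at p)"
proof (cases "c = 1")
  case True
  have "((\<lambda>p::real^4. H * tanh (H * p$1)) has_derivative (\<lambda>h. H * ((H * h$1) * (1 - (tanh (H * p$1))\<^sup>2)))) (at p)"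
    by (intro has_derivative_mult_right DERIV_compose_FDERIV[OF _ has_derivative_mult_right[OF nth_has_derivative]])
       (auto intro!: derivative_eq_intros)
  then show ?thesis using True
    by (simp add: dlog_def[abs_def] dlog_deriv_def sum_4 power2_eq_square mult_ac)
next
  case False
  have "((\<lambda>p. - (lam p * p$c)) has_derivative
      (\<lambda>h. - (lam p * h$c + - (lam p)\<^sup>2 * (p$2 * h$2 + p$3 * h$3 + p$4 * h$4) * p$c))) (at p)"
    by (intro has_derivative_minus has_derivative_mult lam_has_derivative nth_has_derivative)
  moreover have "(\<lambda>h. - (lam p * h$c + - (lam p)\<^sup>2 * (p$2 * h$2 + p$3 * h$3 + p$4 * h$4) * p$c))
      = (\<lambda>h. \<Sum>d\<in>UNIV. dlog_deriv H d c p * h$d)"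
    using False cases_4[of c] by (auto simp: fun_eq_iff dlog_deriv_def sum_4 algebra_simps)
  ultimately show ?thesis using False by (simp add: dlog_def[abs_def])
qed

lemma warp_has_derivative_sum:
  "(warp H has_derivative (\<lambda>h. \<Sum>d\<in>UNIV. 2 * warp H p * dlog H d p * h$d)) (at p)"
  using warp_has_derivative[of H p] by (simp add: sum_4 algebra_simps)

definition ds_gamma_deriv :: "real \<Rightarrow> 4 \<Rightarrow> 4 \<Rightarrow> 4 \<Rightarrow> 4 \<Rightarrow> real^4 \<Rightarrow> real" where
  "ds_gamma_deriv H d c a b p = (if c = 1 then (if a = b \<and> a \<noteq> 1
       then dlog_deriv H d 1 p * warp H p + dlog H 1 p * (2 * warp H p * dlog H d p) else 0)
     else (if c = b then dlog_deriv H d a p else 0) + (if c = a then dlog_deriv H d b p else 0)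
       - (if a = b \<and> a \<noteq> 1 then dlog_deriv H d c p else 0))"

lemma pd_ds_gamma: "pd d (ds_gamma H c a b) p = ds_gamma_deriv H d c a b p"
proof -
  note D = dlog_has_derivative[of H _ p]
  have z: "((\<lambda>q. 0) has_derivative (\<lambda>h::real^4. \<Sum>d\<in>UNIV. 0 * h$d)) (at p)" by simp
  have i: "((\<lambda>q. if P then f q else 0) has_derivative (\<lambda>h. if P then f' h else 0)) (at p)"
    if "(f has_derivative f') (at p)" for P and f :: "real^4 \<Rightarrow> real" and f'
    using that by (cases P) auto
  have m: "((\<lambda>q. dlog H 1 q * warp H q) has_derivative
     (\<lambda>h. dlog H 1 p * (\<Sum>d\<in>UNIV. 2 * warp H p * dlog H d p * h$d) + (\<Sum>d\<in>UNIV. dlog_deriv H d 1 p * h$d) * warp H p)) (at p)"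
    by (intro has_derivative_mult D warp_has_derivative_sum)
  have s: "(\<Sum>d'\<in>UNIV. f d' * (if d' = d then 1 else 0)) = f d" for f :: "4 \<Rightarrow> real"
    using cases_4[of d] by (auto simp: sum_4)
  show ?thesis
  proof (cases "c = 1")
    case True
    then have "ds_gamma H c a b = (\<lambda>q. if a = b \<and> a \<noteq> 1 then dlog H 1 q * warp H q else 0)"
      by (auto simp: ds_gamma_def)
    then show ?thesis
      using pd_eq[OF i[OF m, of "a = b \<and> a \<noteq> 1"], of d] True by (auto simp: ds_gamma_deriv_def s)
  next
    case False
    then have "ds_gamma H c a b = (\<lambda>q. (if c = b then dlog H a q else 0) + (if c = a then dlog H b q else 0)
       - (if a = b \<and> a \<noteq> 1 then dlog H c q else 0))"
      by (auto simp: ds_gamma_def)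
    then show ?thesis
      using pd_eq[OF has_derivative_diff[OF has_derivative_add[OF i[OF D[of a], of "c = b"] i[OF D[of b], of "c = a"]]
          i[OF D[of c], of "a = b \<and> a \<noteq> 1"]], of d] False
      by (auto simp: ds_gamma_deriv_def s)
  qed
qed

text \<open>Links the time and space factors of \<open>warp\<close>. Together with
  \<open>lam_relation\<close> it reduces the Ricci computation to polynomial identities.\<close>

lemma warp_relation:
  assumes "H \<noteq> 0"
  shows "H\<^sup>2 * warp H p * (1 - (tanh (H * p$1))\<^sup>2) = (lam p)\<^sup>2"
proof -
  have "(cosh (H * p$1))\<^sup>2 * (1 - (tanh (H * p$1))\<^sup>2) = (cosh (H * p$1))\<^sup>2 - (sinh (H * p$1))\<^sup>2"
    by (simp add: tanh_def power_divide right_diff_distrib)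
  then have "(cosh (H * p$1))\<^sup>2 * (1 - (tanh (H * p$1))\<^sup>2) = 1" by (simp add: hyperbolic_pythagoras)
  moreover have "H\<^sup>2 * warp H p = (cosh (H * p$1))\<^sup>2 * (lam p)\<^sup>2" using assms by (simp add: warp_def)
  ultimately show ?thesis by algebra
qed

text \<open>The inverse metric is diagonal, so the scalar curvature sees only these entries. They
  are \<open>- 3 * H^2\<close> times those of the metric.\<close>

lemma ricci_diag:
  assumes "H \<noteq> 0"
  shows "ricci (ds_metric H) 1 1 p = - 3 * H\<^sup>2"
    and "a \<noteq> 1 \<Longrightarrow> ricci (ds_metric H) a a p = 3 * H\<^sup>2 * warp H p"
proof -
  define T L w where "T = tanh (H * p$1)" and "L = lam p" and "w = warp H p"
  have r: "H\<^sup>2 * w * (1 - T\<^sup>2) = L\<^sup>2" using warp_relation[OF assms] by (simp add: T_def L_def w_def)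
  have l: "L * ((p$2)\<^sup>2 + (p$3)\<^sup>2 + (p$4)\<^sup>2 + 1) = 2" using lam_relation by (simp add: L_def)
  note defs = ricci_def christoffel_ds_metric[OF assms] pd_ds_gamma sum_4 ds_gamma_deriv_def ds_gamma_def dlog_deriv_def dlog_def
    T_def[symmetric] L_def[symmetric] w_def[symmetric]
  show "ricci (ds_metric H) 1 1 p = - 3 * H\<^sup>2"
    by (simp add: defs power2_eq_square algebra_simps)
  have "ricci (ds_metric H) 2 2 p = 3 * H\<^sup>2 * w"
    apply (simp add: defs)
    using r l by algebra
  moreover have "ricci (ds_metric H) 3 3 p = 3 * H\<^sup>2 * w"
    apply (simp add: defs)
    using r l by algebra
  moreover have "ricci (ds_metric H) 4 4 p = 3 * H\<^sup>2 * w"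
    apply (simp add: defs)
    using r l by algebra
  ultimately show "a \<noteq> 1 \<Longrightarrow> ricci (ds_metric H) a a p = 3 * H\<^sup>2 * warp H p"
    using cases_4[of a] by (auto simp: w_def)
qed

lemma sum_diag_ds_metric:
  assumes "H \<noteq> 0"
  shows "(\<Sum>a\<in>UNIV. \<Sum>b\<in>UNIV. matrix_inv (ds_metric H p) $ a $ b * X a b)
     = X 1 1 - (X 2 2 + X 3 3 + X 4 4) / warp H p"
  unfolding matrix_inv_ds_metric[OF assms] by (simp add: sum_4 add_divide_distrib)

lemma scal_curv_ds_metric:
  assumes "H \<noteq> 0"
  shows "scal_curv (ds_metric H) p = 12 * H\<^sup>2"
  unfolding scal_curv_def sum_diag_ds_metric[OF assms] using ricci_diag[OF assms] warp_pos[OF assms, of p]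
  by (simp add: field_simps)

section \<open>The conformally invariant wave equation\<close>

text \<open>A null linear coordinate of the ambient Minkowski space: \<open>lam - 1 = - cos \<zeta>\<close>. The field
  \<^const>\<open>Phi1\<close> is its reciprocal.\<close>

definition ell :: "real \<Rightarrow> real^4 \<Rightarrow> real" where
  "ell H p = sinh (H * p$1) + cosh (H * p$1) * (lam p - 1)"

definition dell :: "real \<Rightarrow> 4 \<Rightarrow> real^4 \<Rightarrow> real" where
  "dell H a p = (if a = 1 then H * (cosh (H * p$1) + sinh (H * p$1) * (lam p - 1))
     else - cosh (H * p$1) * (lam p)\<^sup>2 * p$a)"

definition ddell :: "real \<Rightarrow> 4 \<Rightarrow> 4 \<Rightarrow> real^4 \<Rightarrow> real" where
  "ddell H b a p = (if a = 1 \<and> b = 1 then H\<^sup>2 * ell H p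
     else if a = 1 then - H * sinh (H * p$1) * (lam p)\<^sup>2 * p$b
     else if b = 1 then - H * sinh (H * p$1) * (lam p)\<^sup>2 * p$a
     else - cosh (H * p$1) * ((if a = b then (lam p)\<^sup>2 else 0) - 2 * (lam p)^3 * p$a * p$b))"

lemma sinh_nth_has_derivative:
  "((\<lambda>p::real^4. sinh (H * p$1)) has_derivative (\<lambda>h. (H * h$1) * cosh (H * p$1))) (at p)"
  by (rule DERIV_compose_FDERIV[OF _ has_derivative_mult_right[OF nth_has_derivative]])
     (auto intro!: derivative_eq_intros)

lemma lam_minus_one_has_derivative:
  "((\<lambda>p. lam p - 1) has_derivative (\<lambda>h. - (lam p)\<^sup>2 * (p$2 * h$2 + p$3 * h$3 + p$4 * h$4))) (at p)"
  using has_derivative_diff[OF lam_has_derivative has_derivative_const[of 1]] by simp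

lemma ell_has_derivative:
  "(ell H has_derivative (\<lambda>h. \<Sum>a\<in>UNIV. dell H a p * h$a)) (at p)"
  unfolding ell_def[abs_def]
  by (rule has_derivative_eq_rhs[OF has_derivative_add[OF sinh_nth_has_derivative
        has_derivative_mult[OF cosh_nth_has_derivative lam_minus_one_has_derivative]]])
     (simp add: fun_eq_iff sum_4 dell_def algebra_simps)

lemma dell_has_derivative:
  "(dell H a has_derivative (\<lambda>h. \<Sum>b\<in>UNIV. ddell H b a p * h$b)) (at p)"
proof (cases "a = 1")
  case True
  have "((\<lambda>p. H * (cosh (H * p$1) + sinh (H * p$1) * (lam p - 1))) has_derivative
      (\<lambda>h. \<Sum>b\<in>UNIV. ddell H b 1 p * h$b)) (at p)"
    by (rule has_derivative_eq_rhs[OF has_derivative_mult_right[OF has_derivative_add[OF cosh_nth_has_derivative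
        has_derivative_mult[OF sinh_nth_has_derivative lam_minus_one_has_derivative]]]])
     (simp add: fun_eq_iff sum_4 ddell_def ell_def power2_eq_square algebra_simps)
  then show ?thesis using True by (simp add: dell_def[abs_def])
next
  case False
  have "((\<lambda>p. (- cosh (H * p$1)) * (lam p)^2 * p$a) has_derivative
      (\<lambda>h. \<Sum>b\<in>UNIV. ddell H b a p * h$b)) (at p)"
    by (rule has_derivative_eq_rhs[OF has_derivative_mult[OF has_derivative_mult[OF has_derivative_minus[OF cosh_nth_has_derivative]
        has_derivative_power[OF lam_has_derivative]] nth_has_derivative]])
     (use False cases_4[of a] in \<open>auto simp: fun_eq_iff sum_4 ddell_def power2_eq_square power3_eq_cube algebra_simps\<close>)
  then show ?thesis using False by (simp add: dell_def[abs_def])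
qed

lemma inverse_ell_has_derivative:
  assumes "ell H p \<noteq> 0"
  shows "((\<lambda>p. 1 / ell H p) has_derivative (\<lambda>h. \<Sum>a\<in>UNIV. - dell H a p / (ell H p)\<^sup>2 * h$a)) (at p)"
  by (rule has_derivative_eq_rhs[OF has_derivative_divide[OF has_derivative_const ell_has_derivative assms]])
     (simp add: fun_eq_iff sum_4 power2_eq_square inverse_eq_divide add_divide_distrib algebra_simps)

definition hess :: "real \<Rightarrow> 4 \<Rightarrow> 4 \<Rightarrow> real^4 \<Rightarrow> real" where
  "hess H a b p = 2 * dell H a p * dell H b p / (ell H p)^3 - ddell H b a p / (ell H p)\<^sup>2"

lemma inverse_ell_has_second_derivative:
  assumes "ell H p \<noteq> 0"
  shows "((\<lambda>p. - dell H a p / (ell H p)\<^sup>2) has_derivative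
    (\<lambda>h. \<Sum>b\<in>UNIV. hess H a b p * h$b)) (at p)"
proof -
  have i: "((\<lambda>p. 1 / ell H p * (1 / ell H p)) has_derivative
      (\<lambda>h. 1 / ell H p * (\<Sum>a\<in>UNIV. - dell H a p / (ell H p)\<^sup>2 * h$a) + (\<Sum>a\<in>UNIV. - dell H a p / (ell H p)\<^sup>2 * h$a) * (1 / ell H p))) (at p)"
    by (intro has_derivative_mult inverse_ell_has_derivative assms)
  have "((\<lambda>p. - dell H a p * (1 / ell H p * (1 / ell H p))) has_derivative
    (\<lambda>h. \<Sum>b\<in>UNIV. hess H a b p * h$b)) (at p)"
    by (rule has_derivative_eq_rhs[OF has_derivative_mult[OF has_derivative_minus[OF dell_has_derivative] i]])
       (use assms in \<open>simp add: hess_def fun_eq_iff sum_4 power2_eq_square power3_eq_cube field_simps\<close>)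
  moreover have "(\<lambda>p. - dell H a p * (1 / ell H p * (1 / ell H p))) = (\<lambda>p. - dell H a p / (ell H p)\<^sup>2)"
    by (simp add: fun_eq_iff power2_eq_square)
  ultimately show ?thesis by simp
qed

text \<open>A linear coordinate of the ambient space has Hessian \<open>H^2 * ell\<close> times the
  metric on the hyperboloid, and for a null one the gradient has square \<open>H^2 * ell^2\<close>.
  Hence the box of \<open>1 / ell\<close> is \<open>(2 - 4) * H^2 / ell\<close>, and a sixth of the
  curvature \<open>12 * H^2\<close> cancels it. The proof checks this in coordinates.\<close>

lemma conf_wave_inverse_ell:
  assumes H: "H \<noteq> 0" and D: "open D" and f: "\<And>p. p \<in> D \<Longrightarrow> f p = 1 / ell H p"
    and nz: "\<And>p. p \<in> D \<Longrightarrow> ell H p \<noteq> 0"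
  shows "solves_conf_wave (ds_metric H) D f"
  unfolding solves_conf_wave_def
proof (intro ballI conjI allI)
  have s: "(\<Sum>b\<in>UNIV. g b * axis a 1 $ b) = g a" for g :: "4 \<Rightarrow> real" and a
    using cases_4[of a] by (auto simp: sum_4)
  have df: "(f has_derivative (\<lambda>h. \<Sum>a\<in>UNIV. - dell H a p / (ell H p)\<^sup>2 * h$a)) (at p)" if "p \<in> D" for p
    by (rule has_derivative_transform_within_open[OF inverse_ell_has_derivative[OF nz[OF that]] D that])
       (simp add: f)
  have pf: "pd a f p = - dell H a p / (ell H p)\<^sup>2" if "p \<in> D" for a p
    unfolding pd_eq[OF df[OF that]] by (rule s)
  have dpf: "(pd a f has_derivative (\<lambda>h. \<Sum>b\<in>UNIV. hess H a b p * h$b)) (at p)"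
    if "p \<in> D" for a p
    by (rule has_derivative_transform_within_open[OF inverse_ell_has_second_derivative[OF nz[OF that]] D that])
       (simp add: pf)
  have ppf: "pd b (pd a f) p = hess H a b p" if "p \<in> D" for a b p
    unfolding pd_eq[OF dpf[OF that]] by (rule s)
  fix p assume p: "p \<in> D"
  show "f differentiable (at p)" using df[OF p] by (auto simp: differentiable_def)
  show "pd a f differentiable (at p)" for a using dpf[OF p] by (auto simp: differentiable_def)
  define S C T L l w where "S = sinh (H * p$1)" and "C = cosh (H * p$1)" and "T = tanh (H * p$1)"
    and "L = lam p" and "l = ell H p" and "w = warp H p"
  have l0: "l \<noteq> 0" using nz[OF p] by (simp add: l_def)
  have w0: "w \<noteq> 0" using warp_pos[OF H, of p] by (simp add: w_def)
  have C0: "C \<noteq> 0" by (simp add: C_def)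
  have lS: "l = S + C * (L - 1)" by (simp add: l_def ell_def S_def C_def L_def)
  have CS: "C\<^sup>2 - S\<^sup>2 = 1" by (simp add: C_def S_def hyperbolic_pythagoras)
  have TC: "T * C = S" by (simp add: T_def C_def S_def tanh_def)
  have wC: "H\<^sup>2 * w = C\<^sup>2 * L\<^sup>2" using H by (simp add: w_def warp_def C_def L_def)
  have rel: "L * ((p$2)\<^sup>2 + (p$3)\<^sup>2 + (p$4)\<^sup>2) = 2 - L" using lam_relation[of p] by (simp add: L_def algebra_simps)
  define q where "q = (p$2)\<^sup>2 + (p$3)\<^sup>2 + (p$4)\<^sup>2"
  define l1 where "l1 = H * (C + S * (L - 1))"
  \<comment> \<open>The second time derivative, the expansion term from the symbols with upper index
    1, and the spatial trace divided by \<open>w\<close>, whose last summand comes from the spatial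
    symbols.\<close>
  have "box (ds_metric H) f p = (2 * l1\<^sup>2 / l^3 - H\<^sup>2 * l / l\<^sup>2) - 3 * (H * T) * l1 / l\<^sup>2
      - ((2 * C\<^sup>2 * L^4 * q / l^3 + C * (3 * L\<^sup>2 - 2 * L^3 * q) / l\<^sup>2) - C * L^3 * q / l\<^sup>2) / w"
    unfolding box_def christoffel_ds_metric[OF H] sum_diag_ds_metric[OF H]
    using l0 w0
    by (simp add: pf[OF p] ppf[OF p] hess_def sum_4 ds_gamma_def dlog_def dell_def ddell_def
        S_def[symmetric] C_def[symmetric] T_def[symmetric] L_def[symmetric] l_def[symmetric] w_def[symmetric] l1_def[symmetric] q_def)
       (simp add: field_simps power2_eq_square power3_eq_cube power4_eq_xxxx)
  also have "\<dots> = - 2 * H\<^sup>2 / l"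
  proof -
    \<comment> \<open>\<open>H * m\<close> is the time derivative of \<open>ell\<close>. The
      relation \<open>mm\<close> encodes the null condition, and \<open>Tm\<close> removes the
      hyperbolic tangent.\<close>
    define m where "m = C + S * (L - 1)"
    have l1: "l1 = H * m" by (simp add: l1_def m_def)
    have L0: "L \<noteq> 0" using lam_pos[of p] by (simp add: L_def)
    have Sm: "S * m + (L - 1) = C * l" using CS unfolding m_def lS by algebra
    have mm: "m\<^sup>2 = l\<^sup>2 + L * (2 - L)" using CS unfolding m_def lS by algebra
    have Tm: "T * m = l - (L - 1) / C"
      using Sm TC C0 by (simp add: field_simps) algebra
    have Lq: "L^4 * q = L^3 * (2 - L)" "L^3 * q = L\<^sup>2 * (2 - L)"
      using rel unfolding q_def[symmetric] by algebra+
    let ?I = "2 * C\<^sup>2 * L^4 * q / l^3 + C * (3 * L\<^sup>2 - 2 * L^3 * q) / l\<^sup>2 - C * L^3 * q / l\<^sup>2"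
    have inner: "?I
        = C\<^sup>2 * L\<^sup>2 * (2 * (L * (2 - L)) / l^3 + 3 * ((L - 1) / C) / l\<^sup>2)"
    proof -
      have a: "2 * C\<^sup>2 * L^4 * q / l^3 = C\<^sup>2 * L\<^sup>2 * (2 * (L * (2 - L)) / l^3)"
        using Lq(1) by (simp add: mult.assoc power2_eq_square power3_eq_cube)
      have b: "C * (3 * L\<^sup>2 - 2 * L^3 * q) / l\<^sup>2 - C * L^3 * q / l\<^sup>2 = C * (L\<^sup>2 * (3 * (L - 1))) / l\<^sup>2"
      proof -
        have "C * (3 * L\<^sup>2 - 2 * L^3 * q) - C * L^3 * q = C * (L\<^sup>2 * (3 * (L - 1)))"
          using Lq(2) by algebra
        then show ?thesis by (simp only: diff_divide_distrib[symmetric])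
      qed
      have c: "C * (L\<^sup>2 * (3 * (L - 1))) / l\<^sup>2 = C\<^sup>2 * L\<^sup>2 * (3 * ((L - 1) / C) / l\<^sup>2)"
        using C0 by (simp add: power2_eq_square)
      show ?thesis unfolding add_diff_eq[symmetric] a b c distrib_left ..
    qed
    have "?I / w
        = H\<^sup>2 * (2 * (L * (2 - L)) / l^3 + 3 * ((L - 1) / C) / l\<^sup>2)"
      unfolding inner using wC[symmetric] w0 by simp
    moreover have "2 * l1\<^sup>2 / l^3 - H\<^sup>2 * l / l\<^sup>2 = H\<^sup>2 * (2 * (L * (2 - L)) / l^3 + 1 / l)"
      unfolding l1 power_mult_distrib mm using l0 by (simp add: field_simps power2_eq_square power3_eq_cube)
    moreover have "3 * (H * T) * l1 / l\<^sup>2 = H\<^sup>2 * (3 / l - 3 * ((L - 1) / C) / l\<^sup>2)"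
    proof -
      have "3 * (H * T) * l1 / l\<^sup>2 = H\<^sup>2 * (3 * (T * m) / l\<^sup>2)" by (simp add: l1 power2_eq_square)
      also have "3 * (T * m) / l\<^sup>2 = 3 / l - 3 * ((L - 1) / C) / l\<^sup>2"
        unfolding Tm using l0 by (simp add: right_diff_distrib diff_divide_distrib power2_eq_square)
      finally show ?thesis .
    qed
    moreover have "H\<^sup>2 * (a + 1 / l) - H\<^sup>2 * (3 / l - b) - H\<^sup>2 * (a + b) = - 2 * H\<^sup>2 / l" for a b
      by (simp add: algebra_simps)
    ultimately show ?thesis by metis
  qed
  finally show "box (ds_metric H) f p + 1 / 6 * scal_curv (ds_metric H) p * f p = 0"
    using f[OF p] by (simp add: scal_curv_ds_metric[OF H] l_def)
qed

section \<open>The explicit field on the static region\<close>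

lemma stereo_nth_1: "stereo p $ 1 = 1 - lam p"
  by (simp add: stereo_eq)

lemma lam_le_2: "lam p \<le> 2"
proof -
  have "1 \<le> den p" by (simp add: den_def)
  then show ?thesis unfolding lam_def using den_pos[of p] by (simp add: divide_le_eq)
qed

lemma continuous_on_lam: "continuous_on A lam"
  using lam_has_derivative by (meson continuous_at_imp_continuous_on has_derivative_continuous)

lemma open_static_domain: "open (static_domain H)"
proof -
  have c: "cos (arccos (1 - lam p)) = 1 - lam p" for p
    using lam_pos[of p] lam_le_2[of p] by (intro cos_arccos) auto
  \<comment> \<open>Without \<open>arccos\<close> the domain is cut out by strict inequalities
    between continuous functions, and the upper bound on \<zeta> becomes automatic.\<close>
  have "static_domain H = {p. 1 - lam p < 0} \<inter> {p. sqrt (1 - (1 - lam p)\<^sup>2) < cos (tau H (p$1))}"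
  proof -
    have "pi/2 < arccos (1 - lam p) \<longleftrightarrow> 1 - lam p < 0" for p
      using arccos_less_mono[of "0::real" "1 - lam p"] lam_pos[of p] lam_le_2[of p] by simp
    moreover have "arccos (1 - lam p) \<le> pi" for p
      using lam_pos[of p] lam_le_2[of p] by (intro arccos_ubound) auto
    moreover have "sin (arccos (1 - lam p)) = sqrt (1 - (1 - lam p)\<^sup>2)" for p
      using lam_pos[of p] lam_le_2[of p] by (intro sin_arccos) auto
    ultimately show ?thesis
      by (auto simp: static_domain_def static_region_def stereo_nth_1)
  qed
  moreover have "open {p. 1 - lam p < 0}"
    by (intro open_Collect_less continuous_intros continuous_on_lam)
  moreover have "open {p::real^4. sqrt (1 - (1 - lam p)\<^sup>2) < cos (tau H (p$1))}"
    unfolding tau_def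
    by (intro open_Collect_less continuous_intros continuous_on_lam) auto
  ultimately show ?thesis by auto
qed

text \<open>In the null coordinates \<open>c * C + S\<close> and \<open>c * C - S\<close>, the
  function \<open>F_st\<close> is their product and \<open>exp (2 * H * t)\<close> their quotient,
  so the two roots in \<open>Phi1\<close> combine to the reciprocal of the first.\<close>

lemma Phi1_ds_eq:
  assumes H: "H > 0" and p: "p \<in> static_domain H"
    and ct: "cos (tau H (p$1)) = 1 / cosh (H * p$1)" and st: "sin (tau H (p$1)) = tanh (H * p$1)"
  shows "Phi1_ds H p = 1 / ell H p" "ell H p > 0"
proof -
  define c C S where "c = lam p - 1" and "C = cosh (H * p$1)" and "S = sinh (H * p$1)"
  define z where "z = arccos (1 - lam p)"
  have b: "- 1 \<le> 1 - lam p" "1 - lam p \<le> 1" using lam_pos[of p] lam_le_2[of p] by auto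
  have cz: "cos z = - c" using cos_arccos[OF b] by (simp add: z_def c_def)
  have z: "pi/2 < z" "z \<le> pi" "sin z < 1 / C"
    using p by (auto simp: static_domain_def static_region_def stereo_nth_1 z_def ct C_def)
  have "cos z < cos (pi/2)" using z by (intro cos_monotone_0_pi) auto
  then have c: "c > 0" by (simp add: cz)
  have C: "C > 0" by (simp add: C_def)
  have CS: "C\<^sup>2 - S\<^sup>2 = 1" by (simp add: C_def S_def hyperbolic_pythagoras)
  have sz: "sin z \<ge> 0" using z by (intro sin_ge_zero) (auto intro: order_trans[OF _ less_imp_le])
  have s2: "(sin z)\<^sup>2 = 1 - c\<^sup>2" by (simp add: sin_squared_eq cz)
  have "(sin z * C) < 1" using z(3) C by (simp add: field_simps)
  then have "(sin z * C)\<^sup>2 < 1\<^sup>2" using sz C by (intro power_strict_mono) auto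
  moreover have sC: "(sin z * C)\<^sup>2 = C\<^sup>2 - c\<^sup>2 * C\<^sup>2"
    by (simp add: power_mult_distrib s2 algebra_simps)
  moreover have pr: "(c * C - S) * (c * C + S) = c\<^sup>2 * C\<^sup>2 - S\<^sup>2" by algebra
  ultimately have Fpos: "(c * C - S) * (c * C + S) > 0" using CS by simp
  \<comment> \<open>The product of the two null coordinates is positive on the static region; as
    their sum is positive too, so is each.\<close>
  moreover have "c * C - S > 0 \<or> c * C + S > 0"
    using mult_pos_pos[OF c C] by linarith
  ultimately have m: "c * C - S > 0" and pl: "c * C + S > 0"
    by (auto simp: zero_less_mult_iff)
  show "ell H p > 0" using pl by (simp add: ell_def c_def C_def S_def algebra_simps)
  define u where "u = (S / C) / c"
  have u: "1 - u = (c * C - S) / (c * C)" "1 + u = (c * C + S) / (c * C)"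
    using c C by (simp_all add: u_def field_simps)
  have up: "1 - u > 0" "1 + u > 0" unfolding u using m pl c C by auto
  have t: "static_chart H (p$1, z) = (artanh u / H, sin z * C / H)"
    using c H by (simp add: static_chart_def ct st cz u_def C_def S_def tanh_def)
  have F: "F_st H (sin z * C / H) = (c * C - S) * (c * C + S)"
  proof -
    have "F_st H (sin z * C / H) = 1 - (sin z * C)\<^sup>2" using H by (simp add: F_st_def power_divide)
    then show ?thesis using CS sC pr by linarith
  qed
  have "exp (- H * (artanh u / H)) = exp (- artanh u)" using H by simp
  also have "\<dots> = exp (ln ((1 + u) / (1 - u)) * (-1/2))" by (simp add: artanh_def)
  also have "\<dots> = ((1 + u) / (1 - u)) powr (-1/2)" using up by (simp add: powr_def mult.commute)
  also have "(1 + u) / (1 - u) = (c * C + S) / (c * C - S)" unfolding u using c C m by simp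
  finally have e: "exp (- H * (artanh u / H)) = ((c * C + S) / (c * C - S)) powr (-1/2)" .
  have "Phi1_ds H p = ((c * C - S) * (c * C + S)) powr (-1/2) * ((c * C + S) / (c * C - S)) powr (-1/2)"
    using t e F by (simp add: Phi1_ds_def stereo_nth_1 z_def[symmetric] Phi1_def)
  also have "\<dots> = ((c * C + S)\<^sup>2) powr (-1/2)"
    using m pl by (subst powr_mult[symmetric]) (auto simp: power2_eq_square)
  also have "\<dots> = 1 / (c * C + S)"
    using pl powr_half_sqrt[of "(c * C + S)\<^sup>2"] by (simp add: powr_minus_divide)
  finally show "Phi1_ds H p = 1 / ell H p"
    by (simp add: ell_def c_def C_def S_def algebra_simps)
qed

section \<open>Decay and asymptotic expansion\<close>

lemma tau_Itau: "tau H \<eta> \<in> Itau"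
  using tau_bounds[of H \<eta>] by (simp add: less_imp_le)

lemma solves_conf_wave_Phi1:
  assumes "H > 0"
  shows "solves_conf_wave (ds_metric H) (static_domain H) (Phi1_ds H)"
  using Phi1_ds_eq[OF assms _ cos_tau sin_tau]
  by (intro conf_wave_inverse_ell open_static_domain) (use assms in \<open>auto simp: less_imp_neq[symmetric]\<close>)

lemma development_bounds:
  assumes H: "H > 0" and d: "development H 2 d u"
  obtains B where "B \<ge> 0" "\<And>\<eta> x. x \<in> S3 \<Longrightarrow> cmod (f_phi u \<eta> x) \<le> B / cosh (H * \<eta>)"
    "\<And>\<eta> x. x \<in> S3 \<Longrightarrow> \<bar>f_Aeta u \<eta> x\<bar> \<le> B / cosh (H * \<eta>)"
    "\<And>\<eta> x. x \<in> S3 \<Longrightarrow> norm (f_A u \<eta> x) \<le> B"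
proof -
  obtain \<phi> A A0 where sol: "ms_solution 2 \<phi> A A0"
    and eq: "\<And>\<eta> x. x \<in> S3 \<Longrightarrow> \<phi> (tau H \<eta>) x = f_phi u \<eta> x / of_real (Omega H \<eta>) \<and>
      A (tau H \<eta>) x = f_A u \<eta> x \<and> f_Aeta u \<eta> x = A0 (tau H \<eta>) x * deriv (tau H) \<eta>"
    using d unfolding development_def by blast
  obtain B where B: "B \<ge> 0" "\<And>\<tau> x. \<tau> \<in> Itau \<Longrightarrow> x \<in> S3 \<Longrightarrow> cmod (\<phi> \<tau> x) \<le> B"
    "\<And>\<tau> x. \<tau> \<in> Itau \<Longrightarrow> x \<in> S3 \<Longrightarrow> norm (A \<tau> x) \<le> B"
    "\<And>\<tau> x. \<tau> \<in> Itau \<Longrightarrow> x \<in> S3 \<Longrightarrow> \<bar>A0 \<tau> x\<bar> \<le> B"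
    using ms_solution_bounded[OF sol] by blast
  show thesis
  \<comment> \<open>A common constant: the conformal weights of the scalar field and of the time
    component bring a factor \<open>H\<close>, the spatial part brings none.\<close>
  proof (rule that[of "B * (H + 1)"])
    show "0 \<le> B * (H + 1)" using B H by simp
    fix \<eta> x assume x: "x \<in> S3"
    have le: "H / cosh (H * \<eta>) \<le> (H + 1) / cosh (H * \<eta>)" by (intro divide_right_mono) auto
    have pos: "H / cosh (H * \<eta>) > 0" using H by simp
    have "f_phi u \<eta> x = of_real (H / cosh (H * \<eta>)) * \<phi> (tau H \<eta>) x"
      using eq[OF x, of \<eta>] pos H by (simp add: Omega_eq)
    then have "cmod (f_phi u \<eta> x) = (H / cosh (H * \<eta>)) * cmod (\<phi> (tau H \<eta>) x)"
      using pos by (simp only: norm_mult norm_of_real abs_of_pos)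
    also have "\<dots> \<le> ((H + 1) / cosh (H * \<eta>)) * B"
      using le pos B(2)[OF tau_Itau x] by (intro mult_mono) auto
    finally show "cmod (f_phi u \<eta> x) \<le> B * (H + 1) / cosh (H * \<eta>)" by (simp add: mult.commute)
    have "\<bar>f_Aeta u \<eta> x\<bar> = (H / cosh (H * \<eta>)) * \<bar>A0 (tau H \<eta>) x\<bar>"
      using eq[OF x, of \<eta>] pos by (simp only: deriv_tau abs_mult abs_of_pos mult.commute)
    also have "\<dots> \<le> ((H + 1) / cosh (H * \<eta>)) * B"
      using le pos B(4)[OF tau_Itau x] by (intro mult_mono) auto
    finally show "\<bar>f_Aeta u \<eta> x\<bar> \<le> B * (H + 1) / cosh (H * \<eta>)" by (simp add: mult.commute)
    have "norm (f_A u \<eta> x) \<le> B * 1" using eq[OF x, of \<eta>] B(3)[OF tau_Itau x, of H \<eta>] by simp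
    also have "\<dots> \<le> B * (H + 1)" using B H by (intro mult_left_mono) auto
    finally show "norm (f_A u \<eta> x) \<le> B * (H + 1)" .
  qed
qed

lemma exp_bound_cosh:
  assumes "y \<le> K / cosh (H * s)" "0 \<le> K" "0 < (H::real)"
  shows "y \<le> (2 * K) * exp (- H * \<bar>s\<bar>)"
proof -
  have "K * (1 / cosh (H * s)) \<le> K * (2 * exp (- \<bar>H * s\<bar>))"
    by (intro mult_left_mono inverse_cosh_le assms)
  then show ?thesis using assms by (simp add: abs_mult)
qed

lemma global_decay:
  assumes H: "H > 0" and d: "development H 2 d u"
  shows "\<exists>C. \<forall>\<^sub>F \<eta> in at_infinity. \<forall>x\<in>S3. cmod (f_phi u \<eta> x) \<le> C * exp (- H * \<bar>\<eta>\<bar>)" (is ?phi)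
    and "\<exists>C. \<forall>\<^sub>F \<eta> in at_infinity. \<forall>x\<in>S3. \<bar>f_Aeta u \<eta> x\<bar> \<le> C * exp (- H * \<bar>\<eta>\<bar>)" (is ?Aeta)
    and "\<exists>C. \<forall>\<^sub>F \<eta> in at_infinity. \<forall>x\<in>S3. norm (f_A u \<eta> x) \<le> C" (is ?A)
proof -
  obtain B where B: "B \<ge> 0" "\<And>\<eta> x. x \<in> S3 \<Longrightarrow> cmod (f_phi u \<eta> x) \<le> B / cosh (H * \<eta>)"
    "\<And>\<eta> x. x \<in> S3 \<Longrightarrow> \<bar>f_Aeta u \<eta> x\<bar> \<le> B / cosh (H * \<eta>)"
    "\<And>\<eta> x. x \<in> S3 \<Longrightarrow> norm (f_A u \<eta> x) \<le> B"
    using development_bounds[OF assms] by blast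
  show ?phi
    by (intro exI[of _ "2 * B"] always_eventually allI ballI exp_bound_cosh B H)
  show ?Aeta
    by (intro exI[of _ "2 * B"] always_eventually allI ballI exp_bound_cosh B H)
  show ?A
    by (intro exI[of _ B] always_eventually allI ballI B)
qed

text \<open>Makes the supremum in \<open>A_ang_norm\<close> one over a nonempty set; otherwise
  bounds on the elements would say nothing about it.\<close>

lemma unit_orthogonal_exists: "\<exists>v::real^3. v \<bullet> w = 0 \<and> norm v = 1"
proof -
  obtain y :: "real^3" where y: "y \<noteq> 0" "orthogonal w y"
    using orthogonal_to_vector_exists[of w] by auto
  then show ?thesis
    by (intro exI[of _ "y /\<^sub>R norm y"]) (auto simp: orthogonal_def inner_commute)
qed

lemma static_decay:
  assumes H: "H > 0" and d: "development H 2 d u" and r: "0 < r" "r < 1 / H"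
  shows "\<exists>C. \<forall>\<^sub>F t in at_infinity. \<forall>\<omega>\<in>S2. cmod (phi_st H u t r \<omega>) \<le> C * exp (- H * \<bar>t\<bar>)" (is ?phi)
    and "\<exists>C. \<forall>\<^sub>F t in at_infinity. \<forall>\<omega>\<in>S2. \<bar>A_t H u t r \<omega>\<bar> \<le> C * exp (- H * \<bar>t\<bar>)" (is ?At)
    and "\<exists>C. \<forall>\<^sub>F t in at_infinity. \<forall>\<omega>\<in>S2. \<bar>A_r H u t r \<omega>\<bar> \<le> C * exp (- H * \<bar>t\<bar>)" (is ?Ar)
    and "\<exists>C. \<forall>\<^sub>F t in at_infinity. \<forall>\<omega>\<in>S2. 1 / r * A_ang_norm H u t r \<omega> \<le> C * exp (- H * \<bar>t\<bar>)" (is ?Aang)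
proof -
  have r0: "0 \<le> r" using r by simp
  define f where "f = sqrt (F_st H r)"
  have f: "f > 0" using F_st_pos[OF H r0 r(2)] by (simp add: f_def)
  have F: "F_st H r > 0" by (rule F_st_pos[OF H r0 r(2)])
  obtain B where B: "B \<ge> 0" "\<And>\<eta> x. x \<in> S3 \<Longrightarrow> cmod (f_phi u \<eta> x) \<le> B / cosh (H * \<eta>)"
    "\<And>\<eta> x. x \<in> S3 \<Longrightarrow> \<bar>f_Aeta u \<eta> x\<bar> \<le> B / cosh (H * \<eta>)"
    "\<And>\<eta> x. x \<in> S3 \<Longrightarrow> norm (f_A u \<eta> x) \<le> B"
    using development_bounds[OF H d] by blast
  have ch: "B / cosh (H * eta_st H t r) \<le> (B / f) / cosh (H * t)" for t
  proof -
    have "B / cosh (H * eta_st H t r) \<le> B / (f * cosh (H * t))"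
      using cosh_eta_st(2)[OF H r0 r(2), of t] f B by (intro divide_left_mono) (auto simp: f_def)
    then show ?thesis by simp
  qed
  have pt: "point_st H t r \<omega> \<in> S3" if "\<omega> \<in> S2" for t \<omega>
    using that by (simp only: point_st_def) (rule sph_S3, simp)
  show ?phi
  proof (intro exI[of _ "2 * (B / f)"] always_eventually allI ballI exp_bound_cosh)
    show "cmod (phi_st H u t r \<omega>) \<le> (B / f) / cosh (H * t)" if "\<omega> \<in> S2" for t \<omega>
      unfolding phi_st_def by (rule order_trans[OF B(2)[OF pt[OF that]] ch])
  qed (use B f H in auto)
  \<comment> \<open>The two products decay for complementary reasons: \<open>f_Aeta\<close> decays
    while the derivative \<open>y\<close> of \<open>eta_st\<close> is bounded, and
    \<open>f_A\<close> is bounded while the velocity \<open>v\<close> on the sphere decays.\<close>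
  have comp: "\<bar>f_Aeta u (eta_st H t r) (point_st H t r \<omega>) * y + f_A u (eta_st H t r) (point_st H t r \<omega>) \<bullet> v\<bar>
      \<le> (B / f * c + B * k) / cosh (H * t)"
    if w: "\<omega> \<in> S2" and v: "norm v \<le> k / cosh (H * t)" and y: "\<bar>y\<bar> \<le> c" for t \<omega> y v c k
  proof -
    let ?A = "f_A u (eta_st H t r) (point_st H t r \<omega>)" and ?Ae = "f_Aeta u (eta_st H t r) (point_st H t r \<omega>)"
    have "\<bar>?Ae * y + ?A \<bullet> v\<bar> \<le> \<bar>?Ae * y\<bar> + \<bar>?A \<bullet> v\<bar>" by (rule abs_triangle_ineq)
    also have "\<bar>?Ae * y\<bar> \<le> ((B / f) / cosh (H * t)) * c"
      unfolding abs_mult by (intro mult_mono order_trans[OF B(3)[OF pt[OF w]] ch] y) (use B f in auto)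
    also have "\<bar>?A \<bullet> v\<bar> \<le> norm ?A * norm v" by (rule Cauchy_Schwarz_ineq2)
    also have "\<dots> \<le> B * (k / cosh (H * t))"
      using v B by (intro mult_mono B(4)[OF pt[OF w]]) auto
    finally show ?thesis by (simp add: add_divide_distrib)
  qed
  define a where "a = H\<^sup>2 * r / f"
  have a: "a \<ge> 0" using H r f by (simp add: a_def)
  show ?At
  proof (intro exI[of _ "2 * (B / f + B * (3 * a))"] always_eventually allI ballI exp_bound_cosh)
    show "\<bar>A_t H u t r \<omega>\<bar> \<le> (B / f + B * (3 * a)) / cosh (H * t)" if w: "\<omega> \<in> S2" for t \<omega>
      unfolding A_t_def
    proof (rule order_trans[OF comp[OF w _ deriv_eta_st_t[OF H r0 r(2)]]])
      show "norm (vector_derivative (\<lambda>t. point_st H t r \<omega>) (at t)) \<le> 3 * a / cosh (H * t)"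
        using point_st_deriv_t[OF H r0 r(2), of \<omega> t] w by (simp add: a_def f_def)
    qed simp
  qed (use B f H a in auto)
  define b where "b = H * r / F_st H r"
  have b: "b \<ge> 0" using F H r by (simp add: b_def)
  obtain K where K: "\<And>t \<omega>. norm \<omega> = 1 \<Longrightarrow>
    norm (vector_derivative (\<lambda>r. point_st H t r \<omega>) (at r)) \<le> K / cosh (H * t)"
    using point_st_deriv_r[OF H r] by blast
  have "norm (axis 1 1 :: real^3) = 1" by (simp add: norm_axis_1)
  from order_trans[OF norm_ge_zero K[OF this, of 0]] have K0: "K \<ge> 0" by simp
  show ?Ar
  proof (intro exI[of _ "2 * (B / f * b + B * K)"] always_eventually allI ballI exp_bound_cosh)
    show "\<bar>A_r H u t r \<omega>\<bar> \<le> (B / f * b + B * K) / cosh (H * t)" if w: "\<omega> \<in> S2" for t \<omega>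
      unfolding A_r_def b_def using w by (intro comp K deriv_eta_st_r H r) auto
  qed (use B f H b K0 in auto)
  define k where "k = H * r / f"
  have k: "k \<ge> 0" using H r f by (simp add: k_def)
  show ?Aang
  proof (intro exI[of _ "2 * (1 / r * (B * k))"] always_eventually allI ballI exp_bound_cosh)
    show "1 / r * A_ang_norm H u t r \<omega> \<le> (1 / r * (B * k)) / cosh (H * t)" if w: "\<omega> \<in> S2" for t \<omega>
    proof -
      have "A_ang_norm H u t r \<omega> \<le> B * (k / cosh (H * t))"
        unfolding A_ang_norm_def
      proof (rule cSUP_least)
        show "{v. v \<bullet> \<omega> = 0 \<and> norm v = 1} \<noteq> {}" using unit_orthogonal_exists by auto
        fix v assume v: "v \<in> {v. v \<bullet> \<omega> = 0 \<and> norm v = 1}"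
        let ?A = "f_A u (eta_st H t r) (point_st H t r \<omega>)"
        let ?v = "frechet_derivative (\<lambda>\<omega>. point_st H t r \<omega>) (at \<omega>) v"
        have "\<bar>?A \<bullet> ?v\<bar> \<le> norm ?A * norm ?v" by (rule Cauchy_Schwarz_ineq2)
        also have "norm ?v = \<bar>sin (zeta_st H t r)\<bar> * norm v"
          unfolding point_st_def by (rule norm_frechet_derivative_sph)
        also have "norm ?A * (\<bar>sin (zeta_st H t r)\<bar> * norm v) \<le> B * (k / cosh (H * t))"
          using v zeta_st_bound(2)[OF H r0 r(2), of t]
          by (intro mult_mono B(4)[OF pt[OF w]]) (use B in \<open>auto simp: k_def f_def\<close>)
        finally show "\<bar>?A \<bullet> ?v\<bar> \<le> B * (k / cosh (H * t))" .
      qed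
      then have "1 / r * A_ang_norm H u t r \<omega> \<le> 1 / r * (B * (k / cosh (H * t)))"
        using r by (intro mult_left_mono) auto
      then show ?thesis by simp
    qed
  qed (use B r k H in auto)
qed

text \<open>The square root \<open>a\<close> and its leading exponential \<open>b\<close> have
  squares that differ by at most 2, so their reciprocals differ by at most \<open>1 / b^3\<close>,
  of order \<open>exp (- 3 * s)\<close>; the weaker rate is what the expansion uses.\<close>

lemma Omega_expansion:
  assumes F: "F > 0" "F \<le> 1" and s: "s \<ge> (0::real)"
  shows "\<bar>1 / sqrt (F * (sinh s)\<^sup>2 + 1) - 2 / sqrt F * exp (- s)\<bar> \<le> 8 / (sqrt F)^3 * exp (- 2 * s)"
proof -
  define f E where "f = sqrt F" and "E = exp s"
  have f: "f > 0" "f\<^sup>2 = F" "f \<le> 1" using F by (auto simp: f_def)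
  have E: "E \<ge> 1" using s by (simp add: E_def)
  define a b where "a = sqrt (F * (sinh s)\<^sup>2 + 1)" and "b = f * E / 2"
  have sh: "sinh s = (E - 1 / E) / 2" by (simp add: sinh_def E_def exp_minus inverse_eq_divide)
  have a2: "a\<^sup>2 = F * (sinh s)\<^sup>2 + 1" using F by (simp add: a_def)
  have alg: "E * i = 1 \<Longrightarrow> f\<^sup>2 * ((E - i) / 2)\<^sup>2 + 1 - (f * E / 2)\<^sup>2 = 1 - f\<^sup>2 / 2 + f\<^sup>2 * i\<^sup>2 / 4" for i
  proof -
    assume "E * i = 1"
    then have "(E - i)\<^sup>2 = E\<^sup>2 - 2 + i\<^sup>2" by algebra
    then show "f\<^sup>2 * ((E - i) / 2)\<^sup>2 + 1 - (f * E / 2)\<^sup>2 = 1 - f\<^sup>2 / 2 + f\<^sup>2 * i\<^sup>2 / 4"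
      by (simp only: power_divide power_mult_distrib) (simp add: field_simps)
  qed
  have diff: "a\<^sup>2 - b\<^sup>2 = 1 - F / 2 + F * (1 / E)\<^sup>2 / 4"
    unfolding a2 b_def sh f(2)[symmetric] by (rule alg) (use E in simp)
  have e1: "0 < 1 / E" "1 / E \<le> 1" using E by auto
  have e2: "F * (1 / E)\<^sup>2 \<le> 1"
    using F e1 by (intro mult_le_one power_le_one) auto
  have dpos: "0 \<le> a\<^sup>2 - b\<^sup>2" "a\<^sup>2 - b\<^sup>2 \<le> 2"
    unfolding diff using F e2 by (auto intro!: add_nonneg_nonneg)
  have b: "b > 0" using f E by (simp add: b_def)
  have "a \<ge> 0" by (simp add: a_def F(1) less_imp_le)
  moreover have "b\<^sup>2 \<le> a\<^sup>2" using dpos(1) by linarith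
  ultimately have ab: "b \<le> a" by (metis power2_le_imp_le)
  then have a: "a > 0" using b by linarith
  have "1 / b - 1 / a = (a\<^sup>2 - b\<^sup>2) / (a * b * (a + b))"
  proof -
    have "a\<^sup>2 - b\<^sup>2 = (a - b) * (a + b)" by algebra
    then have "(a\<^sup>2 - b\<^sup>2) / (a * b * (a + b)) = (a - b) / (a * b)" using a b by simp
    also have "\<dots> = 1 / b - 1 / a" using a b by (simp add: diff_divide_distrib)
    finally show ?thesis ..
  qed
  also have "\<dots> \<le> 2 / (b * b * (b + b))"
    using dpos a b ab by (intro frac_le mult_mono add_mono) auto
  also have "\<dots> = 8 / f^3 * (1 / E)^3"
    by (simp add: b_def power3_eq_cube)
  also have "\<dots> \<le> 8 / f^3 * (1 / E)^2"
    using f e1 by (intro mult_left_mono power_decreasing) auto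
  finally have up: "1 / b - 1 / a \<le> 8 / f^3 * (1 / E)^2" .
  have "1 / a \<le> 1 / b" using ab b by (intro divide_left_mono) auto
  then have "\<bar>1 / a - 1 / b\<bar> \<le> 8 / f^3 * (1 / E)^2" using up by linarith
  moreover have "1 / b = 2 / f * exp (- s)" by (simp add: b_def E_def exp_minus inverse_eq_divide)
  moreover have "(1 / E)^2 = exp (- 2 * s)"
    by (simp add: E_def power2_eq_square exp_minus inverse_eq_divide flip: exp_add)
  ultimately show ?thesis by (simp add: a_def f_def)
qed

lemma static_expansion:
  assumes H: "H > 0" and d: "development H 3 d u"
  shows "\<exists>c::complex. \<forall>r. 0 < r \<and> r < 1 / H \<longrightarrow>
          (\<exists>C. \<forall>\<^sub>F t in at_top. \<forall>\<omega>\<in>S2.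
            cmod (phi_st H u t r \<omega> - c * of_real (Phi1 H t r)) \<le> C * exp (- 2 * H * t))"
proof -
  obtain \<phi> A A0 where sol: "ms_solution 3 \<phi> A A0"
    and eq: "\<And>\<eta> x. x \<in> S3 \<Longrightarrow> \<phi> (tau H \<eta>) x = f_phi u \<eta> x / of_real (Omega H \<eta>)"
    using d unfolding development_def by blast
  have cont: "continuous_on S3 (\<phi> \<tau>)" if "\<tau> \<in> Itau" for \<tau>
    using sol that unfolding ms_solution_def by auto
  have C: "CbH 0 0 3 (\<lambda>\<tau>. scal (\<phi> \<tau>))"
    using sol unfolding ms_solution_def by (elim conjE allE[of _ "0::nat"]) simp
  have C1: "CbH 0 1 2 (\<lambda>\<tau>. scal (\<phi> \<tau>))"
    using sol unfolding ms_solution_def by (elim conjE allE[of _ "1::nat"]) simp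
  have pI: "pi/2 \<in> Itau" by simp
  obtain K where K: "\<forall>\<^sub>F \<sigma> in at (pi/2) within Itau. \<forall>x\<in>S3. norm (\<phi> \<sigma> x - \<phi> (pi/2) x) \<le> K * \<bar>\<sigma> - pi/2\<bar>"
    using time_lipschitz[OF C1 cont pI] by blast
  obtain M where "in_H 0 3 (scal (\<phi> (pi/2)))" using CbH_bound[OF C] pI by blast
  then obtain L where L: "\<And>\<zeta> \<omega>. norm \<omega> = 1 \<Longrightarrow>
      norm (\<phi> (pi/2) (sph \<zeta> \<omega>) - \<phi> (pi/2) (sph pi \<omega>)) \<le> L * \<bar>\<zeta> - pi\<bar>"
    using in_H_3_lipschitz[OF _ cont[OF pI]] by blast
  \<comment> \<open>The value at the South Pole; \<open>sin pi = 0\<close> makes the second argument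
    of \<open>sph\<close> immaterial.\<close>
  define p where "p = \<phi> (pi/2) (sph pi 0)"
  have pp: "\<phi> (pi/2) (sph pi \<omega>) = p" for \<omega> unfolding p_def by (simp add: sph_pi[of \<omega> 0])
  show ?thesis
  \<comment> \<open>\<open>2 * H\<close> is the ratio of the leading term of the conformal factor to
    \<open>Phi1\<close>. Since \<open>p\<close> depends neither on \<open>r\<close> nor on \<omega>,
    the constant can be fixed before \<open>r\<close>.\<close>
  proof (intro exI[of _ "of_real (2 * H) * p"] allI impI)
    fix r assume "0 < r \<and> r < 1 / H"
    then have r: "0 \<le> r" "r < 1 / H" by auto
    note F = F_st_pos[OF H r]
    define f where "f = sqrt (F_st H r)"
    have f: "f > 0" using F by (simp add: f_def)
    define k where "k = H * r / f"
    have k: "k \<ge> 0" using H r f by (simp add: k_def)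
    have cl: "1 / cosh (H * eta_st H t r) \<le> 2 / f * exp (- H * t)" if t: "t \<ge> 0" for t
    proof -
      have "1 / cosh (H * eta_st H t r) \<le> 1 / (f * cosh (H * t))"
        using cosh_eta_st(2)[OF H r, of t] f by (intro divide_left_mono) (auto simp: f_def)
      also have "\<dots> = 1 / f * (1 / cosh (H * t))" by simp
      also have "\<dots> \<le> 1 / f * (2 * exp (- \<bar>H * t\<bar>))"
        using f by (intro mult_left_mono inverse_cosh_le) auto
      finally show ?thesis using t H by simp
    qed
    have tl: "\<bar>tau H (eta_st H t r) - pi/2\<bar> \<le> 8 / f * exp (- H * t)" if t: "t \<ge> 0" for t
    proof -
      have "0 \<le> H * eta_st H t r"
      proof -
        have "sinh 0 \<le> sinh (H * eta_st H t r)"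
          using t H f by (simp add: static_coords[OF H r] f_def[symmetric] sinh_arsinh_real)
        then show ?thesis by (simp only: sinh_real_le_iff)
      qed
      from half_pi_minus_tau[OF this] cl[OF t] show ?thesis by simp
    qed
    have zl: "\<bar>zeta_st H t r - pi\<bar> \<le> 2 * k * exp (- H * t)" if t: "t \<ge> 0" for t
    proof -
      have "\<bar>zeta_st H t r - pi\<bar> \<le> k / cosh (H * t)"
        using zeta_st_bound(1)[OF H r, of t] by (simp add: k_def f_def)
      from exp_bound_cosh[OF this k H] t show ?thesis by simp
    qed
    \<comment> \<open>The estimate in time holds on a punctured neighbourhood of
      \<open>pi/2\<close>, so the limit is taken within it; \<open>tau\<close> never reaches the end
      point.\<close>
    have lim: "filterlim (\<lambda>t. tau H (eta_st H t r)) (at (pi/2) within Itau) at_top"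
      unfolding filterlim_at
    proof
      show "\<forall>\<^sub>F t in at_top. tau H (eta_st H t r) \<in> Itau \<and> tau H (eta_st H t r) \<noteq> pi/2"
        by (intro always_eventually allI conjI tau_Itau) (use tau_bounds(2) in \<open>auto simp: less_imp_neq\<close>)
      have "((\<lambda>t. 8 / f * exp (- H * t)) \<longlongrightarrow> 8 / f * 0) at_top"
        by (intro tendsto_mult tendsto_const filterlim_compose[OF exp_at_bot]
            filterlim_tendsto_neg_mult_at_bot[OF tendsto_const _ filterlim_ident]) (use H in auto)
      then have l0: "((\<lambda>t. 8 / f * exp (- H * t)) \<longlongrightarrow> 0) at_top" by simp
      have "\<forall>\<^sub>F t in at_top. norm (tau H (eta_st H t r) - pi/2) \<le> 8 / f * exp (- H * t)"
        using eventually_ge_at_top[of "0::real"] by eventually_elim (unfold real_norm_def, rule tl)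
      from Lim_null_comparison[OF this l0]
      have "((\<lambda>t. tau H (eta_st H t r) - pi/2) \<longlongrightarrow> 0) at_top" .
      then show "((\<lambda>t. tau H (eta_st H t r)) \<longlongrightarrow> pi/2) at_top" by (rule LIM_zero_cancel)
    qed
    define D where "D = (H * (2 / f)) * (\<bar>K\<bar> * (8 / f) + \<bar>L\<bar> * (2 * k)) + cmod p * (H * (8 / f^3))"
    let ?R = "\<lambda>t \<omega>. phi_st H u t r \<omega> - of_real (2 * H) * p * of_real (Phi1 H t r)"
    have "\<forall>\<^sub>F t in at_top. \<forall>x\<in>S3. norm (\<phi> (tau H (eta_st H t r)) x - \<phi> (pi/2) x) \<le> K * \<bar>tau H (eta_st H t r) - pi/2\<bar>"
      using K lim unfolding filterlim_iff by blast
    then have "\<forall>\<^sub>F t in at_top. \<forall>\<omega>\<in>S2.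
        cmod (?R t \<omega>) \<le> D * exp (- 2 * H * t)"
      using eventually_ge_at_top[of "0::real"]
    proof eventually_elim
      case (elim t)
      show ?case
      proof
        fix \<omega> assume w: "\<omega> \<in> S2"
        then have nw: "norm \<omega> = 1" by simp
        let ?x = "point_st H t r \<omega>" and ?\<tau> = "tau H (eta_st H t r)"
        let ?d1 = "\<phi> ?\<tau> ?x - \<phi> (pi/2) ?x" and ?d2 = "\<phi> (pi/2) ?x - p"
        have x: "?x \<in> S3" unfolding point_st_def by (rule sph_S3[OF nw])
        define O1 where "O1 = H / cosh (H * eta_st H t r)"
        define O2 where "O2 = 2 * H / f * exp (- H * t)"
        define e where "e = exp (- H * t)"
        have ee: "e * e = exp (- 2 * H * t)" by (simp add: e_def flip: exp_add)
        have O1p: "O1 > 0" using H by (simp add: O1_def)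
        have phi: "phi_st H u t r \<omega> = of_real O1 * \<phi> ?\<tau> ?x"
          using eq[OF x, of "eta_st H t r"] O1p H by (simp add: phi_st_def Omega_eq O1_def)
        have main: "of_real (2 * H) * p * of_real (Phi1 H t r) = of_real O2 * p"
        proof -
          have "F_st H r powr (-1/2) = 1 / f"
            using F powr_half_sqrt[of "F_st H r"] by (simp add: f_def powr_minus_divide)
          then show ?thesis by (simp add: Phi1_def O2_def)
        qed
        \<comment> \<open>In the first product the conformal factor and the differences in time and
          space are each of size \<open>e\<close>; in the second, the error of the conformal factor
          is of size \<open>e * e\<close>.\<close>
        have "?R t \<omega>
            = of_real O1 * (?d1 + ?d2) + of_real (O1 - O2) * p"
          unfolding phi main by (simp add: algebra_simps)
        also have "cmod \<dots> \<le> O1 * (cmod ?d1 + cmod ?d2) + \<bar>O1 - O2\<bar> * cmod p"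
        proof -
          have "cmod (of_real O1 * (?d1 + ?d2))
              \<le> O1 * (cmod ?d1 + cmod ?d2)"
            unfolding norm_mult norm_of_real using O1p by (intro mult_mono norm_triangle_ineq) auto
          moreover have "cmod (of_real (O1 - O2) * p) = \<bar>O1 - O2\<bar> * cmod p" by (simp only: norm_mult norm_of_real)
          ultimately show ?thesis by (intro order_trans[OF norm_triangle_ineq] add_mono) auto
        qed
        also have "\<dots> \<le> (H * (2 / f) * e) * (\<bar>K\<bar> * (8 / f * e) + \<bar>L\<bar> * (2 * k * e)) + (H * (8 / f^3 * (e * e))) * cmod p"
        proof (intro add_mono mult_mono)
          show "O1 \<le> H * (2 / f) * e"
            using mult_left_mono[OF cl[OF elim(2)], of H] H by (simp add: O1_def e_def)
          have "cmod ?d1 \<le> K * \<bar>?\<tau> - pi/2\<bar>" using elim(1) x by blast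
          also have "\<dots> \<le> \<bar>K\<bar> * (8 / f * e)"
            using tl[OF elim(2)] by (intro mult_mono) (auto simp: e_def)
          finally show "cmod ?d1 \<le> \<bar>K\<bar> * (8 / f * e)" .
          have "cmod ?d2 \<le> L * \<bar>zeta_st H t r - pi\<bar>"
            using L[OF nw, of "zeta_st H t r"] by (simp add: pp point_st_def)
          also have "\<dots> \<le> \<bar>L\<bar> * (2 * k * e)"
            using zl[OF elim(2)] by (intro mult_mono) (auto simp: e_def)
          finally show "cmod ?d2 \<le> \<bar>L\<bar> * (2 * k * e)" .
          have "\<bar>O1 - O2\<bar> = H * \<bar>1 / cosh (H * eta_st H t r) - 2 / f * e\<bar>"
          proof -
            have "O1 - O2 = H * (1 / cosh (H * eta_st H t r) - 2 / f * e)"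
              by (simp add: O1_def O2_def e_def right_diff_distrib)
            then show ?thesis using H by (simp add: abs_mult)
          qed
          also have "\<dots> \<le> H * (8 / f^3 * (e * e))"
            using Omega_expansion[OF F F_st_le_1, of "H * t"] H elim(2)
            by (intro mult_left_mono) (auto simp: cosh_eta_st(1)[OF H r] f_def e_def mult.assoc simp flip: exp_add)
          finally show "\<bar>O1 - O2\<bar> \<le> H * (8 / f^3 * (e * e))" .
        qed (use H f in \<open>auto simp: e_def\<close>)
        also have "\<dots> = D * (e * e)" unfolding D_def by algebra
        finally show "cmod (?R t \<omega>) \<le> D * exp (- 2 * H * t)"
          by (simp only: ee)
      qed
    qed
    then show "\<exists>C. \<forall>\<^sub>F t in at_top. \<forall>\<omega>\<in>S2.
        cmod (?R t \<omega>) \<le> C * exp (- 2 * H * t)" by blast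
  qed
qed

theorem theorem5p4:
  fixes H :: real
  assumes "H > 0"
  shows "\<exists>\<epsilon>>0.
    (\<forall>d u. admissible H 2 d \<and> development H 2 d u \<and> data_size 2 d \<le> \<epsilon> \<longrightarrow>
      (\<exists>C. \<forall>\<^sub>F \<eta> in at_infinity. \<forall>x\<in>S3. cmod (f_phi u \<eta> x) \<le> C * exp (- H * \<bar>\<eta>\<bar>)) \<and>
      (\<exists>C. \<forall>\<^sub>F \<eta> in at_infinity. \<forall>x\<in>S3. \<bar>f_Aeta u \<eta> x\<bar> \<le> C * exp (- H * \<bar>\<eta>\<bar>)) \<and>
      (\<exists>C. \<forall>\<^sub>F \<eta> in at_infinity. \<forall>x\<in>S3. norm (f_A u \<eta> x) \<le> C) \<and>
      (\<forall>r. 0 < r \<and> r < 1 / H \<longrightarrow>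
        (\<exists>C. \<forall>\<^sub>F t in at_infinity. \<forall>\<omega>\<in>S2. cmod (phi_st H u t r \<omega>) \<le> C * exp (- H * \<bar>t\<bar>)) \<and>
        (\<exists>C. \<forall>\<^sub>F t in at_infinity. \<forall>\<omega>\<in>S2. \<bar>A_t H u t r \<omega>\<bar> \<le> C * exp (- H * \<bar>t\<bar>)) \<and>
        (\<exists>C. \<forall>\<^sub>F t in at_infinity. \<forall>\<omega>\<in>S2. \<bar>A_r H u t r \<omega>\<bar> \<le> C * exp (- H * \<bar>t\<bar>)) \<and>
        (\<exists>C. \<forall>\<^sub>F t in at_infinity. \<forall>\<omega>\<in>S2. 1 / r * A_ang_norm H u t r \<omega> \<le> C * exp (- H * \<bar>t\<bar>))) \<and>
      (admissible H 3 d \<and> development H 3 d u \<and> data_size 3 d \<le> \<epsilon> \<longrightarrow>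
        (\<exists>c::complex. \<forall>r. 0 < r \<and> r < 1 / H \<longrightarrow>
          (\<exists>C. \<forall>\<^sub>F t in at_top. \<forall>\<omega>\<in>S2.
            cmod (phi_st H u t r \<omega> - c * of_real (Phi1 H t r)) \<le> C * exp (- 2 * H * t))))) \<and>
    solves_conf_wave (ds_metric H) (static_domain H) (Phi1_ds H)"
  by (rule exI[of _ 1], intro conjI allI impI)
    (assumption | rule zero_less_one global_decay[OF assms] static_decay[OF assms]
      static_expansion[OF assms] solves_conf_wave_Phi1[OF assms] | erule conjE)+

end
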